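(* Let $1\le p<\infty$ and $\mathbf{w}\in\mathcal{W}$. Suppose $(\mathbf{y}_n)_{n=1}^\infty$ is a subsymmetric basic sequence in $g(\mathbf{w},p)$. Then every subsymmetric basis for $Y=[\mathbf{y}_n]_{n=1}^\infty$ is equivalent to $(\mathbf{y}_n)_{n=1}^\infty$. In particular, every subsymmetric basis in $g(\mathbf{w},p)$ is equivalent to the canonical basis of $g(\mathbf{w},p)$.
   Context: $\mathbb{F}$ is the real or complex field. $\mathcal{W}$ is the set of sequences $\mathbf{w}=(w_n)_{n=1}^\infty$ in $c_0\setminus\ell_1$ of positive reals with $1=w_1\ge w_2\ge\cdots\ge w_n\ge w_{n+1}\ge\cdots>0$. $\mathcal{O}$ is the set of (strictly) increasing functions from $\mathbb{N}$ to $\mathbb{N}$. For $f=(a_n)_{n=1}^\infty\in\mathbb{F}^{\mathbb{N}}$ put $\|f\|_{g}=\sup_{\phi\in\mathcal{O}}\left(\sum_{n=1}^\infty|a_{\phi(n)}|^pw_n\right)^{1/p}$; the Garling sequence space is the Banach space $g(\mathbf{w},p)=\{f\in\mathbb{F}^{\mathbb{N}}:\|f\|_g<\infty\}$, whose canonical basis consists of the unit vectors $\mathbf{e}_n=(\delta_{k,n})_{k=1}^\infty$. $[\mathbf{y}_n]_{n=1}^\infty$ denotes the closed linear span. Two basic sequences $(\mathbf{x}_n)$, $(\mathbf{y}_n)$ are equivalent if there is $C>0$ with $C^{-1}\|\sum a_n\mathbf{y}_n\|\le\|\sum a_n\mathbf{x}_n\|\le C\|\sum a_n\mathbf{y}_n\|$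 for all finitely supported scalar sequences $(a_n)$. A basic sequence $(\mathbf{x}_n)$ is unconditional if $(\mathbf{x}_{\sigma(n)})$ is a basic sequence for every permutation $\sigma$ of $\mathbb{N}$; it is subsymmetric if it is unconditional and equivalent to all its subsequences. *)

theory Defs
  imports "HOL-Analysis.Analysis" "HOL-Library.Function_Algebras"
begin

text \<open>
  Sequences are indexed by \<^typ>\<open>nat\<close> starting at 0, so \<open>w n\<close> is the
  \<open>(n + 1)\<close>-st weight. The scalar field is a type of sort
  \<open>{real_normed_field, euclidean_space}\<close>; its instances \<^typ>\<open>real\<close> and \<^typ>\<open>complex\<close>
  are, up to isometric isomorphism, the only ones.
\<close>


subsection \<open>Bases in normed spaces of scalar sequences\<close>

text \<open>
  A normed space is given by a set \<open>X\<close> of scalar sequences, closed under the pointwise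
  operations, and a function \<open>N\<close> that is a norm on \<open>X\<close> (its values outside \<open>X\<close> are
  irrelevant).
\<close>

definition seq_scale :: "'a::field \<Rightarrow> (nat \<Rightarrow> 'a) \<Rightarrow> (nat \<Rightarrow> 'a)" where
  "seq_scale c f = (\<lambda>k. c * f k)"

definition norm_topology ::
    "(nat \<Rightarrow> 'a::field) set \<Rightarrow> ((nat \<Rightarrow> 'a) \<Rightarrow> real) \<Rightarrow> (nat \<Rightarrow> 'a) topology" where
  "norm_topology X N = Metric_space.mtopology X (\<lambda>f g. N (f - g))"

definition closed_span ::
    "(nat \<Rightarrow> 'a::field) set \<Rightarrow> ((nat \<Rightarrow> 'a) \<Rightarrow> real) \<Rightarrow> (nat \<Rightarrow> nat \<Rightarrow> 'a) \<Rightarrow> (nat \<Rightarrow> 'a) set" where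
  "closed_span X N x = norm_topology X N closure_of module.span seq_scale (range x)"

definition schauder_basis ::
    "(nat \<Rightarrow> 'a::field) set \<Rightarrow> ((nat \<Rightarrow> 'a) \<Rightarrow> real) \<Rightarrow> (nat \<Rightarrow> 'a) set \<Rightarrow> (nat \<Rightarrow> nat \<Rightarrow> 'a) \<Rightarrow> bool" where
  "schauder_basis X N Y x \<longleftrightarrow>
     range x \<subseteq> Y \<and>
     (\<forall>f\<in>Y. \<exists>!a. limitin (norm_topology X N) (\<lambda>n. \<Sum>k<n. seq_scale (a k) (x k)) f sequentially)"

definition basic_sequence ::
    "(nat \<Rightarrow> 'a::field) set \<Rightarrow> ((nat \<Rightarrow> 'a) \<Rightarrow> real) \<Rightarrow> (nat \<Rightarrow> nat \<Rightarrow> 'a) \<Rightarrow> bool" where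
  "basic_sequence X N x \<longleftrightarrow> range x \<subseteq> X \<and> schauder_basis X N (closed_span X N x) x"

definition fin_comb :: "(nat \<Rightarrow> 'a::field) \<Rightarrow> (nat \<Rightarrow> nat \<Rightarrow> 'a) \<Rightarrow> (nat \<Rightarrow> 'a)" where
  "fin_comb a x = (\<Sum>n | a n \<noteq> 0. seq_scale (a n) (x n))"

definition equivalent_seqs ::
    "((nat \<Rightarrow> 'a::field) \<Rightarrow> real) \<Rightarrow> (nat \<Rightarrow> nat \<Rightarrow> 'a) \<Rightarrow> (nat \<Rightarrow> nat \<Rightarrow> 'a) \<Rightarrow> bool" where
  "equivalent_seqs N x y \<longleftrightarrow>
     (\<exists>C>0. \<forall>a. finite {n. a n \<noteq> 0} \<longrightarrow>
        inverse C * N (fin_comb a y) \<le> N (fin_comb a x) \<and>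
        N (fin_comb a x) \<le> C * N (fin_comb a y))"

definition unconditional ::
    "(nat \<Rightarrow> 'a::field) set \<Rightarrow> ((nat \<Rightarrow> 'a) \<Rightarrow> real) \<Rightarrow> (nat \<Rightarrow> nat \<Rightarrow> 'a) \<Rightarrow> bool" where
  "unconditional X N x \<longleftrightarrow>
     basic_sequence X N x \<and> (\<forall>\<sigma>. bij \<sigma> \<longrightarrow> basic_sequence X N (x \<circ> \<sigma>))"

definition subsymmetric ::
    "(nat \<Rightarrow> 'a::field) set \<Rightarrow> ((nat \<Rightarrow> 'a) \<Rightarrow> real) \<Rightarrow> (nat \<Rightarrow> nat \<Rightarrow> 'a) \<Rightarrow> bool" where
  "subsymmetric X N x \<longleftrightarrow>
     unconditional X N x \<and> (\<forall>\<phi>. strict_mono \<phi> \<longrightarrow> equivalent_seqs N x (x \<circ> \<phi>))"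

definition subsymmetric_basis ::
    "(nat \<Rightarrow> 'a::field) set \<Rightarrow> ((nat \<Rightarrow> 'a) \<Rightarrow> real) \<Rightarrow> (nat \<Rightarrow> 'a) set \<Rightarrow> (nat \<Rightarrow> nat \<Rightarrow> 'a) \<Rightarrow> bool" where
  "subsymmetric_basis X N Y x \<longleftrightarrow> schauder_basis X N Y x \<and> subsymmetric X N x"


subsection \<open>Garling sequence spaces\<close>

definition weights :: "(nat \<Rightarrow> real) set" where
  "weights = {w. w \<longlonglongrightarrow> 0 \<and> \<not> summable w \<and> w 0 = 1 \<and> decseq w \<and> (\<forall>n. w n > 0)}"

definition ennreal_powr :: "ennreal \<Rightarrow> real \<Rightarrow> ennreal" where
  "ennreal_powr t r = (if t = \<infinity> then \<infinity> else ennreal (enn2real t powr r))"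

definition garling_ext_norm :: "(nat \<Rightarrow> real) \<Rightarrow> real \<Rightarrow> (nat \<Rightarrow> 'a::real_normed_field) \<Rightarrow> ennreal" where
  "garling_ext_norm w p f =
     (SUP \<phi>\<in>{\<phi> :: nat \<Rightarrow> nat. strict_mono \<phi>}.
        ennreal_powr (\<Sum>n. ennreal (norm (f (\<phi> n)) powr p * w n)) (1 / p))"

definition garling_space :: "(nat \<Rightarrow> real) \<Rightarrow> real \<Rightarrow> (nat \<Rightarrow> 'a::real_normed_field) set" where
  "garling_space w p = {f. garling_ext_norm w p f < \<infinity>}"

text \<open>Meaningful only on \<^const>\<open>garling_space\<close>: \<^const>\<open>enn2real\<close> sends \<open>\<infinity>\<close> to 0.\<close>

definition garling_norm :: "(nat \<Rightarrow> real) \<Rightarrow> real \<Rightarrow> (nat \<Rightarrow> 'a::real_normed_field) \<Rightarrow> real" where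
  "garling_norm w p f = enn2real (garling_ext_norm w p f)"

definition unit_vec :: "nat \<Rightarrow> nat \<Rightarrow> 'a::field" where
  "unit_vec n = (\<lambda>k. if k = n then 1 else 0)"

end

theory Submission
  imports Defs
begin

text \<open>
  Let \<open>x\<close> and \<open>y\<close> be subsymmetric sequences of \<open>g(w, p)\<close> such that \<open>x\<close> lies in the closed span of
  \<open>y\<close>. It suffices to show that \<open>x\<close> dominates \<open>y\<close>, that is,
  \<open>\<parallel>\<Sum> a\<^sub>n y\<^sub>n\<parallel> \<le> C \<parallel>\<Sum> a\<^sub>n x\<^sub>n\<parallel>\<close> (\<open>subsymmetric_dominates\<close>): if \<open>x\<close> is a basis of the closed span of
  \<open>y\<close>, then \<open>y\<close> also lies in the closed span of \<open>x\<close>, and the roles can be exchanged. For the second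
  assertion, the canonical basis is subsymmetric and its closed span is the whole space.

  Expand \<open>x\<^sub>n = \<Sum> c\<^sub>n\<^sub>k y\<^sub>k\<close>. There are three cases.

  \<^item> Some coordinate \<open>c\<^sub>n\<^sub>k\<close>, for fixed \<open>k\<close>, does not tend to \<open>0\<close> as \<open>n \<rightarrow> \<infinity>\<close>. A bounded functional
    is then bounded away from \<open>0\<close> along a subsequence of \<open>x\<close>, so by unconditionality \<open>x\<close> dominates the
    basis of \<open>\<ell>\<^sub>1\<close>, which dominates every bounded sequence.
  \<^item> All coordinates tend to \<open>0\<close>, but not uniformly in \<open>k\<close>. Then along suitable indices \<open>n\<^sub>j\<close> and \<open>k\<^sub>j\<close>
    the matrix of coordinates is bounded away from \<open>0\<close> on the diagonal and summably small off it, and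
    projecting the combinations of the \<open>x\<^sub>n\<^sub>j\<close> onto the \<open>y\<^sub>k\<^sub>j\<close> shows that \<open>x\<close> dominates \<open>y\<close>.
  \<^item> The coordinates tend to \<open>0\<close> uniformly in \<open>k\<close>. Up to equivalence, \<open>y\<close> may be replaced by a disjointly
    and finitely supported sequence \<open>b\<close>, in \<open>g(w, p)\<close> or in \<open>\<ell>\<^sub>1\<close> (\<open>disjoint_model\<close>). Since
    a set of small coefficients loses little when its first elements are deleted, the weights do not
    impede gluing such sets, and vectors with uniformly vanishing coefficients have a
    subsequence that dominates the basis of \<open>\<ell>\<^sub>p\<close> (\<open>vanishing_coefficients_dominate_ell\<close>). So \<open>x\<close> dominates
    the basis of \<open>\<ell>\<^sub>p\<close> (of \<open>\<ell>\<^sub>1\<close> in the second case), which dominates \<open>b\<close> by the upper \<open>p\<close>-estimate \<open>norm_comb_disjoint_le\<close>.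

  The general facts behind this are that the partial sum projections of a Schauder basis are uniformly
  bounded and that bounded multipliers act boundedly on the expansions in an unconditional basis. Both
  follow from Zabreiko's lemma that a countably subadditive seminorm on a Banach space is bounded
  (\<open>countably_subadditive_seminorm_bounded\<close>).
\<close>

section \<open>Scalar sequences and linear combinations\<close>

lemma sum_fun_apply: "(\<Sum>k\<in>A. F k) i = (\<Sum>k\<in>A. F k i)"
  for F :: "'b \<Rightarrow> 'c \<Rightarrow> 'd::comm_monoid_add"
  by (induction A rule: infinite_finite_induct) auto

lemma diff_fun_apply: "(f - g) i = f i - g i"
  for f g :: "'c \<Rightarrow> 'd::ab_group_add"
  by (simp add: fun_diff_def)

lemma seq_scale_apply: "seq_scale c f k = c * f k"
  by (simp add: seq_scale_def)

interpretation seq: vector_space "seq_scale :: 'a::field \<Rightarrow> _"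
  by standard (auto simp: seq_scale_def algebra_simps fun_eq_iff)

text \<open>The linear combination of the vectors \<open>x k\<close> with coefficients \<open>a k\<close>, over \<open>k \<in> A\<close>;
  it is \<open>0\<close> when \<open>A\<close> is infinite.\<close>

definition comb :: "(nat \<Rightarrow> 'a::field) \<Rightarrow> (nat \<Rightarrow> nat \<Rightarrow> 'a) \<Rightarrow> nat set \<Rightarrow> (nat \<Rightarrow> 'a)" where
  "comb a x A = (\<Sum>k\<in>A. seq_scale (a k) (x k))"

lemma comb_empty [simp]: "comb a x {} = 0"
  by (simp add: comb_def)

lemma comb_insert: "finite A \<Longrightarrow> k \<notin> A \<Longrightarrow> comb a x (insert k A) = seq_scale (a k) (x k) + comb a x A"
  by (simp add: comb_def)

lemma comb_add: "comb (\<lambda>k. a k + b k) x A = comb a x A + comb b x A"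
  by (simp add: comb_def seq.scale_left_distrib sum.distrib)

lemma comb_diff: "comb (\<lambda>k. a k - b k) x A = comb a x A - comb b x A"
  by (simp add: comb_def seq.scale_left_diff_distrib sum_subtractf)

lemma comb_diff_right: "comb a (\<lambda>k. x k - y k) A = comb a x A - comb a y A"
  by (simp add: comb_def seq.scale_right_diff_distrib sum_subtractf)

lemma comb_scale: "comb (\<lambda>k. c * a k) x A = seq_scale c (comb a x A)"
  by (simp add: comb_def seq.scale_sum_right)

lemma comb_cong: "(\<And>k. k \<in> A \<Longrightarrow> a k = b k) \<Longrightarrow> (\<And>k. k \<in> A \<Longrightarrow> x k = y k) \<Longrightarrow> comb a x A = comb b y A"
  by (simp add: comb_def)

lemma comb_union_disjoint: "finite A \<Longrightarrow> finite B \<Longrightarrow> A \<inter> B = {} \<Longrightarrow> comb a x (A \<union> B) = comb a x A + comb a x B"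
  by (simp add: comb_def sum.union_disjoint)

lemma comb_restrict:
  assumes "finite B" "A \<subseteq> B" "\<And>k. k \<in> B - A \<Longrightarrow> a k = 0"
  shows "comb a x B = comb a x A"
  unfolding comb_def using assms
  by (intro sum.mono_neutral_right) (auto simp: seq_scale_def fun_eq_iff)

lemma comb_comp:
  assumes "inj_on \<phi> A"
  shows "comb (a \<circ> \<phi>) (x \<circ> \<phi>) A = comb a x (\<phi> ` A)"
  unfolding comb_def by (simp add: sum.reindex[OF assms])

lemma comb_subseq:
  assumes "inj \<phi>"
  shows "comb a (x \<circ> \<phi>) A = comb (a \<circ> inv \<phi>) x (\<phi> ` A)"
  using comb_comp[of \<phi> A "a \<circ> inv \<phi>" x] assms
  by (simp add: inj_on_subset[OF assms] comp_assoc)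

lemma comb_apply: "comb a x A i = (\<Sum>k\<in>A. a k * x k i)"
  by (simp add: comb_def sum_fun_apply seq_scale_apply)

lemma fin_comb_eq: "fin_comb a x = comb a x {n. a n \<noteq> 0}"
  by (simp add: fin_comb_def comb_def)

lemma comb_in_span: "comb a x A \<in> seq.span (range x)"
  unfolding comb_def by (intro seq.span_sum seq.span_scale seq.span_base) auto

lemma in_span_range_comb:
  assumes "f \<in> seq.span (range x)"
  obtains a A where "finite A" "f = comb a x A"
proof -
  have "\<exists>a A. finite A \<and> f = comb a x A"
    using assms
  proof (induction rule: seq.span_induct_alt)
    case base
    show ?case by (rule exI[of _ "\<lambda>_. 0"], rule exI[of _ "{}"]) simp
  next
    case (step c v g)
    then obtain k a A where *: "v = x k" "finite A" "g = comb a x A" by auto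
    define b where "b = (\<lambda>j. if j \<in> A then a j else 0)"
    have g: "g = comb b x (insert k A)"
      using * by (subst comb_restrict[of _ A]) (auto simp: b_def intro: comb_cong)
    have "seq_scale c v = comb (\<lambda>j. if j = k then c else 0) x (insert k A)"
      using * by (subst comb_restrict[of _ "{k}"]) (auto simp: comb_def)
    then have "seq_scale c v + g = comb (\<lambda>j. (if j = k then c else 0) + b j) x (insert k A)"
      by (simp only: comb_add g)
    then show ?case using * by blast
  qed
  then show ?thesis using that by blast
qed

section \<open>Banach spaces of scalar sequences\<close>

text \<open>
  A complete normed space \<open>X\<close> of scalar sequences. Nonnegativity and invariance under
  \<open>f \<mapsto> - f\<close> are required of \<open>N\<close> outside \<open>X\<close> as well, so that \<open>N (f - g)\<close> satisfies the
  axioms of \<^locale>\<open>Metric_space\<close>, which are not all relative to the carrier.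
\<close>

locale banach_seq =
  fixes X :: "(nat \<Rightarrow> 'a::{real_normed_field, euclidean_space}) set"
    and N :: "(nat \<Rightarrow> 'a) \<Rightarrow> real"
  assumes zero_mem: "0 \<in> X"
    and add_mem: "f \<in> X \<Longrightarrow> g \<in> X \<Longrightarrow> f + g \<in> X"
    and scale_mem: "f \<in> X \<Longrightarrow> seq_scale c f \<in> X"
    and N_nonneg: "0 \<le> N f"
    and N_minus: "N (- f) = N f"
    and N_eq_0: "f \<in> X \<Longrightarrow> N f = 0 \<Longrightarrow> f = 0"
    and N_triangle: "f \<in> X \<Longrightarrow> g \<in> X \<Longrightarrow> N (f + g) \<le> N f + N g"
    and N_scale: "f \<in> X \<Longrightarrow> N (seq_scale c f) = norm c * N f"
    and complete: "(\<And>n. s n \<in> X) \<Longrightarrow> (\<And>e. 0 < e \<Longrightarrow> \<exists>M. \<forall>m\<ge>M. \<forall>n\<ge>M. N (s m - s n) < e)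
      \<Longrightarrow> \<exists>f\<in>X. (\<lambda>n. N (s n - f)) \<longlonglongrightarrow> 0"
begin

lemma N_zero: "N 0 = 0"
  using N_scale[OF zero_mem, of 0] by simp

lemma minus_mem: "f \<in> X \<Longrightarrow> - f \<in> X"
  using scale_mem[of f "-1"] by simp

lemma diff_mem: "f \<in> X \<Longrightarrow> g \<in> X \<Longrightarrow> f - g \<in> X"
  using add_mem[of f "-g"] minus_mem[of g] by simp

lemma sum_mem: "(\<And>k. k \<in> A \<Longrightarrow> F k \<in> X) \<Longrightarrow> (\<Sum>k\<in>A. F k) \<in> X"
  by (induction A rule: infinite_finite_induct) (auto intro: zero_mem add_mem)

lemma comb_mem: "(\<And>k. k \<in> A \<Longrightarrow> x k \<in> X) \<Longrightarrow> comb a x A \<in> X"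
  unfolding comb_def by (intro sum_mem scale_mem)

lemma N_commute: "N (f - g) = N (g - f)"
  using N_minus[of "f - g"] by simp

lemma N_diff_triangle: "f \<in> X \<Longrightarrow> g \<in> X \<Longrightarrow> N (f - g) \<le> N f + N g"
  using N_triangle[of f "- g"] minus_mem[of g] N_minus[of g] by simp

lemma N_le_diff: "f \<in> X \<Longrightarrow> g \<in> X \<Longrightarrow> N f \<le> N g + N (f - g)"
  using N_triangle[of g "f - g"] diff_mem[of f g] by simp

lemma N_triangle3: "f \<in> X \<Longrightarrow> g \<in> X \<Longrightarrow> h \<in> X \<Longrightarrow> N (f - h) \<le> N (f - g) + N (g - h)"
  using N_triangle[of "f - g" "g - h"] diff_mem by simp

lemma N_sum: "(\<And>k. k \<in> A \<Longrightarrow> F k \<in> X) \<Longrightarrow> N (\<Sum>k\<in>A. F k) \<le> (\<Sum>k\<in>A. N (F k))"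
proof (induction A rule: infinite_finite_induct)
  case (insert k A)
  then have "N (F k + (\<Sum>k\<in>A. F k)) \<le> N (F k) + N (\<Sum>k\<in>A. F k)"
    by (intro N_triangle sum_mem) auto
  moreover have "N (\<Sum>k\<in>A. F k) \<le> (\<Sum>k\<in>A. N (F k))"
    using insert by auto
  ultimately show ?case
    unfolding sum.insert[OF insert.hyps] by linarith
qed (auto simp: N_zero)

lemma N_comb: "(\<And>k. k \<in> A \<Longrightarrow> x k \<in> X) \<Longrightarrow> N (comb a x A) \<le> (\<Sum>k\<in>A. norm (a k) * N (x k))"
  unfolding comb_def
  by (rule order_trans[OF N_sum]) (auto intro!: scale_mem sum_mono simp: N_scale)

lemma N_lim:
  assumes "f \<in> X" "\<And>n. s n \<in> X" "(\<lambda>n. N (s n - f)) \<longlonglongrightarrow> 0"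
  shows "(\<lambda>n. N (s n)) \<longlonglongrightarrow> N f"
proof -
  have "\<bar>N (s n) - N f\<bar> \<le> N (s n - f)" for n
    using N_le_diff[of f "s n"] N_le_diff[of "s n" f] assms N_commute[of f "s n"] by force
  then show ?thesis
    by (intro LIM_zero_cancel[OF tendsto_rabs_zero_cancel[OF tendsto_sandwich[OF _ _ tendsto_const assms(3)]]]) auto
qed

lemma lim_add:
  assumes "f \<in> X" "g \<in> X" "\<And>n. s n \<in> X" "\<And>n. t n \<in> X"
    "(\<lambda>n. N (s n - f)) \<longlonglongrightarrow> 0" "(\<lambda>n. N (t n - g)) \<longlonglongrightarrow> 0"
  shows "(\<lambda>n. N ((s n + t n) - (f + g))) \<longlonglongrightarrow> 0"
proof (rule tendsto_sandwich[OF _ _ tendsto_const tendsto_add_zero[OF assms(5,6)]])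
  show "\<forall>\<^sub>F n in sequentially. N ((s n + t n) - (f + g)) \<le> N (s n - f) + N (t n - g)"
    using N_triangle[of "s n - f" "t n - g" for n] assms diff_mem
    by (intro always_eventually allI) (simp add: algebra_simps)
qed (auto simp: N_nonneg)

lemma lim_scale:
  assumes "f \<in> X" "\<And>n. s n \<in> X" "(\<lambda>n. N (s n - f)) \<longlonglongrightarrow> 0"
  shows "(\<lambda>n. N (seq_scale c (s n) - seq_scale c f)) \<longlonglongrightarrow> 0"
proof -
  have "N (seq_scale c (s n) - seq_scale c f) = norm c * N (s n - f)" for n
    using N_scale[OF diff_mem[OF assms(2,1)], of c] by (simp add: seq.scale_right_diff_distrib)
  then show ?thesis using tendsto_mult_right_zero[OF assms(3)] by simp
qed

lemma metric_space: "Metric_space X (\<lambda>f g. N (f - g))"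
proof
  show "N (f - g) = 0 \<longleftrightarrow> f = g" if "f \<in> X" "g \<in> X" for f g
    using N_eq_0[OF diff_mem[OF that]] N_zero by auto
qed (use N_nonneg N_commute N_triangle3 in auto)

lemma limitin_norm_topology:
  "limitin (norm_topology X N) s f sequentially \<longleftrightarrow>
     f \<in> X \<and> (\<forall>\<^sub>F n in sequentially. s n \<in> X) \<and> (\<lambda>n. N (s n - f)) \<longlonglongrightarrow> 0"
  unfolding norm_topology_def by (rule Metric_space.limitin_metric_dist_null[OF metric_space])

lemma mcomplete: "Metric_space.mcomplete X (\<lambda>f g. N (f - g))"
  unfolding Metric_space.mcomplete_def[OF metric_space] Metric_space.MCauchy_def[OF metric_space]
proof (intro allI impI, elim conjE)
  fix s :: "nat \<Rightarrow> nat \<Rightarrow> 'a" assume s: "range s \<subseteq> X" "\<forall>e>0. \<exists>M. \<forall>n n'. M \<le> n \<longrightarrow> M \<le> n' \<longrightarrow> N (s n - s n') < e"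
  have mem: "s n \<in> X" for n using s(1) by blast
  have "\<exists>M. \<forall>m\<ge>M. \<forall>n\<ge>M. N (s m - s n) < e" if "0 < e" for e
    using s(2) that by blast
  with mem have "\<exists>f\<in>X. (\<lambda>n. N (s n - f)) \<longlonglongrightarrow> 0"
    by (rule complete)
  then show "\<exists>f. limitin (Metric_space.mtopology X (\<lambda>f g. N (f - g))) s f sequentially"
    using mem limitin_norm_topology[of s] unfolding norm_topology_def
    by (blast intro: always_eventually)
qed

text \<open>
  Zabreiko's lemma. Baire's theorem makes the closure of some sublevel set of \<open>q\<close> a
  neighbourhood of \<open>0\<close>, so that every \<open>f\<close> is approximated to within \<open>N f / 2\<close> by an element
  of controlled \<open>q\<close>; iterating the approximation writes \<open>f\<close> as a series to which countable
  subadditivity applies.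
\<close>

lemma countably_subadditive_seminorm_bounded:
  assumes q_nonneg: "\<And>f. f \<in> X \<Longrightarrow> 0 \<le> q f"
    and q_add: "\<And>f g. f \<in> X \<Longrightarrow> g \<in> X \<Longrightarrow> q (f + g) \<le> q f + q g"
    and q_scale: "\<And>c f. f \<in> X \<Longrightarrow> q (seq_scale c f) \<le> norm c * q f"
    and q_series: "\<And>g f. (\<And>n. g n \<in> X) \<Longrightarrow> f \<in> X \<Longrightarrow> summable (\<lambda>n. q (g n)) \<Longrightarrow>
        (\<lambda>n. N ((\<Sum>j<n. g j) - f)) \<longlonglongrightarrow> 0 \<Longrightarrow> q f \<le> (\<Sum>n. q (g n))"
  shows "\<exists>C>0. \<forall>f\<in>X. q f \<le> C * N f"
proof -
  interpret M: Metric_space X "\<lambda>f g. N (f - g)" by (rule metric_space)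
  define T where "T m = M.mtopology closure_of {f \<in> X. q f \<le> real m}" for m :: nat
  have q_diff: "q (f - g) \<le> q f + q g" if "f \<in> X" "g \<in> X" for f g
    using q_add[of f "-g"] q_scale[of g "-1"] minus_mem[of g] that by force
  have "\<exists>m. M.mtopology interior_of T m \<noteq> {}"
  proof (rule ccontr)
    assume "\<not> ?thesis"
    then have "M.mtopology interior_of \<Union> (range T) = {}"
      by (intro M.metric_Baire_category_alt mcomplete) (auto simp: T_def)
    moreover have "\<Union> (range T) = X"
    proof (intro equalityI subsetI)
      fix f assume "f \<in> \<Union> (range T)" then show "f \<in> X"
        unfolding T_def using closure_of_subset_topspace[of M.mtopology] by auto
    next
      fix f assume f: "f \<in> X"
      obtain m :: nat where "q f \<le> real m" using real_arch_simple by blast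
      then have "f \<in> T m"
        unfolding T_def using f closure_of_subset[of "{f \<in> X. q f \<le> real m}" M.mtopology] by auto
      then show "f \<in> \<Union> (range T)" by auto
    qed
    ultimately show False
      using zero_mem interior_of_topspace[of M.mtopology] by auto
  qed
  then obtain m f0 where "f0 \<in> M.mtopology interior_of T m" by auto
  then obtain U where U: "openin M.mtopology U" "f0 \<in> U" "U \<subseteq> T m"
    by (auto simp: interior_of_def)
  then obtain r where r: "r > 0" "M.mball f0 r \<subseteq> T m" and f0: "f0 \<in> X"
    unfolding M.openin_mtopology by (meson order_trans subsetD)
  have near: "\<exists>a\<in>X. q a \<le> m \<and> N (f - a) < e" if "f \<in> X" "N (f0 - f) < r" "e > 0" for f e
  proof -
    have "f \<in> T m" using r that f0 by auto
    then show ?thesis unfolding T_def M.metric_closure_of using that by fastforce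
  qed
  have ball: "\<exists>g\<in>X. q g \<le> 2 * m \<and> N (h - g) < e" if h: "h \<in> X" "N h < r" "e > 0" for h e
  proof -
    obtain a where a: "a \<in> X" "q a \<le> m" "N (f0 + h - a) < e/2"
      using near[of "f0 + h" "e/2"] h f0 add_mem N_minus[of h] by auto
    obtain b where b: "b \<in> X" "q b \<le> m" "N (f0 - b) < e/2"
      using near[of "f0" "e/2"] h f0 r N_zero by auto
    have "h - (a - b) = (f0 + h - a) - (f0 - b)" by simp
    then have "N (h - (a - b)) \<le> N (f0 + h - a) + N (f0 - b)"
      using N_diff_triangle[of "f0 + h - a" "f0 - b"] diff_mem add_mem f0 h(1) a(1) b(1) by presburger
    then show ?thesis
      using a b q_diff[of a b] by (intro bexI[of _ "a - b"]) (auto intro: diff_mem)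
  qed
  define K where "K = 4 * (real m + 1) / r"
  have K: "K > 0" using r by (simp add: K_def)
  have approx: "\<exists>g\<in>X. q g \<le> K * N f \<and> N (f - g) \<le> N f / 2" if f: "f \<in> X" for f
  proof (cases "N f = 0")
    case True
    then have "f = 0" using f N_eq_0 by auto
    then show ?thesis using q_scale[OF zero_mem, of 0] zero_mem N_zero by (intro bexI[of _ 0]) auto
  next
    case False
    then have Nf: "N f > 0" using N_nonneg[of f] by simp
    define t where "t = r / (2 * N f)"
    have t: "t > 0" using Nf r by (simp add: t_def)
    have "N (seq_scale (of_real t) f) = r / 2"
      using t r f Nf N_scale[OF f, of "of_real t"] by (simp add: t_def del: of_real_divide of_real_mult)
    then obtain g where g: "g \<in> X" "q g \<le> 2 * m" "N (seq_scale (of_real t) f - g) < r / 4"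
      using ball[of "seq_scale (of_real t) f" "r/4"] r f scale_mem by auto
    let ?g = "seq_scale (of_real (1/t)) g"
    have "q ?g \<le> q g / t" using q_scale[of g "of_real (1/t)"] g t by (simp add: norm_divide)
    also have "\<dots> \<le> (2 * m) / t" using g t by (intro divide_right_mono) auto
    also have "\<dots> \<le> K * N f" using Nf r by (simp add: t_def K_def field_simps)
    finally have 1: "q ?g \<le> K * N f" .
    have "f - ?g = seq_scale (of_real (1/t)) (seq_scale (of_real t) f - g)"
      using t by (simp add: seq.scale_right_diff_distrib)
    then have "N (f - ?g) = N (seq_scale (of_real t) f - g) / t"
      using N_scale[of "seq_scale (of_real t) f - g" "of_real (1/t)"] diff_mem scale_mem f g t
      by (simp add: norm_divide)
    also have "\<dots> \<le> (r / 4) / t" using g t by (intro divide_right_mono) auto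
    also have "\<dots> = N f / 2" using Nf r by (simp add: t_def)
    finally show ?thesis using 1 g scale_mem by (intro bexI[of _ ?g]) auto
  qed
  then obtain G where G: "\<And>f. f \<in> X \<Longrightarrow> G f \<in> X \<and> q (G f) \<le> K * N f \<and> N (f - G f) \<le> N f / 2"
    by metis
  have "q f \<le> (2 * K) * N f" if f: "f \<in> X" for f
  proof -
    define F where "F = rec_nat f (\<lambda>_ h. h - G h)"
    have F0: "F 0 = f" and FS: "F (Suc n) = F n - G (F n)" for n by (simp_all add: F_def)
    have FX: "F n \<in> X" for n proof (induction n)
      case (Suc n)
      then show ?case unfolding FS using G by (intro diff_mem) auto
    qed (simp only: F0 f)
    have NF: "N (F n) \<le> N f * (1/2)^n" for n
    proof (induction n)
      case (Suc n)
      have "N (F (Suc n)) \<le> N (F n) / 2" using G[OF FX[of n]] by (simp add: FS)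
      with Suc show ?case by simp
    qed (simp add: F0)
    have sm: "(\<Sum>j<n. G (F j)) = f - F n" for n
      by (induction n) (auto simp: F0 FS algebra_simps)
    have qG: "q (G (F n)) \<le> K * N f * (1/2)^n" for n
    proof -
      have "q (G (F n)) \<le> K * N (F n)" using G FX by auto
      also have "\<dots> \<le> K * (N f * (1/2)^n)" using NF K by (intro mult_left_mono) auto
      finally show ?thesis by (simp add: mult_ac)
    qed
    have s1: "(\<lambda>n. K * N f * (1/2)^n) sums (K * N f * 2)"
      using sums_mult[OF geometric_sums[of "1/2::real"], of "K * N f"] by simp
    have s2: "summable (\<lambda>n. q (G (F n)))"
      by (rule summable_comparison_test'[OF sums_summable[OF s1]]) (use qG q_nonneg G FX in auto)
    have "(\<lambda>n. N f * (1/2)^n) \<longlonglongrightarrow> N f * 0"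
      by (intro tendsto_mult tendsto_const LIMSEQ_power_zero) auto
    then have NF0: "(\<lambda>n. N f * (1/2)^n) \<longlonglongrightarrow> 0" by simp
    have "(\<lambda>n. N (F n)) \<longlonglongrightarrow> 0"
      by (rule tendsto_sandwich[OF _ _ tendsto_const NF0]) (use NF N_nonneg in auto)
    then have lim: "(\<lambda>n. N ((\<Sum>j<n. G (F j)) - f)) \<longlonglongrightarrow> 0"
      by (simp add: sm N_minus)
    have "q f \<le> (\<Sum>n. q (G (F n)))"
      by (rule q_series[OF _ f s2 lim]) (use G FX in auto)
    also have "\<dots> \<le> (\<Sum>n. K * N f * (1/2)^n)"
      by (rule suminf_le[OF _ s2 sums_summable[OF s1]]) (use qG in auto)
    also have "\<dots> = K * N f * 2" using s1 by (simp add: sums_iff)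
    finally show ?thesis by simp
  qed
  then show ?thesis using K by (intro exI[of _ "2 * K"]) auto
qed

end

lemma sum_lessThan_shift_diff:
  "(\<Sum>j<L + J. h j) - (\<Sum>j<J. h j) = (\<Sum>j<L. h (j + J))" for h :: "nat \<Rightarrow> 'b::ab_group_add"
  by (induction L) (simp_all add: algebra_simps)

section \<open>Coefficient functionals of a Schauder basis\<close>

text \<open>A Schauder basis \<open>x\<close> of the whole space \<open>X\<close>; \<open>cf f k\<close> will be the \<open>k\<close>-th coefficient of \<open>f\<close>.\<close>

locale schauder_seq = banach_seq X N
  for X :: "(nat \<Rightarrow> 'a::{real_normed_field, euclidean_space}) set" and N +
  fixes x :: "nat \<Rightarrow> nat \<Rightarrow> 'a"
  assumes basis: "schauder_basis X N X x"
begin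

lemma x_mem: "x k \<in> X"
  using basis by (auto simp: schauder_basis_def)

lemma comb_x_mem: "comb a x A \<in> X"
  by (intro comb_mem x_mem)

lemma expansion_ex1: "f \<in> X \<Longrightarrow> \<exists>!a. (\<lambda>n. N (comb a x {..<n} - f)) \<longlonglongrightarrow> 0"
  using basis comb_x_mem unfolding schauder_basis_def limitin_norm_topology comb_def by auto

definition cf :: "(nat \<Rightarrow> 'a) \<Rightarrow> nat \<Rightarrow> 'a" where
  "cf f = (THE a. (\<lambda>n. N (comb a x {..<n} - f)) \<longlonglongrightarrow> 0)"

lemma cf_lim: "f \<in> X \<Longrightarrow> (\<lambda>n. N (comb (cf f) x {..<n} - f)) \<longlonglongrightarrow> 0"
  unfolding cf_def by (rule theI'[OF expansion_ex1])

lemma cf_unique: "f \<in> X \<Longrightarrow> (\<lambda>n. N (comb a x {..<n} - f)) \<longlonglongrightarrow> 0 \<Longrightarrow> cf f = a"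
  using cf_lim expansion_ex1 by blast

lemma cf_add:
  assumes "f \<in> X" "g \<in> X"
  shows "cf (f + g) k = cf f k + cf g k"
proof -
  have "cf (f + g) = (\<lambda>k. cf f k + cf g k)"
    using lim_add[OF assms comb_x_mem comb_x_mem cf_lim[OF assms(1)] cf_lim[OF assms(2)]]
    by (intro cf_unique add_mem assms) (simp add: comb_add)
  then show ?thesis by simp
qed

lemma cf_scale:
  assumes "f \<in> X"
  shows "cf (seq_scale c f) k = c * cf f k"
proof -
  have "cf (seq_scale c f) = (\<lambda>k. c * cf f k)"
    using lim_scale[OF assms comb_x_mem cf_lim[OF assms]]
    by (intro cf_unique scale_mem assms) (simp add: comb_scale)
  then show ?thesis by simp
qed

lemma cf_comb:
  assumes "finite A"
  shows "cf (comb a x A) = (\<lambda>k. if k \<in> A then a k else 0)"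
proof (rule cf_unique[OF comb_x_mem])
  obtain m where m: "A \<subseteq> {..<m}" using finite_nat_iff_bounded assms by blast
  have "comb (\<lambda>k. if k \<in> A then a k else 0) x {..<n} = comb a x A" if "n \<ge> m" for n
    using that m by (subst comb_restrict[of _ A]) (auto intro: comb_cong)
  then show "(\<lambda>n. N (comb (\<lambda>k. if k \<in> A then a k else 0) x {..<n} - comb a x A)) \<longlonglongrightarrow> 0"
    by (intro tendsto_eventually eventually_sequentiallyI[of m]) (simp add: N_zero)
qed

lemma x_norm_pos: "0 < N (x j)"
proof (rule ccontr)
  assume "\<not> ?thesis"
  then have "x j = 0" using N_nonneg[of "x j"] N_eq_0[OF x_mem] by fastforce
  then have "comb (\<lambda>_. 1) x {j} = comb (\<lambda>_. 1) x {}" by (simp add: comb_def)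
  then have "cf (comb (\<lambda>_. 1) x {j}) j = cf (comb (\<lambda>_. 1) x {}) j" by simp
  then show False unfolding cf_comb[OF finite.emptyI] by (subst (asm) cf_comb) auto
qed

lemma cf_diff:
  assumes "f \<in> X" "g \<in> X"
  shows "cf (f - g) k = cf f k - cf g k"
  using cf_add[of f "seq_scale (-1) g" k] cf_scale[of g "-1" k] scale_mem[of g "-1"] assms by simp

lemma cf_sum:
  assumes "\<And>j. j \<in> A \<Longrightarrow> F j \<in> X"
  shows "cf (\<Sum>j\<in>A. F j) k = (\<Sum>j\<in>A. cf (F j) k)"
proof -
  have z: "cf 0 k = 0" using cf_scale[OF zero_mem, of 0 k] by simp
  show ?thesis using assms
  proof (induction A rule: infinite_finite_induct)
    case (insert j A)
    then show ?case unfolding sum.insert[OF insert.hyps] by (subst cf_add) (auto intro: sum_mem)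
  qed (use z in auto)
qed

lemma comb_cf_sum:
  assumes "\<And>j. j \<in> J \<Longrightarrow> F j \<in> X"
  shows "comb (cf (\<Sum>j\<in>J. F j)) x A = (\<Sum>j\<in>J. comb (cf (F j)) x A)"
proof -
  have "comb (cf (\<Sum>j\<in>J. F j)) x A = (\<Sum>k\<in>A. \<Sum>j\<in>J. seq_scale (cf (F j) k) (x k))"
    unfolding comb_def using cf_sum[of J F] assms by (simp add: seq.scale_sum_left)
  then show ?thesis unfolding comb_def by (simp only: sum.swap[of _ J])
qed

lemma partial_sums_bounded: "f \<in> X \<Longrightarrow> bdd_above (range (\<lambda>n. N (comb (cf f) x {..<n})))"
  using convergentI[OF N_lim[OF _ comb_x_mem cf_lim], of f]
  by (intro Bseq_eq_bounded bounded_imp_bdd_above) (auto simp: Bseq_eq_bounded[symmetric] convergent_imp_Bseq)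

text \<open>
  Zabreiko's lemma for the supremum of the norms of the sub-sums of expansions over a family of index
  sets. What has to be checked is countable subadditivity.
\<close>

lemma sub_sums_uniformly_bounded:
  fixes \<A> :: "nat set set"
  assumes ne: "\<A> \<noteq> {}"
    and bdd: "\<And>f. f \<in> X \<Longrightarrow> bdd_above ((\<lambda>A. N (comb (cf f) x A)) ` \<A>)"
    and series: "\<And>g f Q A. (\<And>n. g n \<in> X) \<Longrightarrow> f \<in> X \<Longrightarrow> (\<And>n A. A \<in> \<A> \<Longrightarrow> N (comb (cf (g n)) x A) \<le> Q n) \<Longrightarrow>
      (\<And>n. 0 \<le> Q n) \<Longrightarrow> summable Q \<Longrightarrow> (\<lambda>n. N ((\<Sum>j<n. g j) - f)) \<longlonglongrightarrow> 0 \<Longrightarrow> A \<in> \<A> \<Longrightarrow> N (comb (cf f) x A) \<le> suminf Q"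
  shows "\<exists>C>0. \<forall>f\<in>X. \<forall>A\<in>\<A>. N (comb (cf f) x A) \<le> C * N f"
proof -
  define q where "q f = (SUP A\<in>\<A>. N (comb (cf f) x A))" for f
  have qle: "N (comb (cf f) x A) \<le> q f" if "f \<in> X" "A \<in> \<A>" for f A
    unfolding q_def by (rule cSUP_upper[OF that(2) bdd[OF that(1)]])
  have leq: "q f \<le> B" if "\<And>A. A \<in> \<A> \<Longrightarrow> N (comb (cf f) x A) \<le> B" for f B
    unfolding q_def using that ne by (intro cSUP_least) auto
  have q_nonneg: "0 \<le> q f" if "f \<in> X" for f
    using ne order_trans[OF N_nonneg qle[OF that]] by blast
  have "\<exists>C>0. \<forall>f\<in>X. q f \<le> C * N f"
  proof (rule countably_subadditive_seminorm_bounded[OF q_nonneg])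
    fix f c assume f: "f \<in> X"
    show "q (seq_scale c f) \<le> norm c * q f"
    proof (rule leq)
      fix A assume A: "A \<in> \<A>"
      have "comb (cf (seq_scale c f)) x A = seq_scale c (comb (cf f) x A)"
        using comb_scale[of c "cf f"] cf_scale[OF f] by presburger
      then show "N (comb (cf (seq_scale c f)) x A) \<le> norm c * q f"
        using qle[OF f A] by (simp add: N_scale comb_x_mem mult_left_mono)
    qed
  next
    fix f g assume fg: "f \<in> X" "g \<in> X"
    show "q (f + g) \<le> q f + q g"
    proof (rule leq)
      fix A assume A: "A \<in> \<A>"
      have "comb (cf (f + g)) x A = comb (cf f) x A + comb (cf g) x A"
        unfolding comb_add[symmetric] using cf_add[OF fg] by presburger
      then show "N (comb (cf (f + g)) x A) \<le> q f + q g"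
        using N_triangle[OF comb_x_mem comb_x_mem, of "cf f" A "cf g" A]
          qle[OF fg(1) A] qle[OF fg(2) A] by simp
    qed
  next
    fix g f
    assume g: "\<And>n. g n \<in> X" and f: "f \<in> X" and sm: "summable (\<lambda>n. q (g n))"
      and lim: "(\<lambda>n. N ((\<Sum>j<n. g j) - f)) \<longlonglongrightarrow> 0"
    show "q f \<le> (\<Sum>n. q (g n))"
      by (rule leq[OF series[OF g f qle[OF g] q_nonneg[OF g] sm lim]])
  qed
  then show ?thesis using qle by (blast intro: order_trans)
qed

text \<open>
  The basis constant is finite. For countable subadditivity the coefficients of the terms
  are summed; the resulting series converges to \<open>f\<close>, so by uniqueness it is the expansion of \<open>f\<close>.
\<close>

lemma partial_sums_uniformly_bounded:
  "\<exists>C>0. \<forall>f\<in>X. \<forall>n. N (comb (cf f) x {..<n}) \<le> C * N f"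
proof -
  let ?A = "range (\<lambda>n::nat. {..<n})"
  have "\<exists>C>0. \<forall>f\<in>X. \<forall>A\<in>?A. N (comb (cf f) x A) \<le> C * N f"
  proof (rule sub_sums_uniformly_bounded)
    show "bdd_above ((\<lambda>A. N (comb (cf f) x A)) ` ?A)" if "f \<in> X" for f
      using partial_sums_bounded[OF that] by (simp add: image_image)
  next
    fix g f Q A
    assume g: "\<And>n. g n \<in> X" and f: "f \<in> X" and Q: "\<And>n A. A \<in> ?A \<Longrightarrow> N (comb (cf (g n)) x A) \<le> Q n"
      and Q_nonneg: "\<And>n. 0 \<le> Q n" and sm: "summable Q"
      and lim: "(\<lambda>n. N ((\<Sum>j<n. g j) - f)) \<longlonglongrightarrow> 0" and A: "A \<in> ?A"
    have qle: "N (comb (cf (g j)) x {..<n}) \<le> Q j" for j n by (rule Q) simp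
    have coef: "norm (cf (g j) k) * N (x k) \<le> 2 * Q j" for j k
    proof -
      have "seq_scale (cf (g j) k) (x k) = comb (cf (g j)) x {..<Suc k} - comb (cf (g j)) x {..<k}"
        by (simp add: comb_def)
      then have "norm (cf (g j) k) * N (x k) = N (comb (cf (g j)) x {..<Suc k} - comb (cf (g j)) x {..<k})"
        using N_scale[OF x_mem, of "cf (g j) k" k] by simp
      also have "\<dots> \<le> Q j + Q j"
        by (rule order_trans[OF N_diff_triangle[OF comb_x_mem comb_x_mem] add_mono[OF qle qle]])
      finally show ?thesis by simp
    qed
    have coef_summable: "summable (\<lambda>j. cf (g j) k)" for k
    proof (rule summable_comparison_test'[OF summable_mult[OF sm, of "2 / N (x k)"]])
      fix j show "norm (cf (g j) k) \<le> 2 / N (x k) * Q j"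
        using coef[of j k] x_norm_pos[of k] by (simp add: field_simps)
    qed
    define c where "c k = (\<Sum>j. cf (g j) k)" for k
    have comb_lim: "(\<lambda>J. N ((\<Sum>j<J. comb (cf (g j)) x {..<n}) - comb c x {..<n})) \<longlonglongrightarrow> 0" for n
    proof (rule tendsto_sandwich[OF _ _ tendsto_const])
      have "(\<Sum>j<J. comb (cf (g j)) x {..<n}) - comb c x {..<n} =
          comb (\<lambda>k. (\<Sum>j<J. cf (g j) k) - c k) x {..<n}" for J
        unfolding comb_diff comb_cf_sum[OF g, symmetric] using cf_sum[of "{..<J}" g] g by (simp add: comb_def)
      then show "\<forall>\<^sub>F J in sequentially. N ((\<Sum>j<J. comb (cf (g j)) x {..<n}) - comb c x {..<n}) \<le>
          (\<Sum>k<n. norm ((\<Sum>j<J. cf (g j) k) - c k) * N (x k))"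
        using N_comb[of "{..<n}" x] x_mem by (auto intro!: always_eventually)
      have "(\<lambda>J. \<Sum>k<n. norm ((\<Sum>j<J. cf (g j) k) - c k) * N (x k)) \<longlonglongrightarrow> (\<Sum>k<n. 0 * N (x k))"
        unfolding c_def
        by (intro tendsto_sum tendsto_mult tendsto_const tendsto_norm_zero LIM_zero
            summable_LIMSEQ coef_summable)
      then show "(\<lambda>J. \<Sum>k<n. norm ((\<Sum>j<J. cf (g j) k) - c k) * N (x k)) \<longlonglongrightarrow> 0" by simp
    qed (auto simp: N_nonneg)
    define R where "R J = (\<Sum>j. Q (j + J))" for J
    have tail: "N (comb c x {..<n} - (\<Sum>j<J. comb (cf (g j)) x {..<n})) \<le> R J" for n J
    proof -
      let ?h = "\<lambda>j. comb (cf (g j)) x {..<n}"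
      have "N ((\<Sum>j<L + J. ?h j) - (\<Sum>j<J. ?h j)) \<le> R J" for L
      proof -
        have "(\<Sum>j<L + J. ?h j) - (\<Sum>j<J. ?h j) = (\<Sum>j<L. ?h (j + J))"
          by (rule sum_lessThan_shift_diff)
        then have "N ((\<Sum>j<L + J. ?h j) - (\<Sum>j<J. ?h j)) \<le> (\<Sum>j<L. N (?h (j + J)))"
          using N_sum[of "{..<L}" "\<lambda>j. ?h (j + J)"] comb_x_mem by metis
        also have "\<dots> \<le> (\<Sum>j<L. Q (j + J))" by (intro sum_mono qle)
        also have "\<dots> \<le> R J"
          unfolding R_def using sm Q_nonneg by (intro sum_le_suminf) (auto intro: summable_ignore_initial_segment)
        finally show ?thesis .
      qed
      then have *: "N (comb c x {..<n} - (\<Sum>j<J. ?h j)) \<le> N ((\<Sum>j<L + J. ?h j) - comb c x {..<n}) + R J" for L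
        using N_triangle3[of "comb c x {..<n}" "\<Sum>j<L + J. ?h j" "\<Sum>j<J. ?h j"] sum_mem[of _ ?h] comb_x_mem
          N_commute by (smt (verit, best))
      have "(\<lambda>L. N ((\<Sum>j<L + J. ?h j) - comb c x {..<n}) + R J) \<longlonglongrightarrow> 0 + R J"
        by (intro tendsto_add tendsto_const LIMSEQ_ignore_initial_segment[OF comb_lim])
      then have "N (comb c x {..<n} - (\<Sum>j<J. ?h j)) \<le> 0 + R J"
        by (rule LIMSEQ_le_const) (use * in auto)
      then show ?thesis by simp
    qed
    have R0: "R \<longlonglongrightarrow> 0"
      unfolding R_def using suminf_exist_split2[OF sm] by simp
    have "(\<lambda>n. N (comb c x {..<n} - f)) \<longlonglongrightarrow> 0"
    proof (rule LIMSEQ_I)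
      fix e :: real assume e: "e > 0"
      have "\<forall>\<^sub>F J in sequentially. R J < e/3" "\<forall>\<^sub>F J in sequentially. N ((\<Sum>j<J. g j) - f) < e/3"
        using order_tendstoD(2)[OF R0, of "e/3"] order_tendstoD(2)[OF lim, of "e/3"] e by auto
      then have "\<exists>J. R J < e/3 \<and> N ((\<Sum>j<J. g j) - f) < e/3"
        using eventually_happens[OF eventually_conj] by force
      then obtain J where J: "R J < e/3" "N ((\<Sum>j<J. g j) - f) < e/3" by blast
      have gs: "(\<Sum>j<J. g j) \<in> X" using g by (intro sum_mem)
      have "\<forall>\<^sub>F n in sequentially. N (comb (cf (\<Sum>j<J. g j)) x {..<n} - (\<Sum>j<J. g j)) < e/3"
        using order_tendstoD(2)[OF cf_lim[OF gs], of "e/3"] e by auto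
      then obtain M where M: "\<And>n. n \<ge> M \<Longrightarrow> N (comb (cf (\<Sum>j<J. g j)) x {..<n} - (\<Sum>j<J. g j)) < e/3"
        unfolding eventually_sequentially by blast
      have "N (comb c x {..<n} - f) < e" if "n \<ge> M" for n
      proof -
        let ?s = "comb (cf (\<Sum>j<J. g j)) x {..<n}"
        have "N (comb c x {..<n} - ?s) \<le> R J" using tail[of n J] comb_cf_sum[of "{..<J}" g] g by simp
        moreover have "N (comb c x {..<n} - f) \<le> N (comb c x {..<n} - ?s) + N (?s - f)"
          "N (?s - f) \<le> N (?s - (\<Sum>j<J. g j)) + N ((\<Sum>j<J. g j) - f)"
          by (intro N_triangle3 comb_x_mem gs f)+
        ultimately show ?thesis using M[OF that] J by linarith
      qed
      then show "\<exists>no. \<forall>n\<ge>no. norm (N (comb c x {..<n} - f) - 0) < e"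
        using N_nonneg by (intro exI[of _ M]) auto
    qed
    then have cf_f: "cf f = c" by (rule cf_unique[OF f])
    obtain n where "A = {..<n}" using A by blast
    then show "N (comb (cf f) x A) \<le> suminf Q" using tail[of n 0] by (simp add: cf_f R_def)
  qed simp
  then show ?thesis by simp
qed

lemma cf_bounded: "\<exists>C>0. \<forall>f\<in>X. norm (cf f k) \<le> C * N f"
proof -
  obtain C where C: "C > 0" "\<And>f n. f \<in> X \<Longrightarrow> N (comb (cf f) x {..<n}) \<le> C * N f"
    using partial_sums_uniformly_bounded by blast
  have "norm (cf f k) \<le> (2 * C / N (x k)) * N f" if f: "f \<in> X" for f
  proof -
    have "seq_scale (cf f k) (x k) = comb (cf f) x {..<Suc k} - comb (cf f) x {..<k}"
      by (simp add: comb_def)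
    then have "norm (cf f k) * N (x k) \<le> C * N f + C * N f"
      using N_diff_triangle[OF comb_x_mem comb_x_mem, of "cf f" "{..<Suc k}" "cf f" "{..<k}"]
        C(2)[OF f, of "Suc k"] C(2)[OF f, of k] N_scale[OF x_mem, of "cf f k" k] by simp
    then show ?thesis using x_norm_pos[of k] by (simp add: field_simps)
  qed
  then show ?thesis using C x_norm_pos[of k] by (intro exI[of _ "2 * C / N (x k)"]) auto
qed

lemma cf_lim_pointwise:
  assumes "f \<in> X" "\<And>n. s n \<in> X" "(\<lambda>n. N (s n - f)) \<longlonglongrightarrow> 0"
  shows "(\<lambda>n. cf (s n) k) \<longlonglongrightarrow> cf f k"
proof -
  obtain C where C: "C > 0" "\<And>f. f \<in> X \<Longrightarrow> norm (cf f k) \<le> C * N f" using cf_bounded by blast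
  have "(\<lambda>n. cf (s n) k - cf f k) \<longlonglongrightarrow> 0"
  proof (rule tendsto_norm_zero_cancel[OF tendsto_sandwich[OF _ _ tendsto_const]])
    show "(\<lambda>n. C * N (s n - f)) \<longlonglongrightarrow> 0" using tendsto_mult_right_zero[OF assms(3)] .
    show "\<forall>\<^sub>F n in sequentially. norm (cf (s n) k - cf f k) \<le> C * N (s n - f)"
      using C(2)[OF diff_mem[OF assms(2,1)]] cf_diff[OF assms(2,1)] by (auto intro!: always_eventually)
  qed auto
  then show ?thesis by (rule LIM_zero_cancel)
qed

end

section \<open>Unconditional bases\<close>

text \<open>An increasing chain of finite sets that exhausts the natural numbers consists of the initial
  segments, of the right lengths, of some enumeration.\<close>

lemma chain_enumeration:
  fixes D :: "nat \<Rightarrow> nat set"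
  assumes fin: "\<And>i. finite (D i)" and mono: "\<And>i. D i \<subseteq> D (Suc i)" and un: "\<And>k. k \<in> D (Suc k)"
  obtains \<sigma> where "bij \<sigma>" "\<And>i. \<sigma> ` {..<card (D i)} = D i"
proof -
  \<comment> \<open>Order the naturals by the first member of the chain that contains them, then by size.\<close>
  define lev where "lev k = (LEAST i. k \<in> D i)" for k
  define P where "P j k \<longleftrightarrow> lev j < lev k \<or> (lev j = lev k \<and> j < k)" for j k
  define r where "r k = card {j. P j k}" for k
  have lev: "k \<in> D (lev k)" for k
    unfolding lev_def using un by (rule LeastI)
  have lev_le: "lev k \<le> i" if "k \<in> D i" for k i
    unfolding lev_def using that by (rule Least_le)
  have D_mono: "D i \<subseteq> D j" if "i \<le> j" for i j
    using lift_Suc_mono_le[of D, OF mono that] .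
  have below: "{j. P j k} \<subset> D i" if "k \<in> D i" for k i
  proof
    show "{j. P j k} \<subseteq> D i"
    proof
      fix j assume "j \<in> {j. P j k}"
      then have "lev j \<le> i" using lev_le[OF that] by (auto simp: P_def)
      then show "j \<in> D i" using lev[of j] D_mono by blast
    qed
    show "{j. P j k} \<noteq> D i" using that by (auto simp: P_def)
  qed
  have fin_P: "finite {j. P j k}" for k
    using below[OF lev[of k]] fin finite_subset by blast
  have r_less: "r j < r k" if "P j k" for j k
  proof -
    have "{i. P i j} \<subset> {i. P i k}" using that by (auto simp: P_def)
    then show ?thesis unfolding r_def by (rule psubset_card_mono[OF fin_P])
  qed
  have inj: "inj r"
  proof (rule injI)
    fix j k assume "r j = r k"
    then have "\<not> P j k" "\<not> P k j" using r_less by force+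
    then show "j = k" by (auto simp: P_def)
  qed
  have image: "r ` D i = {..<card (D i)}" for i
  proof (rule card_subset_eq)
    show "r ` D i \<subseteq> {..<card (D i)}"
      unfolding r_def using psubset_card_mono[OF fin below] by auto
    show "card (r ` D i) = card {..<card (D i)}"
      using card_image[OF inj_on_subset[OF inj subset_UNIV], of "D i"] by simp
  qed simp
  have "surj r"
    unfolding surj_def
  proof
    fix n
    have "{..n} \<subseteq> D (Suc n)" using un D_mono by (meson Suc_le_mono atMost_iff subsetD subsetI)
    then have "Suc n \<le> card (D (Suc n))" using card_mono[OF fin, of "{..n}" "Suc n"] by simp
    then have "n \<in> r ` D (Suc n)" using image by simp
    then show "\<exists>x. n = r x" by auto
  qed
  then have bij: "bij r" using inj by (simp add: bij_def)
  show ?thesis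
  proof (rule that[of "inv r"])
    show "bij (inv r)" using bij by (rule bij_imp_bij_inv)
    show "inv r ` {..<card (D i)} = D i" for i
      using image[of i] inv_f_f[OF inj] by (metis image_inv_f_f inj)
  qed
qed

context banach_seq begin

lemma N_convex_combination:
  fixes t :: real
  assumes "f \<in> X" "g \<in> X" "0 \<le> t" "t \<le> 1" "N f \<le> M" "N (f + g) \<le> M"
  shows "N (f + seq_scale (of_real t) g) \<le> M"
proof -
  let ?s = "seq_scale (of_real (1 - t)) f" and ?r = "seq_scale (of_real t) (f + g)"
  have "f + seq_scale (of_real t) g = ?s + ?r"
    by (simp add: seq.scale_right_distrib seq.scale_left_diff_distrib)
  then have "N (f + seq_scale (of_real t) g) \<le> N ?s + N ?r"
    using N_triangle[of ?s ?r] assms scale_mem add_mem by metis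
  also have "\<dots> = (1 - t) * N f + t * N (f + g)"
    using assms N_scale[of f "of_real (1 - t)"] N_scale[of "f + g" "of_real t"] add_mem
    by (simp del: of_real_diff)
  also have "\<dots> \<le> (1 - t) * M + t * M"
    using assms by (intro add_mono mult_left_mono) auto
  finally show ?thesis by (simp add: algebra_simps)
qed

text \<open>A convex function of the multipliers is largest at a vertex of the cube.\<close>

lemma N_unit_interval_multipliers:
  fixes \<beta> :: "nat \<Rightarrow> real"
  assumes "finite A" "\<And>k. k \<in> A \<Longrightarrow> v k \<in> X" "\<And>k. k \<in> A \<Longrightarrow> 0 \<le> \<beta> k \<and> \<beta> k \<le> 1"
    and "u \<in> X" "\<And>B. B \<subseteq> A \<Longrightarrow> N (u + (\<Sum>k\<in>B. v k)) \<le> M"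
  shows "N (u + (\<Sum>k\<in>A. seq_scale (of_real (\<beta> k)) (v k))) \<le> M"
  using assms
proof (induction A arbitrary: u)
  case empty
  then show ?case using empty(4)[of "{}"] by simp
next
  case (insert k A)
  let ?w = "seq_scale (of_real (\<beta> k)) (v k)"
  have "N ((u + ?w) + (\<Sum>k\<in>A. seq_scale (of_real (\<beta> k)) (v k))) \<le> M"
  proof (rule insert.IH)
    show "u + ?w \<in> X" using insert.prems by (intro add_mem scale_mem) auto
    fix B assume B: "B \<subseteq> A"
    let ?b = "\<Sum>j\<in>B. v j"
    have b: "?b \<in> X" using insert.prems B by (intro sum_mem) auto
    have "N ((u + ?b) + ?w) \<le> M"
    proof (rule N_convex_combination)
      show "u + ?b \<in> X" using insert.prems b by (intro add_mem) auto
      show "N (u + ?b) \<le> M" using insert.prems(4)[of B] B by blast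
      have "finite B" "k \<notin> B" using B insert.hyps finite_subset by auto
      then have "u + ?b + v k = u + (\<Sum>j\<in>insert k B. v j)" by (simp add: add_ac)
      moreover have "N (u + (\<Sum>j\<in>insert k B. v j)) \<le> M" using B by (intro insert.prems) auto
      ultimately show "N (u + ?b + v k) \<le> M" by metis
    qed (use insert.prems in auto)
    moreover have "u + ?b + ?w = u + ?w + ?b" by (simp add: add_ac)
    ultimately show "N (u + ?w + ?b) \<le> M" by metis
  qed (use insert.prems in auto)
  then show ?case unfolding sum.insert[OF insert.hyps] add.assoc .
qed

lemma N_multipliers:
  fixes \<beta> :: "nat \<Rightarrow> 'a"
  assumes "finite A" "\<And>k. x k \<in> X" "\<And>k. norm (\<beta> k) \<le> 1"
    and M: "\<And>B. B \<subseteq> A \<Longrightarrow> N (comb a x B) \<le> M"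
  shows "N (comb (\<lambda>k. \<beta> k * a k) x A) \<le> 2 * real DIM('a) * M"
proof -
  define v where "v k = seq_scale (a k) (x k)" for k
  have v: "v k \<in> X" for k unfolding v_def by (intro scale_mem assms)
  have Mv: "N (\<Sum>k\<in>B. v k) \<le> M" if "B \<subseteq> A" for B using M[OF that] by (simp add: comb_def v_def)
  have unit: "N (\<Sum>k\<in>A. seq_scale (of_real (g k)) (v k)) \<le> M" if "\<And>k. 0 \<le> g k \<and> g k \<le> 1" for g :: "nat \<Rightarrow> real"
    using N_unit_interval_multipliers[of A v g 0 M] assms(1) v that zero_mem Mv by simp
  have real: "N (\<Sum>k\<in>A. seq_scale (of_real (g k)) (v k)) \<le> 2 * M" if g: "\<And>k. \<bar>g k\<bar> \<le> 1" for g :: "nat \<Rightarrow> real"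
  proof -
    let ?p = "\<Sum>k\<in>A. seq_scale (of_real (max (g k) 0)) (v k)" and ?n = "\<Sum>k\<in>A. seq_scale (of_real (max (- g k) 0)) (v k)"
    have "g k = max (g k) 0 - max (- g k) 0" for k by auto
    then have "of_real (g k) = (of_real (max (g k) 0) - of_real (max (- g k) 0) :: 'a)" for k
      by (metis of_real_diff)
    then have "(\<Sum>k\<in>A. seq_scale (of_real (g k)) (v k)) = ?p - ?n"
      by (simp only: seq.scale_left_diff_distrib sum_subtractf)
    moreover have "N (?p - ?n) \<le> N ?p + N ?n"
      by (intro N_diff_triangle sum_mem scale_mem v)
    moreover have "N ?p \<le> M" "N ?n \<le> M"
      using g by (intro unit; force simp: abs_le_iff)+
    ultimately show ?thesis by simp
  qed
  define h where "h i = seq_scale i (\<Sum>k\<in>A. seq_scale (of_real (\<beta> k \<bullet> i)) (v k))" for i :: 'a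
  have "comb (\<lambda>k. \<beta> k * a k) x A = (\<Sum>k\<in>A. \<Sum>i\<in>Basis. seq_scale i (seq_scale (of_real (\<beta> k \<bullet> i)) (v k)))"
    unfolding comb_def
  proof (rule sum.cong[OF refl])
    fix k
    have "\<beta> k = (\<Sum>i\<in>Basis. i * of_real (\<beta> k \<bullet> i))"
      using euclidean_representation[of "\<beta> k"] by (simp add: scaleR_conv_of_real mult.commute)
    then have "seq_scale (\<beta> k) (v k) = (\<Sum>i\<in>Basis. seq_scale (i * of_real (\<beta> k \<bullet> i)) (v k))"
      by (metis seq.scale_sum_left)
    then show "seq_scale (\<beta> k * a k) (x k) = (\<Sum>i\<in>Basis. seq_scale i (seq_scale (of_real (\<beta> k \<bullet> i)) (v k)))"
      by (simp add: v_def mult.assoc)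
  qed
  also have "\<dots> = (\<Sum>i\<in>Basis. h i)"
    unfolding h_def by (subst sum.swap) (simp only: seq.scale_sum_right)
  finally have "N (comb (\<lambda>k. \<beta> k * a k) x A) \<le> (\<Sum>i\<in>Basis. N (h i))"
    using N_sum[of Basis h] by (simp add: h_def sum_mem scale_mem v)
  also have "\<dots> \<le> (\<Sum>i\<in>(Basis :: 'a set). 2 * M)"
  proof (rule sum_mono)
    fix i :: 'a assume i: "i \<in> Basis"
    have "\<bar>\<beta> k \<bullet> i\<bar> \<le> 1" for k using Basis_le_norm[OF i, of "\<beta> k"] assms(3)[of k] by linarith
    then have "N (\<Sum>k\<in>A. seq_scale (of_real (\<beta> k \<bullet> i)) (v k)) \<le> 2 * M" by (rule real)
    then show "N (h i) \<le> 2 * M" unfolding h_def using i by (simp add: N_scale sum_mem scale_mem v)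
  qed
  finally show ?thesis by (simp add: mult_ac)
qed

end

context schauder_seq begin

text \<open>The expansion of \<open>f\<close> in the permuted basis is the permuted expansion.\<close>

lemma cf_permuted:
  assumes "bij \<sigma>" "f \<in> X" "(\<lambda>n. N (comb b (x \<circ> \<sigma>) {..<n} - f)) \<longlonglongrightarrow> 0"
  shows "b = cf f \<circ> \<sigma>"
proof
  fix j
  have inj: "inj \<sigma>" using assms(1) by (rule bij_is_inj)
  have eq: "comb b (x \<circ> \<sigma>) {..<n} = comb (b \<circ> inv \<sigma>) x (\<sigma> ` {..<n})" for n
    by (rule comb_subseq[OF inj])
  have "(\<lambda>n. cf (comb b (x \<circ> \<sigma>) {..<n}) (\<sigma> j)) \<longlonglongrightarrow> cf f (\<sigma> j)"
    by (rule cf_lim_pointwise[OF assms(2) _ assms(3)]) (simp add: eq comb_x_mem)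
  moreover have "cf (comb b (x \<circ> \<sigma>) {..<n}) (\<sigma> j) = b j" if "n > j" for n
    unfolding eq using that inj by (subst cf_comb) auto
  then have "(\<lambda>n. cf (comb b (x \<circ> \<sigma>) {..<n}) (\<sigma> j)) \<longlonglongrightarrow> b j"
    by (intro tendsto_eventually eventually_sequentiallyI[of "Suc j"]) auto
  ultimately show "b j = (cf f \<circ> \<sigma>) j"
    using LIMSEQ_unique by fastforce
qed

text \<open>
  If the finite sub-sums of the expansion of \<open>f\<close> were unbounded, there would be a chain of finite
  sets, exhausting the indices, along which the sums keep jumping by at least \<open>1\<close>; an enumeration
  adapted to the chain rearranges the expansion into a divergent series.
\<close>

lemma finite_subsums_bounded:
  assumes uncond: "\<And>\<sigma>. bij \<sigma> \<Longrightarrow> schauder_basis X N X (x \<circ> \<sigma>)" and f: "f \<in> X"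
  shows "\<exists>B. \<forall>A. finite A \<longrightarrow> N (comb (cf f) x A) \<le> B"
proof (rule ccontr)
  assume "\<not> ?thesis"
  then have unb: "\<exists>A. finite A \<and> B < N (comb (cf f) x A)" for B by (meson not_le)
  let ?S = "comb (cf f) x"
  have step: "\<exists>D'. finite D' \<and> D \<subseteq> D' \<and> i \<in> D' \<and> 1 \<le> N (?S D' - ?S D)" if D: "finite D" for D i
  proof -
    define F where "F = insert i D"
    have F: "finite F" using D by (simp add: F_def)
    obtain A where A: "finite A" "1 + (\<Sum>k\<in>F. norm (cf f k) * N (x k)) + norm (cf f i) * N (x i) < N (?S A)"
      using unb by blast
    have "A = (A - F) \<union> (A \<inter> F)" by auto
    then have "?S A = ?S (A - F) + ?S (A \<inter> F)"
      using comb_union_disjoint[of "A - F" "A \<inter> F" "cf f" x] A F by auto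
    then have "N (?S A) \<le> N (?S (A - F)) + N (?S (A \<inter> F))"
      using N_triangle[OF comb_x_mem comb_x_mem] by metis
    moreover have "N (?S (A \<inter> F)) \<le> (\<Sum>k\<in>A \<inter> F. norm (cf f k) * N (x k))"
      by (intro N_comb x_mem)
    moreover have "\<dots> \<le> (\<Sum>k\<in>F. norm (cf f k) * N (x k))"
      using F by (intro sum_mono2) (auto simp: N_nonneg)
    ultimately have big: "1 + norm (cf f i) * N (x i) < N (?S (A - F))" using A by linarith
    show ?thesis
    proof (cases "i \<in> D")
      case True
      have "?S (D \<union> (A - F)) = ?S D + ?S (A - F)"
        using D A by (intro comb_union_disjoint) (auto simp: F_def)
      then have "N (?S (D \<union> (A - F)) - ?S D) = N (?S (A - F))" by simp
      then show ?thesis using True D A big N_nonneg[of "x i"]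
        by (intro exI[of _ "D \<union> (A - F)"]) (auto intro: order_trans[OF _ less_imp_le[OF big]])
    next
      case False
      have "?S (D \<union> insert i (A - F)) = ?S D + (seq_scale (cf f i) (x i) + ?S (A - F))"
        using D A False by (subst comb_union_disjoint) (auto simp: F_def comb_insert)
      then have eq: "?S (D \<union> insert i (A - F)) - ?S D = seq_scale (cf f i) (x i) + ?S (A - F)" by simp
      have "N (?S (A - F)) \<le> N (seq_scale (cf f i) (x i)) + N (seq_scale (cf f i) (x i) + ?S (A - F))"
        using N_diff_triangle[of "seq_scale (cf f i) (x i) + ?S (A - F)" "seq_scale (cf f i) (x i)"]
          add_mem scale_mem x_mem comb_x_mem by (simp add: add.commute)
      then have "1 \<le> N (?S (D \<union> insert i (A - F)) - ?S D)"
        unfolding eq using big by (simp add: N_scale x_mem)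
      then show ?thesis using D A by (intro exI[of _ "D \<union> insert i (A - F)"]) auto
    qed
  qed
  obtain H where H: "\<And>D i. finite D \<Longrightarrow> finite (H D i) \<and> D \<subseteq> H D i \<and> i \<in> H D i \<and> 1 \<le> N (?S (H D i) - ?S D)"
    using step by metis
  define D where "D = rec_nat {} (\<lambda>i E. H E i)"
  have DS: "D (Suc i) = H (D i) i" for i by (simp add: D_def)
  have fin: "finite (D i)" for i by (induction i) (auto simp: DS H, simp add: D_def)
  obtain \<sigma> where \<sigma>: "bij \<sigma>" "\<And>i. \<sigma> ` {..<card (D i)} = D i"
    by (rule chain_enumeration[of D]) (use fin H in \<open>auto simp: DS\<close>)
  have "\<exists>b. (\<lambda>n. N (comb b (x \<circ> \<sigma>) {..<n} - f)) \<longlonglongrightarrow> 0"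
    using uncond[OF \<sigma>(1)] f unfolding schauder_basis_def limitin_norm_topology comb_def by blast
  then have lim: "(\<lambda>n. N (comb (cf f \<circ> \<sigma>) (x \<circ> \<sigma>) {..<n} - f)) \<longlonglongrightarrow> 0"
    using cf_permuted[OF \<sigma>(1) f] by blast
  have "comb (cf f \<circ> \<sigma>) (x \<circ> \<sigma>) {..<card (D i)} = ?S (D i)" for i
    using comb_comp[of \<sigma> "{..<card (D i)}" "cf f" x] \<sigma> bij_is_inj[OF \<sigma>(1)] by (simp add: inj_on_subset)
  moreover have "D i \<noteq> D (Suc i)" for i using H[OF fin[of i], of i] N_zero DS by auto
  then have "card (D i) < card (D (Suc i))" for i
    using H[OF fin[of i], of i] DS fin by (metis psubsetI psubset_card_mono)
  then have "strict_mono (\<lambda>i. card (D i))" by (simp add: strict_mono_Suc_iff)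
  from LIMSEQ_subseq_LIMSEQ[OF lim this]
  have "(\<lambda>i. N (comb (cf f \<circ> \<sigma>) (x \<circ> \<sigma>) {..<card (D i)} - f)) \<longlonglongrightarrow> 0" by (simp add: o_def)
  ultimately have lim': "(\<lambda>i. N (?S (D i) - f)) \<longlonglongrightarrow> 0" by simp
  have "1 \<le> N (?S (D (Suc i)) - f) + N (?S (D i) - f)" for i
    using H[OF fin[of i], of i] N_triangle3[OF comb_x_mem f comb_x_mem, of "cf f" "D (Suc i)" "cf f" "D i"] DS N_commute
    by (metis order_trans)
  then have "1 \<le> (0::real) + 0"
    by (intro LIMSEQ_le_const[OF tendsto_add[OF LIMSEQ_Suc[OF lim'] lim']]) auto
  then show False by simp
qed

lemma unconditional_multipliers:
  assumes uncond: "\<And>\<sigma>. bij \<sigma> \<Longrightarrow> schauder_basis X N X (x \<circ> \<sigma>)"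
  shows "\<exists>K>0. \<forall>f\<in>X. \<forall>A \<beta>. finite A \<longrightarrow> (\<forall>k. norm (\<beta> k) \<le> 1) \<longrightarrow>
    N (comb (\<lambda>k. \<beta> k * cf f k) x A) \<le> K * N f"
proof -
  have "\<exists>C>0. \<forall>f\<in>X. \<forall>A\<in>{A. finite A}. N (comb (cf f) x A) \<le> C * N f"
  proof (rule sub_sums_uniformly_bounded)
    show "bdd_above ((\<lambda>A. N (comb (cf f) x A)) ` {A. finite A})" if "f \<in> X" for f
      using finite_subsums_bounded[OF uncond that] by (auto simp: bdd_above_def)
  next
    fix g f Q and A :: "nat set"
    assume g: "\<And>n. g n \<in> X" and f: "f \<in> X"
      and Q: "\<And>n A. A \<in> {A. finite A} \<Longrightarrow> N (comb (cf (g n)) x A) \<le> Q n"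
      and Q_nonneg: "\<And>n. 0 \<le> Q n" and sm: "summable Q"
      and lim: "(\<lambda>n. N ((\<Sum>j<n. g j) - f)) \<longlonglongrightarrow> 0" and A: "A \<in> {A. finite A}"
    have gs: "(\<Sum>j<J. g j) \<in> X" for J using g by (intro sum_mem)
    have le: "N (comb (cf (\<Sum>j<J. g j)) x A) \<le> suminf Q" for J
    proof -
      have "N (comb (cf (\<Sum>j<J. g j)) x A) \<le> (\<Sum>j<J. N (comb (cf (g j)) x A))"
        using N_sum[of "{..<J}" "\<lambda>j. comb (cf (g j)) x A"] comb_cf_sum[of "{..<J}" g A] g comb_x_mem by simp
      also have "\<dots> \<le> (\<Sum>j<J. Q j)" by (intro sum_mono Q A)
      also have "\<dots> \<le> suminf Q" using sm Q_nonneg by (intro sum_le_suminf) auto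
      finally show ?thesis .
    qed
    have *: "N (comb (cf f) x A) \<le> N (comb (cf (\<Sum>j<J. g j)) x A - comb (cf f) x A) + suminf Q" for J
      using N_le_diff[OF comb_x_mem comb_x_mem, of "cf f" A "cf (\<Sum>j<J. g j)" A] le[of J]
      unfolding N_commute[of "comb (cf f) x A"] by linarith
    have "(\<lambda>J. N (comb (cf (\<Sum>j<J. g j)) x A - comb (cf f) x A)) \<longlonglongrightarrow> 0"
    proof (rule tendsto_sandwich[OF _ _ tendsto_const])
      show "\<forall>\<^sub>F J in sequentially. N (comb (cf (\<Sum>j<J. g j)) x A - comb (cf f) x A) \<le>
          (\<Sum>k\<in>A. norm (cf (\<Sum>j<J. g j) k - cf f k) * N (x k))"
        unfolding comb_diff[symmetric] by (intro always_eventually allI N_comb x_mem)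
      have "(\<lambda>J. \<Sum>k\<in>A. norm (cf (\<Sum>j<J. g j) k - cf f k) * N (x k)) \<longlonglongrightarrow> (\<Sum>k\<in>A. 0 * N (x k))"
        by (intro tendsto_sum tendsto_mult tendsto_const tendsto_norm_zero LIM_zero cf_lim_pointwise f gs lim)
      then show "(\<lambda>J. \<Sum>k\<in>A. norm (cf (\<Sum>j<J. g j) k - cf f k) * N (x k)) \<longlonglongrightarrow> 0" by simp
    qed (auto simp: N_nonneg)
    from tendsto_add[OF this tendsto_const[of "suminf Q"]]
    have "N (comb (cf f) x A) \<le> 0 + suminf Q"
      by (rule LIMSEQ_le_const) (use * in auto)
    then show "N (comb (cf f) x A) \<le> suminf Q" by simp
  qed auto
  then obtain C where C: "C > 0" "\<And>f A. f \<in> X \<Longrightarrow> finite A \<Longrightarrow> N (comb (cf f) x A) \<le> C * N f" by blast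
  have "N (comb (\<lambda>k. \<beta> k * cf f k) x A) \<le> (2 * real DIM('a) * C) * N f"
    if "f \<in> X" "finite A" "\<forall>k. norm (\<beta> k) \<le> 1" for f A \<beta>
  proof -
    have "N (comb (cf f) x B) \<le> C * N f" if "B \<subseteq> A" for B
      by (rule C(2)[OF \<open>f \<in> X\<close> finite_subset[OF that \<open>finite A\<close>]])
    then have "N (comb (\<lambda>k. \<beta> k * cf f k) x A) \<le> 2 * real DIM('a) * (C * N f)"
      using that(3) by (intro N_multipliers[OF \<open>finite A\<close> x_mem]) auto
    then show ?thesis by (simp add: mult_ac)
  qed
  then show ?thesis using C by (intro exI[of _ "2 * real DIM('a) * C"]) auto
qed

end

section \<open>Closed spans and basic sequences\<close>

context banach_seq begin

lemma span_mem: "range x \<subseteq> X \<Longrightarrow> f \<in> seq.span (range x) \<Longrightarrow> f \<in> X"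
  for x :: "nat \<Rightarrow> nat \<Rightarrow> 'a"
  by (rule in_span_range_comb[of f x]) (auto intro: comb_mem)

lemma closed_span_iff:
  assumes "range x \<subseteq> X"
  shows "f \<in> closed_span X N x \<longleftrightarrow> f \<in> X \<and> (\<forall>e>0. \<exists>g\<in>seq.span (range x). N (f - g) < e)"
  unfolding closed_span_def norm_topology_def Metric_space.metric_closure_of[OF metric_space]
    Metric_space.in_mball[OF metric_space]
  using span_mem[OF assms] by auto

lemma closed_span_subset: "range x \<subseteq> X \<Longrightarrow> closed_span X N x \<subseteq> X"
  using closed_span_iff by auto

lemma span_subset_closed_span:
  assumes "range x \<subseteq> X" "f \<in> seq.span (range x)"
  shows "f \<in> closed_span X N x"
  unfolding closed_span_iff[OF assms(1)]
proof (intro conjI allI impI)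
  show "f \<in> X" by (rule span_mem[OF assms])
  show "\<exists>g\<in>seq.span (range x). N (f - g) < e" if "0 < e" for e
    using assms(2) that by (intro bexI[of _ f]) (simp_all only: diff_self N_zero)
qed

lemma range_subset_closed_span: "range x \<subseteq> X \<Longrightarrow> range x \<subseteq> closed_span X N x"
  by (intro subsetI span_subset_closed_span) (auto intro: seq.span_base)

lemma lim_in_closed_span:
  assumes "range x \<subseteq> X" "f \<in> X" "(\<lambda>n. N (s n - f)) \<longlonglongrightarrow> 0" "\<And>n. s n \<in> closed_span X N x"
  shows "f \<in> closed_span X N x"
  unfolding closed_span_iff[OF assms(1)]
proof (intro conjI allI impI assms(2))
  fix e :: real assume e: "e > 0"
  have "\<forall>\<^sub>F n in sequentially. N (s n - f) < e/2" using order_tendstoD(2)[OF assms(3), of "e/2"] e by simp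
  then obtain n where n: "N (s n - f) < e/2" by (auto simp: eventually_sequentially)
  have sn: "s n \<in> X" using assms(4) closed_span_subset[OF assms(1)] by auto
  obtain g where g: "g \<in> seq.span (range x)" "N (s n - g) < e/2"
    using assms(4)[of n] e unfolding closed_span_iff[OF assms(1)] by (meson half_gt_zero)
  have "N (f - g) \<le> N (f - s n) + N (s n - g)" using span_mem[OF assms(1) g(1)] sn assms(2) by (intro N_triangle3)
  then show "\<exists>g\<in>seq.span (range x). N (f - g) < e" using g n N_commute[of f "s n"] by force
qed

lemma closed_span_banach:
  assumes "range x \<subseteq> X"
  shows "banach_seq (closed_span X N x) N"
proof
  note sub = closed_span_subset[OF assms]
  have mem: "f \<in> X" if "f \<in> closed_span X N x" for f using that sub by auto
  show "0 \<in> closed_span X N x" using span_subset_closed_span[OF assms] seq.span_zero by blast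
  show "f + g \<in> closed_span X N x" if f: "f \<in> closed_span X N x" and g: "g \<in> closed_span X N x" for f g
    unfolding closed_span_iff[OF assms]
  proof (intro conjI allI impI)
    show "f + g \<in> X" using f g mem add_mem by auto
    fix e :: real assume e: "e > 0"
    obtain f' where f': "f' \<in> seq.span (range x)" "N (f - f') < e/2"
      using f e unfolding closed_span_iff[OF assms] by (meson half_gt_zero)
    obtain g' where g': "g' \<in> seq.span (range x)" "N (g - g') < e/2"
      using g e unfolding closed_span_iff[OF assms] by (meson half_gt_zero)
    have "(f + g) - (f' + g') = (f - f') + (g - g')" by simp
    then have "N ((f + g) - (f' + g')) \<le> N (f - f') + N (g - g')"
      using N_triangle[of "f - f'" "g - g'"] f g f' g' mem span_mem[OF assms] diff_mem by metis
    then show "\<exists>h\<in>seq.span (range x). N (f + g - h) < e"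
      using f' g' seq.span_add by (intro bexI[of _ "f' + g'"]) auto
  qed
  show "seq_scale c f \<in> closed_span X N x" if f: "f \<in> closed_span X N x" for c f
    unfolding closed_span_iff[OF assms]
  proof (intro conjI allI impI)
    show "seq_scale c f \<in> X" using f mem scale_mem by auto
    fix e :: real assume e: "e > 0"
    have d: "e / (norm c + 1) > 0" using e by (simp add: add_nonneg_pos)
    obtain f' where f': "f' \<in> seq.span (range x)" "N (f - f') < e / (norm c + 1)"
      using f d unfolding closed_span_iff[OF assms] by meson
    have "N (seq_scale c f - seq_scale c f') = norm c * N (f - f')"
      using N_scale[OF diff_mem[of f f'], of c] mem[OF f] span_mem[OF assms f'(1)]
      by (simp add: seq.scale_right_diff_distrib)
    also have "\<dots> \<le> (norm c + 1) * N (f - f')" using N_nonneg[of "f - f'"] by (simp add: mult_right_mono)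
    also have "\<dots> < (norm c + 1) * (e / (norm c + 1))"
      by (rule mult_strict_left_mono[OF f'(2)]) (simp add: add_nonneg_pos)
    also have "\<dots> = e" using add_nonneg_pos[OF norm_ge_zero[of c] zero_less_one] by simp
    finally show "\<exists>h\<in>seq.span (range x). N (seq_scale c f - h) < e"
      using f' seq.span_scale by blast
  qed
  show "\<exists>f\<in>closed_span X N x. (\<lambda>n. N (s n - f)) \<longlonglongrightarrow> 0"
    if s: "\<And>n. s n \<in> closed_span X N x" "\<And>e. 0 < e \<Longrightarrow> \<exists>M. \<forall>m\<ge>M. \<forall>n\<ge>M. N (s m - s n) < e"
    for s :: "nat \<Rightarrow> nat \<Rightarrow> 'a"
    using complete[of s] s mem lim_in_closed_span[OF assms] by blast
  show "N (f + g) \<le> N f + N g" if "f \<in> closed_span X N x" "g \<in> closed_span X N x" for f g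
    using that mem by (intro N_triangle)
qed (use N_nonneg N_minus N_eq_0 N_scale closed_span_subset[OF assms] in auto)

lemma schauder_basis_mono:
  assumes Y: "banach_seq Y N" "Y \<subseteq> X" and sb: "schauder_basis X N Y x"
  shows "schauder_basis Y N Y x"
proof -
  interpret Y: banach_seq Y N by (rule Y(1))
  have "range x \<subseteq> Y" using sb by (simp add: schauder_basis_def)
  then have "comb a x {..<n} \<in> Y" for a n by (intro Y.comb_mem) auto
  then show ?thesis
    using sb Y(2) unfolding schauder_basis_def limitin_norm_topology Y.limitin_norm_topology comb_def
    by (auto simp: subset_iff)
qed

end

section \<open>Domination and perturbation\<close>

text \<open>
  \<open>dominates N x M y\<close>: on finite linear combinations, the \<open>M\<close>-norm taken along \<open>y\<close> is at
  most a constant multiple of the \<open>N\<close>-norm taken along \<open>x\<close>. The two sequences may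
  live in different spaces.
\<close>

definition dominates ::
    "((nat \<Rightarrow> 'a::field) \<Rightarrow> real) \<Rightarrow> (nat \<Rightarrow> nat \<Rightarrow> 'a) \<Rightarrow> ((nat \<Rightarrow> 'a) \<Rightarrow> real) \<Rightarrow> (nat \<Rightarrow> nat \<Rightarrow> 'a) \<Rightarrow> bool" where
  "dominates N x M y \<longleftrightarrow> (\<exists>C>0. \<forall>a A. finite A \<longrightarrow> M (comb a y A) \<le> C * N (comb a x A))"

lemma dominatesI:
  assumes "\<And>a A. finite A \<Longrightarrow> M (comb a y A) \<le> C * N (comb a x A)" "\<And>f. 0 \<le> N f"
  shows "dominates N x M y"
proof -
  have "M (comb a y A) \<le> max C 1 * N (comb a x A)" if "finite A" for a A
    using assms(1)[OF that, of a] mult_right_mono[of C "max C 1" "N (comb a x A)"] assms(2) by force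
  then show ?thesis unfolding dominates_def by (intro exI[of _ "max C 1"]) auto
qed

lemma dominates_trans:
  assumes "dominates N x M y" "dominates M y L z"
  shows "dominates N x L z"
proof -
  obtain C where C: "C > 0" "\<And>a A. finite A \<Longrightarrow> M (comb a y A) \<le> C * N (comb a x A)"
    using assms(1) unfolding dominates_def by blast
  obtain D where D: "D > 0" "\<And>a A. finite A \<Longrightarrow> L (comb a z A) \<le> D * M (comb a y A)"
    using assms(2) unfolding dominates_def by blast
  have "L (comb a z A) \<le> (D * C) * N (comb a x A)" if "finite A" for a A
    using order_trans[OF D(2)[OF that] mult_left_mono[OF C(2)[OF that] less_imp_le[OF D(1)]]] by (simp add: mult.assoc)
  then show ?thesis unfolding dominates_def using C D by (intro exI[of _ "D * C"]) auto
qed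

lemma dominates_subseq:
  assumes "dominates N x M y" "inj \<phi>"
  shows "dominates N (x \<circ> \<phi>) M (y \<circ> \<phi>)"
proof -
  obtain C where C: "C > 0" "\<And>a A. finite A \<Longrightarrow> M (comb a y A) \<le> C * N (comb a x A)"
    using assms(1) unfolding dominates_def by blast
  show ?thesis unfolding dominates_def comb_subseq[OF assms(2)] using C by (intro exI[of _ C]) auto
qed

lemma equivalent_seqs_iff_dominates:
  "equivalent_seqs N x y \<longleftrightarrow> dominates N x N y \<and> dominates N y N x" if nonneg: "\<And>f. 0 \<le> N f"
proof
  have comb_fin: "comb a z A = fin_comb (\<lambda>k. if k \<in> A then a k else 0) z" if "finite A" for a A and z :: "nat \<Rightarrow> nat \<Rightarrow> 'a"
  proof -
    have "comb a z A = comb (\<lambda>k. if k \<in> A then a k else 0) z A" by (auto intro: comb_cong)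
    also have "\<dots> = fin_comb (\<lambda>k. if k \<in> A then a k else 0) z"
      unfolding fin_comb_eq using that by (intro comb_restrict) auto
    finally show ?thesis .
  qed
  have fin: "finite {k. (if k \<in> A then a k else 0) \<noteq> 0}" if "finite A" for a :: "nat \<Rightarrow> 'a" and A
    by (rule finite_subset[OF _ that]) auto
  assume "equivalent_seqs N x y"
  then obtain C where C: "C > 0" "\<And>a. finite {n. a n \<noteq> 0} \<Longrightarrow>
        inverse C * N (fin_comb a y) \<le> N (fin_comb a x) \<and> N (fin_comb a x) \<le> C * N (fin_comb a y)"
    unfolding equivalent_seqs_def by blast
  have "N (comb a y A) \<le> C * N (comb a x A) \<and> N (comb a x A) \<le> C * N (comb a y A)" if "finite A" for a A
    using C(2)[OF fin[OF that, of a]] C(1) unfolding comb_fin[OF that] by (simp add: field_simps)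
  then show "dominates N x N y \<and> dominates N y N x" unfolding dominates_def using C(1) by blast
next
  assume "dominates N x N y \<and> dominates N y N x"
  then obtain C D where C: "C > 0" "\<And>a A. finite A \<Longrightarrow> N (comb a y A) \<le> C * N (comb a x A)"
    and D: "D > 0" "\<And>a A. finite A \<Longrightarrow> N (comb a x A) \<le> D * N (comb a y A)"
    unfolding dominates_def by blast
  have "inverse (max C D) * N (fin_comb a y) \<le> N (fin_comb a x) \<and> N (fin_comb a x) \<le> max C D * N (fin_comb a y)"
    if "finite {n. a n \<noteq> 0}" for a
  proof -
    have "N (fin_comb a y) \<le> max C D * N (fin_comb a x)" "N (fin_comb a x) \<le> max C D * N (fin_comb a y)"
      using C(2)[OF that, of a] D(2)[OF that, of a] nonneg[of "fin_comb a x"] nonneg[of "fin_comb a y"]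
        mult_right_mono[of C "max C D" "N (fin_comb a x)"] mult_right_mono[of D "max C D" "N (fin_comb a y)"]
      unfolding fin_comb_eq by (auto intro: order_trans)
    then show ?thesis using C(1) by (simp add: field_simps less_max_iff_disj)
  qed
  then show "equivalent_seqs N x y" unfolding equivalent_seqs_def
    using C(1) by (intro exI[of _ "max C D"]) auto
qed

text \<open>Multiplying the coefficients by scalars of modulus at most \<open>1\<close> increases the norm of a finite
  linear combination by at most the factor \<open>K\<close>.\<close>

definition mult_bounded :: "((nat \<Rightarrow> 'a::real_normed_field) \<Rightarrow> real) \<Rightarrow> (nat \<Rightarrow> nat \<Rightarrow> 'a) \<Rightarrow> real \<Rightarrow> bool" where
  "mult_bounded N x K \<longleftrightarrow> (\<forall>a A \<beta>. finite A \<longrightarrow> (\<forall>k. norm (\<beta> k) \<le> 1) \<longrightarrow>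
     N (comb (\<lambda>k. \<beta> k * a k) x A) \<le> K * N (comb a x A))"

lemma mult_boundedD:
  "mult_bounded N x K \<Longrightarrow> finite A \<Longrightarrow> (\<And>k. norm (\<beta> k) \<le> 1) \<Longrightarrow>
     N (comb (\<lambda>k. \<beta> k * a k) x A) \<le> K * N (comb a x A)"
  by (auto simp: mult_bounded_def)

lemma mult_bounded_subseq:
  fixes x :: "nat \<Rightarrow> nat \<Rightarrow> 'a::real_normed_field"
  assumes "mult_bounded N x K" "inj \<phi>"
  shows "mult_bounded N (x \<circ> \<phi>) K"
  unfolding mult_bounded_def
proof (intro allI impI)
  fix a \<beta> :: "nat \<Rightarrow> 'a" and A :: "nat set" assume A: "finite A" and \<beta>: "\<forall>k. norm (\<beta> k) \<le> 1"
  show "N (comb (\<lambda>k. \<beta> k * a k) (x \<circ> \<phi>) A) \<le> K * N (comb a (x \<circ> \<phi>) A)"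
    using mult_boundedD[OF assms(1), of "\<phi> ` A" "\<beta> \<circ> inv \<phi>" "a \<circ> inv \<phi>"] A \<beta>
    unfolding comb_subseq[OF assms(2)] by (simp add: o_def)
qed

context banach_seq begin

lemma mult_bounded_coeff:
  assumes "mult_bounded N x K" "range x \<subseteq> X" "finite A" "j \<in> A"
  shows "norm (a j) * N (x j) \<le> K * N (comb a x A)"
proof -
  have "comb (\<lambda>k. (if k = j then 1 else 0) * a k) x A = comb (\<lambda>k. (if k = j then 1 else 0) * a k) x {j}"
    using assms by (intro comb_restrict) auto
  also have "\<dots> = seq_scale (a j) (x j)" by (simp add: comb_def)
  finally show ?thesis
    using mult_boundedD[OF assms(1,3), of "\<lambda>k. if k = j then 1 else 0" a] assms(2) N_scale[of "x j" "a j"]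
    by (simp add: image_subset_iff)
qed

lemma perturbation_bound:
  assumes "range x \<subseteq> X" "range u \<subseteq> X" "\<And>k. k \<in> A \<Longrightarrow> norm (a k) \<le> R" "(\<Sum>k\<in>A. N (u k - x k)) \<le> S" "0 \<le> R"
  shows "N (comb a u A - comb a x A) \<le> R * S"
proof -
  have "N (comb a u A - comb a x A) \<le> (\<Sum>k\<in>A. norm (a k) * N (u k - x k))"
    unfolding comb_diff_right[symmetric] using assms by (intro N_comb diff_mem) auto
  also have "\<dots> \<le> (\<Sum>k\<in>A. R * N (u k - x k))" by (intro sum_mono mult_right_mono assms N_nonneg)
  also have "\<dots> = R * (\<Sum>k\<in>A. N (u k - x k))" by (simp add: sum_distrib_left)
  also have "\<dots> \<le> R * S" using assms by (intro mult_left_mono) auto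
  finally show ?thesis .
qed

lemma coeff_bound:
  assumes "mult_bounded N x K" "range x \<subseteq> X" "finite A" "j \<in> A" "\<And>k. m \<le> N (x k)" "0 < m"
  shows "norm (a j) \<le> K / m * N (comb a x A)"
proof -
  have "norm (a j) * m \<le> norm (a j) * N (x j)" using assms by (intro mult_left_mono) auto
  also have "\<dots> \<le> K * N (comb a x A)" by (rule mult_bounded_coeff[OF assms(1-4)])
  finally show ?thesis using assms(6) by (simp add: field_simps)
qed

text \<open>An unconditional sequence that is bounded below dominates its summable perturbations; it is
  dominated by the perturbation as soon as the latter is small enough.\<close>

lemma dominates_perturbation:
  assumes mb: "mult_bounded N x K" "0 < K" "range x \<subseteq> X" "range u \<subseteq> X" "\<And>k. m \<le> N (x k)" "0 < m"
    and small: "\<And>A. finite A \<Longrightarrow> (\<Sum>k\<in>A. N (u k - x k)) \<le> S"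
  shows "dominates N x N u" "K / m * S < 1 \<Longrightarrow> dominates N u N x"
proof -
  have mem: "comb a x A \<in> X" "comb a u A \<in> X" for a A using mb by (auto intro!: comb_mem)
  have diff: "N (comb a u A - comb a x A) \<le> (K / m * S) * N (comb a x A)" if A: "finite A" for a A
    using perturbation_bound[OF mb(3,4) coeff_bound[OF mb(1,3) A _ mb(5,6), of _ a] small[OF A]] mb(2,6)
      N_nonneg[of "comb a x A"] by (simp add: mult_ac)
  have le: "N (comb a u A) \<le> (1 + K / m * S) * N (comb a x A)" if A: "finite A" for a A
    using diff[OF A, of a] N_le_diff[OF mem(2,1), of a A a A] by (simp add: algebra_simps)
  show "dominates N x N u" by (rule dominatesI[where M = N and N = N and x = x and y = u, OF le N_nonneg])
  assume lt: "K / m * S < 1"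
  have le': "N (comb a x A) \<le> 1 / (1 - K / m * S) * N (comb a u A)" if A: "finite A" for a A
    using diff[OF A, of a] N_le_diff[OF mem(1,2), of a A a A] lt N_commute[of "comb a x A"]
    by (simp add: field_simps)
  show "dominates N u N x" by (rule dominatesI[where M = N and N = N and x = u and y = x, OF le' N_nonneg])
qed

text \<open>Unimodular multipliers align the values \<open>a k * l (x k)\<close> of the functional, so the bound on \<open>l\<close>
  becomes a lower \<open>\<ell>\<^sub>1\<close>-estimate for \<open>x\<close>.\<close>

lemma sum_coeff_le_of_functional:
  fixes l :: "(nat \<Rightarrow> 'a) \<Rightarrow> 'a"
  assumes mb: "mult_bounded N x K" "finite A" "0 < \<delta>" "0 \<le> C"
    and lin: "\<And>a. l (comb a x A) = (\<Sum>k\<in>A. a k * l (x k))"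
    and bd: "\<And>a. norm (l (comb a x A)) \<le> C * N (comb a x A)"
    and large: "\<And>k. \<delta> \<le> norm (l (x k))"
  shows "(\<Sum>k\<in>A. norm (a k)) \<le> C * K / \<delta> * N (comb a x A)"
proof -
  define \<beta> where "\<beta> k = (let z = a k * l (x k) in if z = 0 then 0 else of_real (norm z) / z)" for k
  have \<beta>: "norm (\<beta> k) \<le> 1" "\<beta> k * a k * l (x k) = of_real (norm (a k * l (x k)))" for k
    by (auto simp: \<beta>_def Let_def norm_divide norm_mult)
  have "(\<Sum>k\<in>A. norm (a k)) * \<delta> = (\<Sum>k\<in>A. norm (a k) * \<delta>)" by (simp add: sum_distrib_right)
  also have "\<dots> \<le> (\<Sum>k\<in>A. norm (a k * l (x k)))"
    unfolding norm_mult by (intro sum_mono mult_left_mono large) auto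
  also have "\<dots> = norm (\<Sum>k\<in>A. \<beta> k * a k * l (x k))"
    unfolding \<beta>(2) of_real_sum[symmetric] by (simp add: sum_nonneg del: of_real_sum)
  also have "\<dots> = norm (l (comb (\<lambda>k. \<beta> k * a k) x A))" by (simp add: lin)
  also have "\<dots> \<le> C * N (comb (\<lambda>k. \<beta> k * a k) x A)" by (rule bd)
  also have "\<dots> \<le> C * (K * N (comb a x A))"
    using mb \<beta>(1) by (intro mult_left_mono mult_boundedD)
  finally show ?thesis using mb(3) by (simp add: field_simps)
qed

text \<open>The coordinate functionals of an unconditional basic sequence, on its closed span.\<close>

lemma unconditional_coordinates:
  assumes "unconditional X N x"
  obtains c K where "0 < K" "mult_bounded N x K" "\<And>k. 0 < N (x k)"
    "\<forall>f\<in>closed_span X N x. (\<lambda>n. N (comb (c f) x {..<n} - f)) \<longlonglongrightarrow> 0"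
    "\<forall>f\<in>closed_span X N x. \<forall>A. finite A \<longrightarrow> N (comb (c f) x A) \<le> K * N f"
    "\<forall>a u A k. range u \<subseteq> closed_span X N x \<longrightarrow> c (comb a u A) k = (\<Sum>i\<in>A. a i * c (u i) k)"
proof -
  define Y where "Y = closed_span X N x"
  have bs: "basic_sequence X N x" "\<And>\<sigma>. bij \<sigma> \<Longrightarrow> basic_sequence X N (x \<circ> \<sigma>)"
    using assms by (auto simp: unconditional_def)
  have rx: "range x \<subseteq> X" using bs by (simp add: basic_sequence_def)
  have YX: "Y \<subseteq> X" unfolding Y_def by (rule closed_span_subset[OF rx])
  interpret Y: banach_seq Y N unfolding Y_def by (rule closed_span_banach[OF rx])
  have sbY: "schauder_basis Y N Y x"
    using schauder_basis_mono[OF Y.banach_seq_axioms YX] bs(1) unfolding Y_def basic_sequence_def by blast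
  interpret Y: schauder_seq Y N x by standard (rule sbY)
  have "schauder_basis Y N Y (x \<circ> \<sigma>)" if "bij \<sigma>" for \<sigma>
  proof (rule schauder_basis_mono[OF Y.banach_seq_axioms YX])
    have "range (x \<circ> \<sigma>) = range x" using bij_is_surj[OF that] by (metis image_comp)
    then have "closed_span X N (x \<circ> \<sigma>) = Y" by (simp add: Y_def closed_span_def)
    then show "schauder_basis X N Y (x \<circ> \<sigma>)" using bs(2)[OF that] by (simp add: basic_sequence_def)
  qed
  then obtain K where K: "K > 0" "\<And>f A \<beta>. f \<in> Y \<Longrightarrow> finite A \<Longrightarrow> (\<And>k. norm (\<beta> k) \<le> 1) \<Longrightarrow>
      N (comb (\<lambda>k. \<beta> k * Y.cf f k) x A) \<le> K * N f"
    using Y.unconditional_multipliers by metis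
  have mb: "mult_bounded N x K"
    unfolding mult_bounded_def
  proof (intro allI impI)
    fix a \<beta> :: "nat \<Rightarrow> 'a" and A :: "nat set" assume *: "finite A" "\<forall>k. norm (\<beta> k) \<le> 1"
    have "comb (\<lambda>k. \<beta> k * a k) x A = comb (\<lambda>k. \<beta> k * Y.cf (comb a x A) k) x A"
      by (rule comb_cong) (simp_all add: Y.cf_comb[OF *(1)])
    then show "N (comb (\<lambda>k. \<beta> k * a k) x A) \<le> K * N (comb a x A)"
      using K(2)[OF Y.comb_x_mem, of A \<beta> a A] * by simp
  qed
  have lin: "Y.cf (comb a u A) k = (\<Sum>i\<in>A. a i * Y.cf (u i) k)" if u: "range u \<subseteq> Y" for a u A k
  proof -
    have "u i \<in> Y" for i using u by auto
    then show ?thesis unfolding comb_def by (simp add: Y.cf_sum Y.scale_mem Y.cf_scale)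
  qed
  show ?thesis
    by (rule that[of K Y.cf])
      (use K(1) K(2)[of _ _ "\<lambda>_. 1"] mb Y.x_norm_pos Y.cf_lim lin in \<open>auto simp: Y_def\<close>)
qed

end

section \<open>Subsymmetric sequences\<close>

lemma strict_mono_choice:
  assumes "\<And>n L. \<exists>k>L. P n k"
  obtains \<phi> :: "nat \<Rightarrow> nat" where "strict_mono \<phi>" "\<And>n. P n (\<phi> n)"
proof -
  have "\<exists>\<phi>. \<forall>n. P n (\<phi> n) \<and> \<phi> n < \<phi> (Suc n)"
    using assms by (intro dependent_nat_choice) blast+
  then show ?thesis using that by (auto simp: strict_mono_Suc_iff)
qed

lemma strict_mono_eventually_choice:
  assumes "\<And>m. \<exists>n0. \<forall>n\<ge>n0. Q m n"
  obtains \<psi> :: "nat \<Rightarrow> nat" where "strict_mono \<psi>" "\<And>j. Q (\<psi> j) (\<psi> (Suc j))"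
proof -
  have "\<exists>n. Q m n \<and> m < n" for m
  proof -
    obtain n0 where "\<And>n. n \<ge> n0 \<Longrightarrow> Q m n" using assms[of m] by blast
    then show ?thesis by (intro exI[of _ "max n0 (Suc m)"]) auto
  qed
  then have "\<exists>\<psi>. \<forall>j. True \<and> (Q (\<psi> j) (\<psi> (Suc j)) \<and> \<psi> j < \<psi> (Suc j))"
    by (intro dependent_nat_choice) auto
  then show ?thesis using that by (auto simp: strict_mono_Suc_iff)
qed

text \<open>If \<open>u\<close> is unbounded, then some subsequence eventually exceeds every multiple of \<open>u\<close> termwise.\<close>

lemma bounded_of_subseq_comparable:
  fixes u :: "nat \<Rightarrow> real"
  assumes pos: "\<And>n. 0 < u n" and sub: "\<And>\<phi>. strict_mono \<phi> \<Longrightarrow> \<exists>C. \<forall>n. u (\<phi> n) \<le> C * u n"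
  shows "\<exists>M. \<forall>n. u n \<le> M"
proof (rule ccontr)
  assume unb: "\<not> ?thesis"
  have "\<exists>k>L. real n * u n < u k" for n L
  proof (rule ccontr)
    assume "\<not> ?thesis"
    then have large: "u k \<le> real n * u n" if "k > L" for k using that by force
    have "u k \<le> max (real n * u n) (Max (u ` {..L}))" for k
    proof (cases "k \<le> L")
      case True
      then have "u k \<le> Max (u ` {..L})" by (intro Max_ge) auto
      then show ?thesis by linarith
    next
      case False
      then show ?thesis using large[of k] by simp
    qed
    then show False using unb by blast
  qed
  then obtain \<phi> where \<phi>: "strict_mono \<phi>" "\<And>n. real n * u n < u (\<phi> n)"
    using strict_mono_choice[where P = "\<lambda>n k. real n * u n < u k"] by blast
  obtain C where C: "\<And>n. u (\<phi> n) \<le> C * u n" using sub[OF \<phi>(1)] by blast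
  obtain n :: nat where n: "C \<le> real n" using real_arch_simple by blast
  have "u (\<phi> n) \<le> real n * u n" using C[of n] n pos[of n] mult_right_mono[of C "real n" "u n"] by linarith
  then show False using \<phi>(2)[of n] by linarith
qed

context banach_seq begin

lemma subsymmetric_dominates_subseq:
  assumes "subsymmetric X N x" "strict_mono \<phi>"
  shows "dominates N x N (x \<circ> \<phi>)" "dominates N (x \<circ> \<phi>) N x"
  using assms equivalent_seqs_iff_dominates[of N x "x \<circ> \<phi>"] N_nonneg by (auto simp: subsymmetric_def)

lemma subsymmetric_range: "subsymmetric X N x \<Longrightarrow> range x \<subseteq> X"
  by (simp add: subsymmetric_def unconditional_def basic_sequence_def)

lemma subsymmetric_seminormalized:
  assumes "subsymmetric X N x"
  obtains m M where "0 < m" "\<And>k. m \<le> N (x k)" "\<And>k. N (x k) \<le> M"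
proof -
  have pos: "0 < N (x k)" for k
    using unconditional_coordinates[of x] assms unfolding subsymmetric_def by metis
  have single: "comb (\<lambda>_. 1) z {n} = z n" for z :: "nat \<Rightarrow> nat \<Rightarrow> 'a" and n by (simp add: comb_def)
  have "\<exists>M. \<forall>k. N (x k) \<le> M"
  proof (rule bounded_of_subseq_comparable[OF pos])
    fix \<phi> :: "nat \<Rightarrow> nat" assume "strict_mono \<phi>"
    from subsymmetric_dominates_subseq(1)[OF assms this] obtain C where
      "\<And>a A. finite A \<Longrightarrow> N (comb a (x \<circ> \<phi>) A) \<le> C * N (comb a x A)" unfolding dominates_def by blast
    from this[of "{n}" "\<lambda>_. 1" for n] show "\<exists>C. \<forall>n. N (x (\<phi> n)) \<le> C * N (x n)"
      unfolding single by auto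
  qed
  moreover have "\<exists>M. \<forall>k. inverse (N (x k)) \<le> M"
  proof (rule bounded_of_subseq_comparable)
    fix \<phi> :: "nat \<Rightarrow> nat" assume "strict_mono \<phi>"
    from subsymmetric_dominates_subseq(2)[OF assms this] obtain C where
      C: "\<And>a A. finite A \<Longrightarrow> N (comb a x A) \<le> C * N (comb a (x \<circ> \<phi>) A)" unfolding dominates_def by blast
    have "N (x n) \<le> C * N (x (\<phi> n))" for n
      using C[of "{n}" "\<lambda>_. 1"] unfolding single by simp
    then show "\<exists>C. \<forall>n. inverse (N (x (\<phi> n))) \<le> C * inverse (N (x n))"
      using pos by (intro exI[of _ C]) (simp add: field_simps)
  qed (simp add: pos)
  then obtain B where B: "\<And>k. inverse (N (x k)) \<le> B" by blast
  then have "0 < B" using pos[of 0] by (meson inverse_positive_iff_positive less_le_trans)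
  then have "inverse B \<le> N (x k)" for k using B[of k] pos[of k] by (simp add: field_simps)
  ultimately show ?thesis using that \<open>0 < B\<close> by (metis inverse_positive_iff_positive)
qed

end

section \<open>The Garling norm\<close>

text \<open>
  The parameters of a Garling-type norm. The constant weight is allowed, so that the
  spaces \<open>\<ell>\<^sub>p\<close> are included.
\<close>

locale garling =
  fixes w :: "nat \<Rightarrow> real" and p :: real
  assumes p_ge_1: "1 \<le> p" and w_nonneg: "\<And>n. 0 \<le> w n" and w_decseq: "decseq w" and w_0: "w 0 = 1"
begin

lemma w_mono: "m \<le> n \<Longrightarrow> w n \<le> w m"
  using w_decseq by (simp add: decseq_def)

lemma w_le_1: "w n \<le> 1"
  using w_mono[of 0 n] w_0 by simp

abbreviation gnorm :: "(nat \<Rightarrow> 'a::real_normed_field) \<Rightarrow> real" where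
  "gnorm \<equiv> garling_norm w p"

abbreviation gspace :: "(nat \<Rightarrow> 'a::real_normed_field) set" where
  "gspace \<equiv> garling_space w p"

text \<open>
  The sum that a finite set \<open>F\<close> of indices, listed in increasing order, contributes to the
  \<open>p\<close>-th power of the norm: \<open>card (F \<inter> {..<k})\<close> is the position of \<open>k\<close> in \<open>F\<close>,
  counted from \<open>0\<close>.
\<close>

definition gsum :: "nat set \<Rightarrow> (nat \<Rightarrow> 'a::real_normed_field) \<Rightarrow> real" where
  "gsum F f = (\<Sum>k\<in>F. norm (f k) powr p * w (card (F \<inter> {..<k})))"

end

lemma rank_strict_mono:
  fixes \<phi> :: "nat \<Rightarrow> nat"
  assumes "strict_mono \<phi>" "K \<le> i" "i < n"
  shows "card (\<phi> ` {K..<n} \<inter> {..<\<phi> i}) = i - K"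
proof -
  have "\<phi> ` {K..<n} \<inter> {..<\<phi> i} = \<phi> ` {K..<i}"
    using assms by (auto simp: strict_mono_less)
  then show ?thesis using strict_mono_imp_inj_on[OF assms(1)] by (simp add: card_image inj_on_subset)
qed

lemma finite_set_strict_mono_image:
  fixes F :: "nat set"
  assumes "finite F"
  obtains \<phi> :: "nat \<Rightarrow> nat" where "strict_mono \<phi>" "F = \<phi> ` {0..<card F}"
proof -
  obtain r :: "nat \<Rightarrow> nat" where r: "strict_mono_on {..<card F} r" "\<And>n. n < card F \<Longrightarrow> r n \<in> F"
    using finite_enumerate[OF assms] by blast
  obtain m where m: "F \<subseteq> {..<m}" using assms finite_nat_iff_bounded by blast
  define \<phi> where "\<phi> i = (if i < card F then r i else m + i)" for i
  have "strict_mono \<phi>"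
  proof (rule strict_monoI)
    fix i j :: nat assume "i < j"
    then show "\<phi> i < \<phi> j"
      using r strict_mono_onD[OF r(1), of i j] m by (auto simp: \<phi>_def intro: trans_less_add1)
  qed
  moreover have "\<phi> ` {0..<card F} = F"
  proof (rule card_subset_eq[OF assms])
    show "\<phi> ` {0..<card F} \<subseteq> F" using r by (auto simp: \<phi>_def)
    show "card (\<phi> ` {0..<card F}) = card F"
      using strict_mono_imp_inj_on[OF \<open>strict_mono \<phi>\<close>] by (simp add: card_image inj_on_subset)
  qed
  ultimately show ?thesis using that by metis
qed

lemma powr_convex_nonneg:
  fixes s r t p :: real
  assumes p: "1 \<le> p" and "0 \<le> s" "0 \<le> r" "0 \<le> t" "t \<le> 1"
  shows "((1 - t) * s + t * r) powr p \<le> (1 - t) * s powr p + t * r powr p"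
proof -
  have small: "(u * x) powr p \<le> u * x powr p" if "0 \<le> u" "u \<le> 1" "0 \<le> x" for u x :: real
  proof -
    have "u powr p \<le> u powr 1"
      using powr_mono'[of 1 p u] p that by simp
    then have "u powr p \<le> u" using that by simp
    then show ?thesis using that by (simp add: powr_mult mult_right_mono)
  qed
  consider "s = 0" | "r = 0" | "0 < s" "0 < r" using assms by linarith
  then show ?thesis
  proof cases
    case 1 then show ?thesis using small[of t r] assms by simp
  next
    case 2 then show ?thesis using small[of "1 - t" s] assms by simp
  next
    case 3
    then show ?thesis
      using convex_onD[OF powr_convex[OF p], of t s r] assms by simp
  qed
qed

context garling begin

lemma gsum_empty [simp]: "gsum {} f = 0"
  by (simp add: gsum_def)

lemma gsum_nonneg: "0 \<le> gsum F f"
  unfolding gsum_def by (intro sum_nonneg mult_nonneg_nonneg w_nonneg) auto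

lemma gsum_mono: "(\<And>k. k \<in> F \<Longrightarrow> norm (f k) \<le> norm (g k)) \<Longrightarrow> gsum F f \<le> gsum F g"
  unfolding gsum_def using p_ge_1 by (intro sum_mono mult_right_mono powr_mono2 w_nonneg) auto

lemma gsum_strict_mono_image:
  assumes "strict_mono \<phi>"
  shows "gsum (\<phi> ` {0..<n}) f = (\<Sum>i<n. norm (f (\<phi> i)) powr p * w i)"
  unfolding gsum_def
proof (subst sum.reindex)
  show "inj_on \<phi> {0..<n}" using strict_mono_imp_inj_on[OF assms] by (simp add: inj_on_subset)
  have "card (\<phi> ` {0..<n} \<inter> {..<\<phi> i}) = i" if "i < n" for i
    using rank_strict_mono[OF assms, of 0 i n] that by simp
  then show "sum ((\<lambda>k. norm (f k) powr p * w (card (\<phi> ` {0..<n} \<inter> {..<k}))) \<circ> \<phi>) {0..<n} =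
      (\<Sum>i<n. norm (f (\<phi> i)) powr p * w i)"
    by (intro sum.cong) auto
qed

lemma gsum_subset:
  assumes "finite F" "A \<subseteq> F"
  shows "(\<Sum>k\<in>A. norm (f k) powr p * w (card (F \<inter> {..<k}))) \<le> gsum A f"
  unfolding gsum_def using assms
  by (intro sum_mono mult_left_mono w_mono card_mono) (auto intro: finite_subset)

lemma gsum_le_norm_powr:
  assumes f: "f \<in> gspace" and F: "finite F"
  shows "gsum F f \<le> gnorm f powr p"
proof -
  obtain \<phi> :: "nat \<Rightarrow> nat" where \<phi>: "strict_mono \<phi>" "F = \<phi> ` {0..<card F}"
    using finite_set_strict_mono_image[OF F] by blast
  define T where "T = (\<Sum>n. ennreal (norm (f (\<phi> n)) powr p * w n))"
  have fin: "garling_ext_norm w p f < \<infinity>" using f by (simp add: garling_space_def)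
  have le: "ennreal_powr T (1 / p) \<le> garling_ext_norm w p f"
    unfolding garling_ext_norm_def T_def by (intro SUP_upper) (use \<phi> in auto)
  then have T: "T \<noteq> \<infinity>" using fin by (auto simp: ennreal_powr_def)
  have "ennreal (gsum F f) = (\<Sum>i<card F. ennreal (norm (f (\<phi> i)) powr p * w i))"
    using gsum_strict_mono_image[OF \<phi>(1), of "card F" f] \<phi>(2) w_nonneg by (simp add: sum_ennreal)
  also have "\<dots> \<le> T" unfolding T_def by (intro sum_le_suminf) auto
  finally have gT: "gsum F f \<le> enn2real T"
    using T gsum_nonneg[of F f] enn2real_mono[of "ennreal (gsum F f)" T] by (simp add: less_top)
  have "ennreal (enn2real T powr (1 / p)) \<le> garling_ext_norm w p f"
    using le T by (simp add: ennreal_powr_def)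
  then have "enn2real T powr (1 / p) \<le> gnorm f"
    unfolding garling_norm_def using fin enn2real_mono[of "ennreal (enn2real T powr (1 / p))"] by fastforce
  then have "(enn2real T powr (1 / p)) powr p \<le> gnorm f powr p"
    using p_ge_1 by (intro powr_mono2) auto
  then show ?thesis using gT p_ge_1 by (simp add: powr_powr)
qed

text \<open>The next lemma and \<open>gsum_le_norm_powr\<close> say that the norm is the supremum of
  \<open>gsum F f powr (1 / p)\<close> over the finite sets \<open>F\<close>.\<close>

lemma norm_leI:
  assumes B: "0 \<le> B" and le: "\<And>F. finite F \<Longrightarrow> gsum F f \<le> B powr p"
  shows "f \<in> gspace" "gnorm f \<le> B"
proof -
  have "garling_ext_norm w p f \<le> ennreal B"
    unfolding garling_ext_norm_def
  proof (rule SUP_least)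
    fix \<phi> :: "nat \<Rightarrow> nat" assume "\<phi> \<in> {\<phi>. strict_mono \<phi>}"
    then have \<phi>: "strict_mono \<phi>" by simp
    define T where "T = (\<Sum>n. ennreal (norm (f (\<phi> n)) powr p * w n))"
    have T: "T \<le> ennreal (B powr p)"
      unfolding T_def suminf_eq_SUP
    proof (rule SUP_least)
      fix n
      have "(\<Sum>i<n. ennreal (norm (f (\<phi> i)) powr p * w i)) = ennreal (gsum (\<phi> ` {0..<n}) f)"
        using gsum_strict_mono_image[OF \<phi>, of n f] w_nonneg by (simp add: sum_ennreal)
      also have "\<dots> \<le> ennreal (B powr p)" by (intro ennreal_leI le) auto
      finally show "(\<Sum>i<n. ennreal (norm (f (\<phi> i)) powr p * w i)) \<le> ennreal (B powr p)" .
    qed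
    then have "T \<noteq> \<infinity>" by (auto simp: top_unique)
    have "enn2real T \<le> B powr p" using T by (intro enn2real_leI) auto
    then have "enn2real T powr (1 / p) \<le> (B powr p) powr (1 / p)"
      using p_ge_1 by (intro powr_mono2) auto
    also have "\<dots> = B" using B p_ge_1 by (simp add: powr_powr)
    finally show "ennreal_powr T (1 / p) \<le> ennreal B"
      using \<open>T \<noteq> \<infinity>\<close> by (simp add: ennreal_powr_def ennreal_leI)
  qed
  then show "f \<in> gspace" "gnorm f \<le> B"
    using B unfolding garling_space_def garling_norm_def
    by (auto intro: enn2real_leI le_less_trans)
qed

lemma norm_gt_imp_gsum:
  assumes "0 \<le> B" "B < gnorm f"
  obtains F where "finite F" "B powr p < gsum F f"
  using norm_leI(2)[OF assms(1), of f] assms(2) by (meson not_le)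

lemma norm_nonneg: "0 \<le> gnorm f"
  by (simp add: garling_norm_def)

lemma gsum_single: "gsum {k} f = norm (f k) powr p"
  by (simp add: gsum_def w_0)

lemma coord_le_norm:
  assumes "f \<in> gspace"
  shows "norm (f k) \<le> gnorm f"
proof -
  have "norm (f k) powr p \<le> gnorm f powr p"
    using gsum_le_norm_powr[OF assms, of "{k}"] by (simp add: gsum_single)
  then show ?thesis
    using p_ge_1 norm_nonneg[of f] powr_less_mono2[of p "gnorm f" "norm (f k)"] by fastforce
qed

lemma norm_mono:
  assumes g: "g \<in> gspace" and le: "\<And>k. norm (f k) \<le> norm (g k)"
  shows "f \<in> gspace" "gnorm f \<le> gnorm g"
  using norm_leI[OF norm_nonneg, of f g] gsum_mono[of _ f g] gsum_le_norm_powr[OF g] le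
  by (meson order_trans)+

lemma norm_eq_0:
  assumes "f \<in> gspace" "gnorm f = 0"
  shows "f = 0"
  using coord_le_norm[OF assms(1)] assms(2) by (auto simp: fun_eq_iff)

lemma zero_in_garling: "(0 :: nat \<Rightarrow> 'a::real_normed_field) \<in> gspace"
  "gnorm (0 :: nat \<Rightarrow> 'a) = 0"
proof -
  have "gsum F (0 :: nat \<Rightarrow> 'a) \<le> 0 powr p" for F by (simp add: gsum_def)
  from norm_leI[OF order_refl this] show "(0 :: nat \<Rightarrow> 'a) \<in> gspace"
    "gnorm (0 :: nat \<Rightarrow> 'a) = 0"
    using norm_nonneg[of "0 :: nat \<Rightarrow> 'a"] by (auto intro: antisym)
qed

text \<open>The step of the triangle inequality that needs convexity of \<open>t \<mapsto> t powr p\<close>.\<close>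

lemma gsum_add_le:
  assumes "0 < a" "0 < b" "gsum F f \<le> a powr p" "gsum F g \<le> b powr p"
  shows "gsum F (f + g) \<le> (a + b) powr p"
proof -
  define t where "t = b / (a + b)"
  have t: "0 \<le> t" "t \<le> 1" "1 - t = a / (a + b)" using assms by (auto simp: t_def field_simps)
  have pt: "norm ((f + g) k) powr p \<le> (a + b) powr p * ((1 - t) * (norm (f k) powr p / a powr p) + t * (norm (g k) powr p / b powr p))" for k
  proof -
    have "norm ((f + g) k) powr p \<le> (norm (f k) + norm (g k)) powr p"
      using p_ge_1 by (intro powr_mono2) (auto simp: norm_triangle_ineq)
    also have "norm (f k) + norm (g k) = (a + b) * ((1 - t) * (norm (f k) / a) + t * (norm (g k) / b))"
    proof -
      have "(a + b) * (1 - t) = a" "(a + b) * t = b" using assms unfolding t(3) by (auto simp: t_def)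
      then have "(a + b) * ((1 - t) * (norm (f k) / a) + t * (norm (g k) / b)) = a * (norm (f k) / a) + b * (norm (g k) / b)"
        by (metis distrib_left mult.assoc)
      then show ?thesis using assms by simp
    qed
    also have "\<dots> powr p = (a + b) powr p * ((1 - t) * (norm (f k) / a) + t * (norm (g k) / b)) powr p"
      by (rule powr_mult)
    also have "\<dots> \<le> (a + b) powr p * ((1 - t) * (norm (f k) / a) powr p + t * (norm (g k) / b) powr p)"
      using assms t p_ge_1 by (intro mult_left_mono powr_convex_nonneg) auto
    finally show ?thesis using assms by (simp add: powr_divide)
  qed
  have "gsum F (f + g) \<le> (\<Sum>k\<in>F. (a + b) powr p * ((1 - t) * (norm (f k) powr p / a powr p) + t * (norm (g k) powr p / b powr p)) * w (card (F \<inter> {..<k})))"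
    unfolding gsum_def by (intro sum_mono mult_right_mono pt w_nonneg)
  also have "\<dots> = (a + b) powr p * ((1 - t) * (gsum F f / a powr p) + t * (gsum F g / b powr p))"
    unfolding gsum_def sum_divide_distrib sum_distrib_left sum.distrib[symmetric]
    by (intro sum.cong) (auto simp: algebra_simps)
  also have "\<dots> \<le> (a + b) powr p * ((1 - t) * 1 + t * 1)"
    using assms t by (intro mult_left_mono add_mono) auto
  finally show ?thesis by simp
qed

lemma norm_add:
  assumes f: "f \<in> gspace" and g: "g \<in> gspace"
  shows "f + g \<in> gspace" "gnorm (f + g) \<le> gnorm f + gnorm g"
proof -
  have "f + g \<in> gspace \<and> gnorm (f + g) \<le> gnorm f + gnorm g"
  proof (cases "gnorm f = 0 \<or> gnorm g = 0")
    case True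
    then show ?thesis using norm_eq_0[OF f] norm_eq_0[OF g] f g zero_in_garling by auto
  next
    case False
    then have pos: "0 < gnorm f" "0 < gnorm g"
      using norm_nonneg[of f] norm_nonneg[of g] by auto
    have "gsum F (f + g) \<le> (gnorm f + gnorm g) powr p" if "finite F" for F
      by (intro gsum_add_le pos gsum_le_norm_powr f g that)
    then show ?thesis using norm_leI[of "gnorm f + gnorm g" "f + g"] pos by simp
  qed
  then show "f + g \<in> gspace" "gnorm (f + g) \<le> gnorm f + gnorm g"
    by auto
qed

lemma gsum_scale: "gsum F (seq_scale c f) = norm c powr p * gsum F f"
  by (simp add: gsum_def seq_scale_def norm_mult powr_mult sum_distrib_left mult.assoc)

lemma norm_scale_le:
  assumes f: "f \<in> gspace"
  shows "seq_scale c f \<in> gspace" "gnorm (seq_scale c f) \<le> norm c * gnorm f"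
proof -
  have "gsum F (seq_scale c f) \<le> (norm c * gnorm f) powr p" if "finite F" for F
    using gsum_le_norm_powr[OF f that] norm_nonneg[of f] by (simp add: gsum_scale powr_mult mult_left_mono)
  from norm_leI[OF _ this] show "seq_scale c f \<in> gspace"
    "gnorm (seq_scale c f) \<le> norm c * gnorm f"
    using norm_nonneg[of f] by auto
qed

lemma norm_scale:
  assumes f: "f \<in> gspace"
  shows "gnorm (seq_scale c f) = norm c * gnorm f"
proof (cases "c = 0")
  case True
  then show ?thesis using norm_scale_le(2)[OF f, of c] norm_nonneg[of "seq_scale c f"] by simp
next
  case False
  have "gnorm f \<le> norm (inverse c) * gnorm (seq_scale c f)"
    using norm_scale_le(2)[OF norm_scale_le(1)[OF f], of "inverse c" c] False by simp
  then have "norm c * gnorm f \<le> gnorm (seq_scale c f)"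
    using False unfolding norm_inverse by (simp add: field_simps)
  then show ?thesis using norm_scale_le(2)[OF f, of c] by simp
qed

lemma norm_minus: "gnorm (- f) = gnorm f"
  by (simp add: garling_norm_def garling_ext_norm_def)

lemma gsum_tendsto:
  assumes "\<And>k. (\<lambda>n. s n k) \<longlonglongrightarrow> f k"
  shows "(\<lambda>n. gsum F (s n)) \<longlonglongrightarrow> gsum F f"
  unfolding gsum_def using p_ge_1 assms
  by (intro tendsto_sum tendsto_mult tendsto_const tendsto_powr' tendsto_norm) auto

lemma norm_diff_mem:
  assumes "f \<in> gspace" "g \<in> gspace"
  shows "f - g \<in> gspace"
  using norm_add(1)[OF assms(1) norm_scale_le(1)[OF assms(2), of "-1"]] by simp

lemma banach:
  "banach_seq (gspace :: (nat \<Rightarrow> 'a::{real_normed_field, euclidean_space}) set) gnorm"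
proof
  fix s :: "nat \<Rightarrow> nat \<Rightarrow> 'a"
  assume s: "\<And>n. s n \<in> gspace"
    and cauchy: "\<And>e. 0 < e \<Longrightarrow> \<exists>M. \<forall>m\<ge>M. \<forall>n\<ge>M. gnorm (s m - s n) < e"
  have d: "s m - s n \<in> gspace" for m n by (rule norm_diff_mem[OF s s])
  have "Cauchy (\<lambda>n. s n k)" for k
  proof (rule CauchyI)
    fix e :: real assume "0 < e"
    then obtain M where M: "\<And>m n. m \<ge> M \<Longrightarrow> n \<ge> M \<Longrightarrow> gnorm (s m - s n) < e"
      using cauchy by blast
    show "\<exists>M. \<forall>m\<ge>M. \<forall>n\<ge>M. norm (s m k - s n k) < e"
      using M coord_le_norm[OF d, of _ _ k] unfolding diff_fun_apply by (meson le_less_trans)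
  qed
  then have "\<exists>l. (\<lambda>n. s n k) \<longlonglongrightarrow> l" for k
    using Cauchy_convergent by (auto simp: convergent_def)
  then obtain f where f: "\<And>k. (\<lambda>n. s n k) \<longlonglongrightarrow> f k" by metis
  have close: "s n - f \<in> gspace \<and> gnorm (s n - f) \<le> e"
    if M: "\<And>m n. m \<ge> M \<Longrightarrow> n \<ge> M \<Longrightarrow> gnorm (s m - s n) < e" and n: "n \<ge> M" and e: "0 < e" for M n e
  proof -
    have "gsum F (s n - f) \<le> e powr p" if F: "finite F" for F
    proof (rule LIMSEQ_le_const2[OF gsum_tendsto])
      show "(\<lambda>m. (s n - s m) k) \<longlonglongrightarrow> (s n - f) k" for k
        unfolding diff_fun_apply by (intro tendsto_diff tendsto_const f)
      have "gsum F (s n - s m) \<le> e powr p" if "m \<ge> M" for m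
        using gsum_le_norm_powr[OF d F, of n m] M[OF n that] p_ge_1 norm_nonneg
          powr_mono2[of p "gnorm (s n - s m)" e] by (smt (verit))
      then show "\<exists>N. \<forall>m\<ge>N. gsum F (s n - s m) \<le> e powr p" by blast
    qed
    then show ?thesis using norm_leI[of e "s n - f"] e by auto
  qed
  obtain M1 where M1: "\<And>m n. m \<ge> M1 \<Longrightarrow> n \<ge> M1 \<Longrightarrow> gnorm (s m - s n) < 1"
    using cauchy[OF zero_less_one] by blast
  have "s M1 - (s M1 - f) \<in> gspace"
    by (rule norm_diff_mem[OF s conjunct1[OF close[OF M1 order_refl zero_less_one]]])
  then have fX: "f \<in> gspace" by simp
  moreover have "(\<lambda>n. gnorm (s n - f)) \<longlonglongrightarrow> 0"
  proof (rule LIMSEQ_I)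
    fix e :: real assume e: "0 < e"
    obtain M where M: "\<And>m n. m \<ge> M \<Longrightarrow> n \<ge> M \<Longrightarrow> gnorm (s m - s n) < e/2"
      using cauchy[OF half_gt_zero[OF e]] by blast
    have "gnorm (s n - f) < e" if "n \<ge> M" for n using close[OF M that] e by fastforce
    then show "\<exists>no. \<forall>n\<ge>no. norm (gnorm (s n - f) - 0) < e"
      using norm_nonneg[of "s n - f" for n] by (intro exI[of _ M]) simp
  qed
  ultimately show "\<exists>f\<in>gspace. (\<lambda>n. gnorm (s n - f)) \<longlonglongrightarrow> 0" by blast
qed (use zero_in_garling norm_add norm_scale_le norm_nonneg norm_minus norm_eq_0 norm_scale in auto)

section \<open>Disjoint vectors and tails\<close>

lemma gsum_support:
  assumes "finite F" "\<And>k. k \<in> F - S \<Longrightarrow> f k = 0"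
  shows "gsum F f \<le> gsum (F \<inter> S) f"
proof -
  have "gsum F f = (\<Sum>k\<in>F \<inter> S. norm (f k) powr p * w (card (F \<inter> {..<k})))"
    unfolding gsum_def using assms by (intro sum.mono_neutral_right) auto
  also have "\<dots> \<le> gsum (F \<inter> S) f" using assms(1) by (intro gsum_subset) auto
  finally show ?thesis .
qed

lemma gsum_union_ge:
  assumes P: "P \<subseteq> {..<K}" and F: "finite F" "F \<subseteq> {K..}"
  shows "gsum P f + (\<Sum>k\<in>F. norm (f k) powr p * w (K + card (F \<inter> {..<k}))) \<le> gsum (P \<union> F) f"
proof -
  have finP: "finite P" using P finite_subset by blast
  have "gsum (P \<union> F) f = (\<Sum>k\<in>P. norm (f k) powr p * w (card ((P \<union> F) \<inter> {..<k})))
      + (\<Sum>k\<in>F. norm (f k) powr p * w (card ((P \<union> F) \<inter> {..<k})))"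
    unfolding gsum_def
  proof (rule sum.union_disjoint[OF finP F(1)])
    show "P \<inter> F = {}" using P F(2) by fastforce
  qed
  moreover have "(\<Sum>k\<in>P. norm (f k) powr p * w (card ((P \<union> F) \<inter> {..<k}))) = gsum P f"
    unfolding gsum_def
  proof (rule sum.cong[OF refl])
    fix k assume "k \<in> P"
    then have "(P \<union> F) \<inter> {..<k} = P \<inter> {..<k}" using P F by force
    then show "norm (f k) powr p * w (card ((P \<union> F) \<inter> {..<k})) = norm (f k) powr p * w (card (P \<inter> {..<k}))"
      by simp
  qed
  moreover have "(\<Sum>k\<in>F. norm (f k) powr p * w (K + card (F \<inter> {..<k})))
      \<le> (\<Sum>k\<in>F. norm (f k) powr p * w (card ((P \<union> F) \<inter> {..<k})))"
  proof (intro sum_mono mult_left_mono w_mono)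
    fix k
    have "card ((P \<union> F) \<inter> {..<k}) \<le> card (P \<union> (F \<inter> {..<k}))"
      using finP F by (intro card_mono) auto
    also have "\<dots> \<le> card P + card (F \<inter> {..<k})" by (rule card_Un_le)
    also have "card P \<le> K" using card_mono[OF _ P] by simp
    finally show "card ((P \<union> F) \<inter> {..<k}) \<le> K + card (F \<inter> {..<k})" by simp
  qed auto
  ultimately show ?thesis by linarith
qed

text \<open>
  Deleting the first \<open>K\<close> elements of \<open>F\<close> costs little when \<open>f\<close> is small on \<open>F\<close>, and makes room
  for up to \<open>K\<close> smaller indices: each remaining element keeps its position, hence its weight,
  when they are put in front.
\<close>

lemma drop_initial_indices:
  assumes F: "finite F" and small: "\<And>k. k \<in> F \<Longrightarrow> norm (f k) powr p \<le> \<eta>" and \<eta>: "0 \<le> \<eta>"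
  obtains F' where "F' \<subseteq> F" "F' \<subseteq> {K..}"
    "gsum F f - real K * \<eta> \<le> (\<Sum>k\<in>F'. norm (f k) powr p * w (K + card (F' \<inter> {..<k})))"
proof -
  obtain \<phi> :: "nat \<Rightarrow> nat" where \<phi>: "strict_mono \<phi>" "F = \<phi> ` {0..<card F}"
    using finite_set_strict_mono_image[OF F] by blast
  define n where "n = card F"
  have inj: "inj_on \<phi> S" for S using strict_mono_imp_inj_on[OF \<phi>(1)] by (simp add: inj_on_subset)
  have F_eq: "F = \<phi> ` {0..<n}" using \<phi>(2) by (simp add: n_def)
  let ?t = "\<lambda>i. norm (f (\<phi> i)) powr p * w i"
  have "gsum F f = (\<Sum>i<n. ?t i)" unfolding F_eq by (rule gsum_strict_mono_image[OF \<phi>(1)])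
  also have "\<dots> \<le> (\<Sum>i\<in>{..<K} \<inter> {..<n}. ?t i) + (\<Sum>i\<in>{K..<n}. ?t i)"
    by (subst sum.union_disjoint[symmetric]) (auto intro!: sum_mono2 mult_nonneg_nonneg w_nonneg)
  also have "(\<Sum>i\<in>{..<K} \<inter> {..<n}. ?t i) \<le> (\<Sum>i\<in>{..<K} \<inter> {..<n}. \<eta>)"
  proof (rule sum_mono)
    fix i assume "i \<in> {..<K} \<inter> {..<n}"
    then have "norm (f (\<phi> i)) powr p \<le> \<eta>" using F_eq by (intro small) auto
    then show "?t i \<le> \<eta>" using w_le_1[of i] w_nonneg[of i] \<eta>
      by (metis mult_mono mult.right_neutral powr_ge_zero)
  qed
  also have "\<dots> \<le> real K * \<eta>"
    using \<eta> card_mono[of "{..<K}" "{..<K} \<inter> {..<n}"] by (simp add: mult_right_mono)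
  also have "(\<Sum>i\<in>{K..<n}. ?t i) = (\<Sum>k\<in>\<phi> ` {K..<n}. norm (f k) powr p * w (K + card (\<phi> ` {K..<n} \<inter> {..<k})))"
    by (subst sum.reindex[OF inj]) (auto intro!: sum.cong simp: rank_strict_mono[OF \<phi>(1)])
  finally show ?thesis
    using F_eq strict_mono_imp_increasing[OF \<phi>(1)]
    by (intro that[of "\<phi> ` {K..<n}"]) (auto intro: order_trans)
qed

lemma finite_support_mem:
  assumes S: "finite S" "\<And>k. k \<notin> S \<Longrightarrow> f k = 0"
  shows "f \<in> gspace"
proof -
  define C where "C = (\<Sum>k\<in>S. norm (f k) powr p)"
  have C: "0 \<le> C" by (auto simp: C_def intro: sum_nonneg)
  have "gsum F f \<le> (C powr (1 / p)) powr p" if F: "finite F" for F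
  proof -
    have "gsum F f \<le> gsum (F \<inter> S) f" using F S by (intro gsum_support) auto
    also have "\<dots> \<le> (\<Sum>k\<in>F \<inter> S. norm (f k) powr p)"
      unfolding gsum_def using w_le_1 by (intro sum_mono) (simp add: mult_left_le)
    also have "\<dots> \<le> C" unfolding C_def using S by (intro sum_mono2) auto
    also have "C = (C powr (1 / p)) powr p" using C p_ge_1 by (simp add: powr_powr)
    finally show ?thesis .
  qed
  then show ?thesis using norm_leI(1)[of "C powr (1 / p)" f] by simp
qed

text \<open>
  An upper \<open>p\<close>-estimate with constant \<open>1\<close> for disjointly supported vectors: the positions of
  indices do not increase on passing to the subset that belongs to one vector.
\<close>

lemma norm_comb_disjoint_le:
  fixes b :: "nat \<Rightarrow> nat \<Rightarrow> 'a::real_normed_field"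
  assumes A: "finite A" and disj: "\<And>k l i. b k i \<noteq> 0 \<Longrightarrow> b l i \<noteq> 0 \<Longrightarrow> k = l"
    and b: "\<And>k. b k \<in> gspace" "\<And>k. gnorm (b k) \<le> M"
  shows "gnorm (comb a b A) \<le> M * (\<Sum>k\<in>A. norm (a k) powr p) powr (1 / p)"
proof (rule norm_leI(2))
  have M: "0 \<le> M" using b(2)[of 0] norm_nonneg[of "b 0"] by linarith
  define S where "S = (\<Sum>k\<in>A. norm (a k) powr p)"
  have S: "0 \<le> S" by (auto simp: S_def intro: sum_nonneg)
  show "0 \<le> M * (\<Sum>k\<in>A. norm (a k) powr p) powr (1 / p)" using M by simp
  fix F :: "nat set" assume F: "finite F"
  have pt: "norm (comb a b A i) powr p \<le> (\<Sum>k\<in>A. norm (a k) powr p * norm (b k i) powr p)" for i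
  proof (cases "\<exists>k\<in>A. b k i \<noteq> 0")
    case True
    then obtain k where k: "k \<in> A" "b k i \<noteq> 0" by blast
    have "comb a b A i = a k * b k i"
      unfolding comb_apply using A k disj by (subst sum.remove[OF A k(1)]) (auto intro!: sum.neutral)
    then have "norm (comb a b A i) powr p = norm (a k) powr p * norm (b k i) powr p"
      by (simp add: norm_mult powr_mult)
    also have "\<dots> \<le> (\<Sum>k\<in>A. norm (a k) powr p * norm (b k i) powr p)"
      using A k(1) by (intro member_le_sum) auto
    finally show ?thesis .
  next
    case False
    then have "comb a b A i = 0" unfolding comb_apply by (intro sum.neutral) auto
    then show ?thesis by (simp add: sum_nonneg)
  qed
  have "gsum F (comb a b A) \<le> (\<Sum>i\<in>F. (\<Sum>k\<in>A. norm (a k) powr p * norm (b k i) powr p) * w (card (F \<inter> {..<i})))"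
    unfolding gsum_def by (intro sum_mono mult_right_mono pt w_nonneg)
  also have "\<dots> = (\<Sum>k\<in>A. norm (a k) powr p * gsum F (b k))"
    unfolding gsum_def sum_distrib_right sum_distrib_left mult.assoc by (rule sum.swap)
  also have "\<dots> \<le> (\<Sum>k\<in>A. norm (a k) powr p * M powr p)"
  proof (intro sum_mono mult_left_mono)
    fix k
    have "gnorm (b k) powr p \<le> M powr p"
      using b(2) norm_nonneg[of "b k"] p_ge_1 by (intro powr_mono2) auto
    then show "gsum F (b k) \<le> M powr p" using gsum_le_norm_powr[OF b(1) F, of k] by linarith
  qed simp
  also have "\<dots> = M powr p * S" by (simp add: S_def sum_distrib_left mult.commute)
  also have "\<dots> = (M * S powr (1 / p)) powr p" using M S p_ge_1 by (simp add: powr_mult powr_powr)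
  finally show "gsum F (comb a b A) \<le> (M * (\<Sum>k\<in>A. norm (a k) powr p) powr (1 / p)) powr p"
    by (simp add: S_def)
qed

end

lemma comb_unit_vec_apply:
  assumes "finite A"
  shows "comb a unit_vec A i = (if i \<in> A then a i else 0)"
proof -
  have "comb a unit_vec A i = (\<Sum>k\<in>A. if k = i then a k else 0)"
    unfolding comb_apply unit_vec_def by (intro sum.cong) auto
  then show ?thesis using assms by simp
qed

lemma garling_const: "1 \<le> p \<Longrightarrow> garling (\<lambda>_. 1) p"
  by unfold_locales (auto simp: decseq_def)

lemma const_weight_norm:
  assumes p: "1 \<le> p" and A: "finite A"
  shows "garling_norm (\<lambda>_. 1) p (comb a unit_vec A) = (\<Sum>k\<in>A. norm (a k) powr p) powr (1 / p)"
proof -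
  interpret garling "\<lambda>_. 1" p using p by (rule garling_const)
  let ?f = "comb a unit_vec A"
  define S where "S = (\<Sum>k\<in>A. norm (a k) powr p)"
  have S: "0 \<le> S" by (auto simp: S_def intro: sum_nonneg)
  have f: "?f i = (if i \<in> A then a i else 0)" for i by (rule comb_unit_vec_apply[OF A])
  have fX: "?f \<in> garling_space (\<lambda>_. 1) p" using A by (rule finite_support_mem) (simp add: f)
  have "gsum F ?f \<le> (S powr (1 / p)) powr p" if F: "finite F" for F
  proof -
    have "gsum F ?f \<le> gsum (F \<inter> A) ?f" using F by (intro gsum_support) (auto simp: f)
    also have "\<dots> \<le> S" unfolding gsum_def S_def using A F
      by (auto simp: f intro!: sum_mono2)
    finally show ?thesis using S p by (simp add: powr_powr)
  qed
  then have "garling_norm (\<lambda>_. 1) p ?f \<le> S powr (1 / p)" by (intro norm_leI(2)) auto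
  moreover have "S \<le> garling_norm (\<lambda>_. 1) p ?f powr p"
    using gsum_le_norm_powr[OF fX A] by (simp add: gsum_def f S_def)
  then have "S powr (1 / p) \<le> (garling_norm (\<lambda>_. 1) p ?f powr p) powr (1 / p)"
    using S p by (intro powr_mono2) auto
  then have "S powr (1 / p) \<le> garling_norm (\<lambda>_. 1) p ?f"
    using p norm_nonneg[of ?f] by (simp add: powr_powr)
  ultimately show ?thesis by (simp add: S_def)
qed

lemma powr_add_le:
  fixes x y p :: real
  assumes "0 \<le> x" "0 \<le> y" "0 \<le> p"
  shows "(x + y) powr p \<le> 2 powr p * (x powr p + y powr p)"
proof -
  have "(x + y) powr p \<le> (2 * max x y) powr p" using assms by (intro powr_mono2) auto
  also have "\<dots> = 2 powr p * max x y powr p" by (rule powr_mult)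
  also have "\<dots> \<le> 2 powr p * (x powr p + y powr p)" by (intro mult_left_mono) (auto simp: max_def)
  finally show ?thesis .
qed

lemma powr_le_self:
  fixes x p :: real
  assumes "0 \<le> x" "x \<le> 1" "1 \<le> p"
  shows "x powr p \<le> x"
  using powr_mono'[of 1 p x] assms by simp

context garling begin

text \<open>
  The elements of the space tend to \<open>0\<close> in norm off initial segments, provided that the weights are
  not summable. If they did not, there would be, arbitrarily far out, finite sets over which
  the sum is large while the coefficients are small (they tend to \<open>0\<close>), and disjoint such sets
  would accumulate by \<open>drop_initial_indices\<close>.
\<close>

lemma tail_small:
  assumes ns: "\<not> summable w" and f: "f \<in> gspace" and e: "0 < e"
  shows "\<exists>L. gnorm (\<lambda>k. if k < L then 0 else f k) < e"
proof (rule ccontr)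
  assume "\<not> ?thesis"
  then have large: "e \<le> gnorm (\<lambda>k. if k < L then 0 else f k)" for L by (simp add: not_less)
  define c where "c = (e / 2) powr p"
  have c: "0 < c" using e by (simp add: c_def)
  have c0: "\<exists>L. \<forall>k\<ge>L. norm (f k) powr p \<le> d" if d: "0 < d" for d
  proof (rule ccontr)
    assume "\<not> ?thesis"
    then have "\<exists>\<^sub>\<infinity>k. d < norm (f k) powr p" by (auto simp: INFM_nat_le not_le)
    then have "infinite {k. d < norm (f k) powr p}" by (simp add: INFM_iff_infinite)
    then obtain \<phi> :: "nat \<Rightarrow> nat" where \<phi>: "strict_mono \<phi>" "\<And>n. d < norm (f (\<phi> n)) powr p"
      using infinite_enumerate by blast
    have bound: "(\<Sum>i<n. w i) \<le> gnorm f powr p / d" for n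
    proof -
      have "d * (\<Sum>i<n. w i) \<le> (\<Sum>i<n. norm (f (\<phi> i)) powr p * w i)"
        unfolding sum_distrib_left using \<phi>(2) w_nonneg by (intro sum_mono mult_right_mono) (auto intro: less_imp_le)
      also have "\<dots> = gsum (\<phi> ` {0..<n}) f" by (simp add: gsum_strict_mono_image[OF \<phi>(1)])
      also have "\<dots> \<le> gnorm f powr p" by (intro gsum_le_norm_powr f) auto
      finally show ?thesis using d by (simp add: field_simps)
    qed
    have "(\<Sum>i\<le>n. w i) \<le> gnorm f powr p / d" for n
      using bound[of "Suc n"] by (simp only: lessThan_Suc_atMost)
    then have "summable w" using w_nonneg by (intro bounded_imp_summable)
    then show False using ns by simp
  qed
  have extend: "\<exists>K' P'. P' \<subseteq> {..<K'} \<and> gsum P f + c / 2 \<le> gsum P' f" if P: "P \<subseteq> {..<K}" for P K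
  proof -
    define \<eta> where "\<eta> = c / (2 * (real K + 1))"
    have \<eta>: "0 < \<eta>" "real K * \<eta> \<le> c / 2" using c by (auto simp: \<eta>_def field_simps)
    obtain L where L: "\<And>k. k \<ge> L \<Longrightarrow> norm (f k) powr p \<le> \<eta>" using c0[OF \<eta>(1)] by blast
    let ?t = "\<lambda>k. if k < L then 0 else f k"
    have "e / 2 < gnorm ?t" using large[of L] e by linarith
    then obtain F where F: "finite F" "c < gsum F ?t"
      using norm_gt_imp_gsum[of "e/2" ?t] e by (auto simp: c_def)
    obtain F' where F': "F' \<subseteq> F" "F' \<subseteq> {K..}"
        "gsum F ?t - real K * \<eta> \<le> (\<Sum>k\<in>F'. norm (?t k) powr p * w (K + card (F' \<inter> {..<k})))"
      by (rule drop_initial_indices[OF F(1), of ?t \<eta> K]) (use L \<eta> in auto)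
    have finF': "finite F'" using F' F finite_subset by blast
    have "c / 2 \<le> (\<Sum>k\<in>F'. norm (?t k) powr p * w (K + card (F' \<inter> {..<k})))" using F' F \<eta> by linarith
    also have "\<dots> \<le> (\<Sum>k\<in>F'. norm (f k) powr p * w (K + card (F' \<inter> {..<k})))"
      by (intro sum_mono mult_right_mono w_nonneg) auto
    finally have "gsum P f + c / 2 \<le> gsum (P \<union> F') f"
      using gsum_union_ge[OF P finF' F'(2), of f] by linarith
    moreover have "finite (P \<union> F')" using P finF' finite_subset by blast
    ultimately show ?thesis using finite_nat_iff_bounded by blast
  qed
  have "\<exists>K P. P \<subseteq> {..<K} \<and> real n * (c / 2) \<le> gsum P f" for n
  proof (induction n)
    case 0 then show ?case by (intro exI[of _ 0] exI[of _ "{}"]) auto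
  next
    case (Suc n)
    then obtain K P where "P \<subseteq> {..<K}" "real n * (c / 2) \<le> gsum P f" by blast
    with extend[of P K] obtain K' P' where "P' \<subseteq> {..<K'}" "gsum P f + c / 2 \<le> gsum P' f" by blast
    with \<open>real n * (c / 2) \<le> gsum P f\<close> show ?case
      by (intro exI[of _ K'] exI[of _ P']) (simp add: distrib_right)
  qed
  then have "real n * (c / 2) \<le> gnorm f powr p" for n
    using gsum_le_norm_powr[OF f] by (meson finite_lessThan finite_subset order_trans)
  moreover obtain n :: nat where "gnorm f powr p < real n * (c / 2)"
    using reals_Archimedean3[of "c / 2"] c by auto
  ultimately show False by (meson not_less)
qed

end

section \<open>Vectors with vanishing coefficients\<close>

lemma sum_half_powers_le: "(\<Sum>i\<in>{Suc j..<J}. (1/2::real) ^ i) \<le> (1/2) ^ j"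
proof (cases "j < J")
  case True
  then have "(\<Sum>i\<in>{Suc j..<J}. (1/2::real) ^ i) = (1/2) ^ j - 2 * (1/2) ^ J"
    by (induction J) (auto simp: less_Suc_eq)
  then show ?thesis by simp
qed simp

context garling begin

text \<open>
  Finitely supported vectors of norm bounded below whose coefficients tend uniformly to \<open>0\<close> have a
  subsequence dominating the basis of \<open>\<ell>\<^sub>p\<close>. Along a sparse subsequence each vector
  contributes a fixed amount over a set of its own, and the later vectors are too small to
  disturb it; by \<open>drop_initial_indices\<close> these contributions add up.
\<close>

lemma vanishing_coefficients_dominate_ell:
  fixes Z :: "nat \<Rightarrow> nat \<Rightarrow> 'a::{real_normed_field, euclidean_space}"
  assumes supp: "\<And>n. \<exists>B. \<forall>k\<ge>B. Z n k = 0"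
    and c: "0 < c" "\<And>n. c \<le> gnorm (Z n)"
    and sup: "\<And>e. 0 < e \<Longrightarrow> \<exists>n0. \<forall>n\<ge>n0. \<forall>k. norm (Z n k) \<le> e"
  obtains \<psi> where "strict_mono \<psi>" "dominates gnorm (Z \<circ> \<psi>) (garling_norm (\<lambda>_. 1) p) unit_vec"
proof -
  interpret banach_seq "gspace :: (nat \<Rightarrow> 'a) set" "gnorm" by (rule banach)
  define c' where "c' = (c / 2) powr p"
  have c': "0 < c'" using c by (simp add: c'_def)
  obtain B0 where B0: "\<And>n k. k \<ge> B0 n \<Longrightarrow> Z n k = 0" using supp by metis
  define B where "B n = (\<Sum>i\<le>n. B0 i)" for n
  have B_mono: "B m \<le> B n" if "m \<le> n" for m n unfolding B_def using that by (intro sum_mono2) auto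
  have B: "Z n k = 0" if "k \<ge> B n" for n k
    using that member_le_sum[of n "{..n}" B0] by (intro B0) (simp add: B_def)
  have Z_mem: "Z n \<in> gspace" for n
    by (rule finite_support_mem[of "{..<B n}"]) (auto intro: B)
  \<comment> \<open>The constant makes the total disturbance at most \<open>c' / 4\<close> below.\<close>
  define \<sigma> where "\<sigma> = min 1 (c' / (8 * 2 powr p))"
  have \<sigma>: "0 < \<sigma>" "\<sigma> \<le> 1" "2 powr p * (2 * \<sigma>) \<le> c' / 4" using c' by (auto simp: \<sigma>_def min_def field_simps)
  have \<sigma>c: "\<sigma> \<le> c' / 2"
  proof -
    have "1 \<le> (2::real) powr p" using p_ge_1 by (intro ge_one_powr_ge_zero) auto
    then have "\<sigma> \<le> 2 powr p * \<sigma>" using \<sigma>(1) by simp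
    then show ?thesis using \<sigma>(3) c' by linarith
  qed
  define \<delta> where "\<delta> m = \<sigma> * (1/2) ^ m / (real (B m) + 1)" for m
  have \<delta>_pos: "0 < \<delta> m" for m using \<sigma> by (simp add: \<delta>_def add_nonneg_pos)
  have \<delta>_le: "\<delta> m \<le> \<sigma> / (real (B m) + 1)" for m
    unfolding \<delta>_def using \<sigma> by (intro divide_right_mono) (auto simp: power_le_one mult_left_le)
  obtain \<psi> :: "nat \<Rightarrow> nat" where \<psi>: "strict_mono \<psi>" "\<And>j k. norm (Z (\<psi> (Suc j)) k) \<le> \<delta> (\<psi> j)"
    using strict_mono_eventually_choice[of "\<lambda>m n. \<forall>k. norm (Z n k) \<le> \<delta> m"] sup[OF \<delta>_pos] by metis
  define n where "n j = \<psi> (Suc j)" for j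
  define K where "K j = B (\<psi> j)" for j
  have K_mono: "K i \<le> K j" if "i \<le> j" for i j
    unfolding K_def using that \<psi>(1) by (intro B_mono) (simp add: strict_mono_less_eq)
  have "\<exists>F. F \<subseteq> {K j..<K (Suc j)} \<and>
      c' / 2 \<le> (\<Sum>k\<in>F. norm (Z (n j) k) powr p * w (K j + card (F \<inter> {..<k})))" for j
  proof -
    have "c / 2 < gnorm (Z (n j))" using c(2)[of "n j"] c(1) by linarith
    then obtain F where F: "finite F" "c' < gsum F (Z (n j))"
      using norm_gt_imp_gsum[of "c/2" "Z (n j)"] c by (auto simp: c'_def)
    let ?F = "F \<inter> {..<K (Suc j)}"
    have "gsum F (Z (n j)) \<le> gsum ?F (Z (n j))"
      using F by (intro gsum_support) (auto simp: K_def n_def intro: B)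
    then have F2: "c' < gsum ?F (Z (n j))" using F by linarith
    define \<eta> where "\<eta> = \<sigma> / (real (K j) + 1)"
    have \<eta>: "0 \<le> \<eta>" "\<eta> \<le> 1" "real (K j) * \<eta> \<le> \<sigma>" using \<sigma> by (auto simp: \<eta>_def field_simps)
    have small: "norm (Z (n j) k) powr p \<le> \<eta>" for k
    proof -
      have "norm (Z (n j) k) \<le> \<eta>" using \<psi>(2)[of j k] \<delta>_le[of "\<psi> j"] by (simp add: \<eta>_def K_def n_def)
      then show ?thesis using powr_le_self[of "norm (Z (n j) k)" p] \<eta> p_ge_1 by simp
    qed
    obtain F' where F': "F' \<subseteq> ?F" "F' \<subseteq> {K j..}" "gsum ?F (Z (n j)) - real (K j) * \<eta>
        \<le> (\<Sum>k\<in>F'. norm (Z (n j) k) powr p * w (K j + card (F' \<inter> {..<k})))"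
      by (rule drop_initial_indices[of ?F "Z (n j)" \<eta> "K j"]) (use F small \<eta> in auto)
    have "c' / 2 \<le> (\<Sum>k\<in>F'. norm (Z (n j) k) powr p * w (K j + card (F' \<inter> {..<k})))"
      using F' F2 \<eta> \<sigma>c by linarith
    then show ?thesis using F' by (intro exI[of _ F']) auto
  qed
  then obtain F where F: "\<And>j. F j \<subseteq> {K j..<K (Suc j)}"
    "\<And>j. c' / 2 \<le> (\<Sum>k\<in>F j. norm (Z (n j) k) powr p * w (K j + card (F j \<inter> {..<k})))" by metis
  have finF: "finite (F j)" for j using F(1)[of j] finite_subset by blast
  have main: "garling_norm (\<lambda>_. 1) p (comb a unit_vec A) \<le> (4 * 2 powr p / c') powr (1 / p) * gnorm (comb a (Z \<circ> n) A)"
    if A: "finite A" for a A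
  proof -
    define f where "f = comb a (Z \<circ> n) A"
    define a' where "a' i = (if i \<in> A then a i else 0)" for i
    define S where "S = (\<Sum>i\<in>A. norm (a i) powr p)"
    have S: "0 \<le> S" by (auto simp: S_def intro: sum_nonneg)
    obtain J where J: "A \<subseteq> {..<J}" using A finite_nat_iff_bounded by blast
    have f_eq: "f = comb a' (Z \<circ> n) {..<J}"
      unfolding f_def using J by (subst comb_restrict[of "{..<J}" A]) (auto simp: a'_def intro: comb_cong)
    have S_eq: "S = (\<Sum>i<J. norm (a' i) powr p)"
      unfolding S_def a'_def using J p_ge_1 by (intro sum.mono_neutral_cong_left) auto
    define \<alpha> where "\<alpha> = S powr (1 / p)"
    have \<alpha>p: "\<alpha> powr p = S" using S p_ge_1 by (simp add: \<alpha>_def powr_powr)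
    have a'_le: "norm (a' i) \<le> \<alpha>" for i
    proof -
      have "norm (a' i) powr p \<le> S"
        unfolding a'_def S_def using A p_ge_1 by (auto intro: member_le_sum sum_nonneg)
      then have "(norm (a' i) powr p) powr (1 / p) \<le> \<alpha>"
        unfolding \<alpha>_def using p_ge_1 by (intro powr_mono2) auto
      then show ?thesis using p_ge_1 by (simp add: powr_powr)
    qed
    define T where "T j = (\<Sum>k\<in>F j. norm (f k) powr p * w (K j + card (F j \<inter> {..<k})))" for j
    have "(\<Sum>j<m. T j) \<le> gsum (\<Union>j<m. F j) f" for m
    proof (induction m)
      case (Suc m)
      have "(\<Union>j<m. F j) \<subseteq> {..<K m}"
      proof
        fix k assume "k \<in> (\<Union>j<m. F j)"
        then obtain j where "j < m" "k < K (Suc j)" using F(1) by fastforce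
        then show "k \<in> {..<K m}" using K_mono[of "Suc j" m] by auto
      qed
      moreover have "F m \<subseteq> {K m..}" using F(1)[of m] by auto
      ultimately have "gsum (\<Union>j<m. F j) f + T m \<le> gsum ((\<Union>j<m. F j) \<union> F m) f"
        unfolding T_def by (intro gsum_union_ge finF)
      moreover have "(\<Union>j<m. F j) \<union> F m = (\<Union>j<Suc m. F j)" by (auto simp: less_Suc_eq)
      ultimately show ?case using Suc by simp
    qed simp
    moreover have "f \<in> gspace" unfolding f_def using Z_mem by (intro comb_mem) auto
    then have "gsum (\<Union>j<J. F j) f \<le> gnorm f powr p"
      using finF by (intro gsum_le_norm_powr) auto
    ultimately have sum_T: "(\<Sum>j<J. T j) \<le> gnorm f powr p" by (meson order_trans)
    have each: "norm (a' j) powr p * (c' / 2) \<le> 2 powr p * (T j + S * (\<sigma> * (1/2) ^ j))" if j: "j < J" for j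
    proof -
      define d where "d = \<sigma> * (1/2) ^ j / (real (K (Suc j)) + 1)"
      have d: "0 \<le> d" "d \<le> 1" "real (K (Suc j)) * d \<le> \<sigma> * (1/2) ^ j"
      proof -
        define q where "q = \<sigma> * (1/2) ^ j"
        have q: "0 \<le> q" "q \<le> 1" unfolding q_def using \<sigma> mult_le_one[of \<sigma> "(1/2) ^ j"] by (auto simp: power_le_one)
        then show "0 \<le> d" "d \<le> 1" "real (K (Suc j)) * d \<le> \<sigma> * (1/2) ^ j"
          unfolding d_def q_def[symmetric] by (auto simp: divide_simps algebra_simps)
      qed
      have pt: "norm (a' j * Z (n j) k) powr p \<le> 2 powr p * (norm (f k) powr p + S * d)" if k: "k \<in> F j" for k
      proof -
        define r where "r = (\<Sum>i\<in>{Suc j..<J}. a' i * Z (n i) k)"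
        have zero: "Z (n i) k = 0" if "i < j" for i
        proof (rule B)
          have "B (n i) = K (Suc i)" by (simp add: K_def n_def)
          also have "\<dots> \<le> K j" using that by (intro K_mono) auto
          also have "\<dots> \<le> k" using k F(1)[of j] by auto
          finally show "B (n i) \<le> k" .
        qed
        have "f k = (\<Sum>i<J. a' i * Z (n i) k)" by (simp add: f_eq comb_apply)
        also have "\<dots> = (\<Sum>i\<in>{j..<J}. a' i * Z (n i) k)"
          using zero by (intro sum.mono_neutral_right) auto
        also have "\<dots> = a' j * Z (n j) k + r" unfolding r_def using j by (rule sum.atLeast_Suc_lessThan)
        finally have fk: "a' j * Z (n j) k = f k - r" by simp
        have "norm r \<le> (\<Sum>i\<in>{Suc j..<J}. \<alpha> * (\<sigma> * (1/2) ^ i / (real (K (Suc j)) + 1)))"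
          unfolding r_def
        proof (rule sum_norm_le)
          fix i assume i: "i \<in> {Suc j..<J}"
          have "norm (Z (n i) k) \<le> \<sigma> * (1/2) ^ \<psi> i / (real (K i) + 1)"
            using \<psi>(2)[of i k] by (simp add: n_def \<delta>_def K_def)
          also have "\<dots> \<le> \<sigma> * (1/2) ^ i / (real (K (Suc j)) + 1)"
          proof (rule frac_le)
            show "\<sigma> * (1/2) ^ \<psi> i \<le> \<sigma> * (1/2) ^ i"
              using \<sigma> strict_mono_imp_increasing[OF \<psi>(1), of i] by (intro mult_left_mono power_decreasing) auto
            show "real (K (Suc j)) + 1 \<le> real (K i) + 1" using K_mono[of "Suc j" i] i by simp
          qed (use \<sigma> in auto)
          finally show "norm (a' i * Z (n i) k) \<le> \<alpha> * (\<sigma> * (1/2) ^ i / (real (K (Suc j)) + 1))"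
            unfolding norm_mult using a'_le[of i] by (intro mult_mono) (auto intro: order_trans[OF norm_ge_zero])
        qed
        also have "\<dots> = \<alpha> * \<sigma> / (real (K (Suc j)) + 1) * (\<Sum>i\<in>{Suc j..<J}. (1/2) ^ i)"
          by (simp add: sum_distrib_left sum_distrib_right mult_ac)
        also have "\<dots> \<le> \<alpha> * \<sigma> / (real (K (Suc j)) + 1) * (1/2) ^ j"
        proof (rule mult_left_mono)
          show "(\<Sum>i\<in>{Suc j..<J}. (1/2::real) ^ i) \<le> (1/2) ^ j" by (rule sum_half_powers_le)
          show "0 \<le> \<alpha> * \<sigma> / (real (K (Suc j)) + 1)" using \<sigma> by (simp add: \<alpha>_def)
        qed
        also have "\<dots> = \<alpha> * d" by (simp add: d_def)
        finally have "norm r powr p \<le> (\<alpha> * d) powr p" using p_ge_1 by (intro powr_mono2) auto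
        also have "\<dots> = S * d powr p" by (simp add: powr_mult \<alpha>p)
        also have "\<dots> \<le> S * d" using powr_le_self[OF d(1,2) p_ge_1] S by (rule mult_left_mono)
        finally have r: "norm r powr p \<le> S * d" .
        have "norm (a' j * Z (n j) k) powr p \<le> (norm (f k) + norm r) powr p"
          unfolding fk using p_ge_1 by (intro powr_mono2 norm_triangle_ineq4) auto
        also have "\<dots> \<le> 2 powr p * (norm (f k) powr p + norm r powr p)"
          using p_ge_1 by (intro powr_add_le) auto
        also have "\<dots> \<le> 2 powr p * (norm (f k) powr p + S * d)" using r by (intro mult_left_mono) auto
        finally show ?thesis .
      qed
      have "norm (a' j) powr p * (c' / 2) \<le>
          norm (a' j) powr p * (\<Sum>k\<in>F j. norm (Z (n j) k) powr p * w (K j + card (F j \<inter> {..<k})))"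
        using F(2)[of j] by (intro mult_left_mono) auto
      also have "\<dots> = (\<Sum>k\<in>F j. norm (a' j * Z (n j) k) powr p * w (K j + card (F j \<inter> {..<k})))"
        by (simp add: sum_distrib_left norm_mult powr_mult mult.assoc)
      also have "\<dots> \<le> (\<Sum>k\<in>F j. 2 powr p * (norm (f k) powr p + S * d) * w (K j + card (F j \<inter> {..<k})))"
        by (intro sum_mono mult_right_mono pt w_nonneg)
      also have "\<dots> = 2 powr p * (T j + (\<Sum>k\<in>F j. S * d * w (K j + card (F j \<inter> {..<k}))))"
        unfolding T_def sum.distrib[symmetric] sum_distrib_left by (intro sum.cong) (auto simp: algebra_simps)
      also have "\<dots> \<le> 2 powr p * (T j + S * (\<sigma> * (1/2) ^ j))"
      proof (intro mult_left_mono add_left_mono)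
        have "(\<Sum>k\<in>F j. S * d * w (K j + card (F j \<inter> {..<k}))) \<le> (\<Sum>k\<in>F j. S * d)"
          using w_le_1 S d by (intro sum_mono) (simp add: mult_left_le)
        also have "\<dots> = real (card (F j)) * (S * d)" by simp
        also have "\<dots> \<le> real (K (Suc j)) * (S * d)"
          using card_mono[OF _ F(1)[of j]] S d by (intro mult_right_mono) auto
        also have "\<dots> = S * (real (K (Suc j)) * d)" by simp
        also have "\<dots> \<le> S * (\<sigma> * (1/2) ^ j)" using d S by (intro mult_left_mono) auto
        finally show "(\<Sum>k\<in>F j. S * d * w (K j + card (F j \<inter> {..<k}))) \<le> S * (\<sigma> * (1/2) ^ j)" .
      qed simp
      finally show ?thesis .
    qed
    have "S * (c' / 2) = (\<Sum>j<J. norm (a' j) powr p * (c' / 2))"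
      by (simp only: S_eq sum_distrib_right)
    also have "\<dots> \<le> (\<Sum>j<J. 2 powr p * (T j + S * (\<sigma> * (1/2) ^ j)))"
      by (intro sum_mono each) simp
    also have "\<dots> = 2 powr p * (\<Sum>j<J. T j) + S * (2 powr p * (\<sigma> * (\<Sum>j<J. (1/2) ^ j)))"
      unfolding sum_distrib_left sum.distrib[symmetric] by (intro sum.cong) (simp_all add: algebra_simps)
    also have "\<dots> \<le> 2 powr p * gnorm f powr p + S * (c' / 4)"
    proof (intro add_mono mult_left_mono sum_T S)
      have "(\<Sum>j<J. (1/2::real) ^ j) = 2 - 2 * (1/2) ^ J" by (induction J) auto
      then have "(\<Sum>j<J. (1/2::real) ^ j) \<le> 2" by simp
      then have "2 powr p * (\<sigma> * (\<Sum>j<J. (1/2) ^ j)) \<le> 2 powr p * (\<sigma> * 2)"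
        using \<sigma> by (intro mult_left_mono) auto
      then show "2 powr p * (\<sigma> * (\<Sum>j<J. (1/2) ^ j)) \<le> c' / 4" using \<sigma>(3) by (simp add: mult_ac)
    qed simp
    finally have "S \<le> (4 * 2 powr p / c') * gnorm f powr p" using c' by (simp add: field_simps)
    then have "S powr (1 / p) \<le> ((4 * 2 powr p / c') * gnorm f powr p) powr (1 / p)"
      using S p_ge_1 by (intro powr_mono2) auto
    also have "\<dots> = (4 * 2 powr p / c') powr (1 / p) * gnorm f"
      unfolding powr_mult using norm_nonneg[of f] p_ge_1 by (simp add: powr_powr)
    finally show ?thesis unfolding const_weight_norm[OF p_ge_1 A] S_def f_def .
  qed
  have "strict_mono n" using \<psi>(1) by (simp add: n_def strict_mono_Suc_iff)
  moreover have "dominates gnorm (Z \<circ> n) (garling_norm (\<lambda>_. 1) p) unit_vec"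
    by (rule dominatesI[where M = "garling_norm (\<lambda>_. 1) p" and N = "gnorm" and x = "Z \<circ> n" and y = unit_vec, OF main norm_nonneg])
  ultimately show ?thesis by (rule that)
qed

section \<open>The canonical basis\<close>

lemma unit_vec_mem: "unit_vec k \<in> gspace"
  by (rule finite_support_mem[of "{k}"]) (auto simp: unit_vec_def)

lemma unit_vec_expansion:
  fixes f :: "nat \<Rightarrow> 'a::{real_normed_field, euclidean_space}"
  assumes ns: "\<not> summable w" and f: "f \<in> gspace" and e: "0 < e"
  obtains L where "\<And>A. finite A \<Longrightarrow> {..<L} \<subseteq> A \<Longrightarrow> gnorm (comb f unit_vec A - f) < e"
proof -
  obtain L where L: "gnorm (\<lambda>k. if k < L then 0 else f k) < e"
    using tail_small[OF ns f e] by blast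
  have tail: "(\<lambda>k. if k < L then 0 else f k) \<in> gspace" by (rule norm_mono(1)[OF f]) simp
  show ?thesis
  proof (rule that[of L])
    fix A :: "nat set" assume A: "finite A" "{..<L} \<subseteq> A"
    have "gnorm (comb f unit_vec A - f) \<le> gnorm (\<lambda>k. if k < L then 0 else f k)"
      using A by (intro norm_mono(2)[OF tail]) (auto simp: diff_fun_apply comb_unit_vec_apply)
    then show "gnorm (comb f unit_vec A - f) < e" using L by linarith
  qed
qed

lemma closed_span_unit_vec:
  assumes ns: "\<not> summable w"
  shows "closed_span gspace gnorm unit_vec
    = (gspace :: (nat \<Rightarrow> 'a::{real_normed_field, euclidean_space}) set)"
proof -
  interpret banach_seq "gspace :: (nat \<Rightarrow> 'a) set" "gnorm" by (rule banach)
  have r: "range unit_vec \<subseteq> (gspace :: (nat \<Rightarrow> 'a) set)" using unit_vec_mem by auto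
  have "\<exists>g\<in>seq.span (range unit_vec). gnorm (f - g) < e"
    if fe: "f \<in> gspace" "0 < e" for f :: "nat \<Rightarrow> 'a" and e
  proof -
    obtain L where "\<And>A. finite A \<Longrightarrow> {..<L} \<subseteq> A \<Longrightarrow> gnorm (comb f unit_vec A - f) < e"
      using unit_vec_expansion[OF ns fe] by blast
    from this[of "{..<L}"] show ?thesis
      using comb_in_span N_commute[of f] by (intro bexI[of _ "comb f unit_vec {..<L}"]) auto
  qed
  then show ?thesis using closed_span_iff[OF r] by blast
qed

text \<open>Spreading the coefficients out along \<open>\<phi>\<close> changes no positions, hence no weights.\<close>

lemma norm_comb_unit_vec_subseq:
  fixes a :: "nat \<Rightarrow> 'a::{real_normed_field, euclidean_space}"
  assumes \<phi>: "strict_mono \<phi>" and A: "finite A"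
  shows "gnorm (comb a (unit_vec \<circ> \<phi>) A) = gnorm (comb a unit_vec A)"
proof -
  have inj: "inj \<phi>" by (rule strict_mono_imp_inj_on[OF \<phi>])
  let ?f = "comb a unit_vec A" and ?g = "comb a (unit_vec \<circ> \<phi>) A"
  have f: "?f i = (if i \<in> A then a i else 0)" for i by (rule comb_unit_vec_apply[OF A])
  have "?g = comb (a \<circ> inv \<phi>) unit_vec (\<phi> ` A)"
    by (rule comb_subseq[OF inj])
  then have g: "?g i = (if i \<in> \<phi> ` A then a (inv \<phi> i) else 0)" for i
    using comb_unit_vec_apply[of "\<phi> ` A" "a \<circ> inv \<phi>" i] A by simp
  have g\<phi>: "?g (\<phi> k) = ?f k" for k unfolding f g using inj by (auto simp: inj_image_mem_iff)
  have fX: "?f \<in> gspace" by (rule finite_support_mem[OF A]) (simp add: f)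
  have gX: "?g \<in> gspace" by (rule finite_support_mem[of "\<phi> ` A"]) (use A in \<open>auto simp: g\<close>)
  have rank: "card (\<phi> ` F \<inter> {..<\<phi> k}) = card (F \<inter> {..<k})" for F k
  proof -
    have "\<phi> ` F \<inter> {..<\<phi> k} = \<phi> ` (F \<inter> {..<k})" using \<phi> by (auto simp: strict_mono_less)
    then show ?thesis using inj by (simp add: card_image inj_on_subset)
  qed
  have image: "gsum (\<phi> ` F) ?g = gsum F ?f" for F
    unfolding gsum_def by (subst sum.reindex[OF inj_on_subset[OF inj subset_UNIV]]) (simp add: g\<phi> rank)
  have "gnorm ?g \<le> gnorm ?f"
  proof (rule norm_leI(2)[OF norm_nonneg])
    fix F :: "nat set" assume F: "finite F"
    have "gsum F ?g \<le> gsum (F \<inter> range \<phi>) ?g" using F by (intro gsum_support) (auto simp: g)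
    also have "F \<inter> range \<phi> = \<phi> ` (\<phi> -` F)" by auto
    also have "gsum \<dots> ?g = gsum (\<phi> -` F) ?f" by (rule image)
    also have "\<dots> \<le> gnorm ?f powr p"
      by (intro gsum_le_norm_powr fX finite_vimageI F inj)
    finally show "gsum F ?g \<le> gnorm ?f powr p" .
  qed
  moreover have "gnorm ?f \<le> gnorm ?g"
  proof (rule norm_leI(2)[OF norm_nonneg])
    fix F :: "nat set" assume F: "finite F"
    then show "gsum F ?f \<le> gnorm ?g powr p"
      unfolding image[symmetric] by (intro gsum_le_norm_powr gX) auto
  qed
  ultimately show ?thesis by simp
qed

lemma unit_vec_basic_sequence:
  assumes ns: "\<not> summable w" and \<sigma>: "bij \<sigma>"
  shows "basic_sequence (gspace :: (nat \<Rightarrow> 'a::{real_normed_field, euclidean_space}) set)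
    gnorm (unit_vec \<circ> \<sigma>)"
proof -
  interpret banach_seq "gspace :: (nat \<Rightarrow> 'a) set" "gnorm" by (rule banach)
  let ?X = "gspace :: (nat \<Rightarrow> 'a) set" and ?N = "gnorm :: (nat \<Rightarrow> 'a) \<Rightarrow> real"
  let ?e = "unit_vec :: nat \<Rightarrow> nat \<Rightarrow> 'a"
  have range: "range (?e \<circ> \<sigma>) = range ?e" using bij_is_surj[OF \<sigma>] by (metis image_comp)
  have inj: "inj \<sigma>" by (rule bij_is_inj[OF \<sigma>])
  have mem: "range (?e \<circ> \<sigma>) \<subseteq> ?X" using unit_vec_mem by auto
  have eq: "comb a (?e \<circ> \<sigma>) {..<n} = comb (a \<circ> inv \<sigma>) ?e (\<sigma> ` {..<n})" for a n
    by (rule comb_subseq[OF inj])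
  have comb_X: "comb a (?e \<circ> \<sigma>) A \<in> ?X" for a A using mem by (intro comb_mem) auto
  have "\<exists>!a. (\<lambda>n. ?N (comb a (?e \<circ> \<sigma>) {..<n} - f)) \<longlonglongrightarrow> 0" if f: "f \<in> ?X" for f
  proof (rule ex1I[of _ "f \<circ> \<sigma>"])
    show "(\<lambda>n. ?N (comb (f \<circ> \<sigma>) (?e \<circ> \<sigma>) {..<n} - f)) \<longlonglongrightarrow> 0"
    proof (rule LIMSEQ_I)
      fix e :: real assume e: "0 < e"
      obtain L where L: "\<And>A. finite A \<Longrightarrow> {..<L} \<subseteq> A \<Longrightarrow> ?N (comb f ?e A - f) < e"
        using unit_vec_expansion[OF ns f e] by blast
      have "finite (inv \<sigma> ` {..<L})" by simp
      then obtain M where M: "inv \<sigma> ` {..<L} \<subseteq> {..<M}" using finite_nat_iff_bounded by blast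
      have "?N (comb (f \<circ> \<sigma>) (?e \<circ> \<sigma>) {..<n} - f) < e" if n: "M \<le> n" for n
      proof -
        have "{..<L} \<subseteq> \<sigma> ` {..<n}"
        proof
          fix k assume "k \<in> {..<L}"
          then have "inv \<sigma> k \<in> {..<n}" using M n by force
          moreover have "\<sigma> (inv \<sigma> k) = k" using bij_is_surj[OF \<sigma>] by (simp add: surj_f_inv_f)
          ultimately show "k \<in> \<sigma> ` {..<n}" by (metis imageI)
        qed
        moreover have "comb (f \<circ> \<sigma>) (?e \<circ> \<sigma>) {..<n} = comb f ?e (\<sigma> ` {..<n})"
          by (rule comb_comp[OF inj_on_subset[OF inj subset_UNIV]])
        ultimately show ?thesis using L by simp
      qed
      then show "\<exists>no. \<forall>n\<ge>no. norm (?N (comb (f \<circ> \<sigma>) (?e \<circ> \<sigma>) {..<n} - f) - 0) < e"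
        using N_nonneg by (intro exI[of _ M]) simp
    qed
  next
    fix a assume lim: "(\<lambda>n. ?N (comb a (?e \<circ> \<sigma>) {..<n} - f)) \<longlonglongrightarrow> 0"
    show "a = f \<circ> \<sigma>"
    proof
      fix j
      have "norm (a j - f (\<sigma> j)) \<le> ?N (comb a (?e \<circ> \<sigma>) {..<n} - f)" if "j < n" for n
      proof -
        have "(comb a (?e \<circ> \<sigma>) {..<n} - f) (\<sigma> j) = a j - f (\<sigma> j)"
          unfolding eq diff_fun_apply using that inj by (subst comb_unit_vec_apply) auto
        then show ?thesis using coord_le_norm[OF diff_mem[OF comb_X f], of a "{..<n}" "\<sigma> j"] by simp
      qed
      then have "norm (a j - f (\<sigma> j)) \<le> 0"
        by (intro LIMSEQ_le_const[OF lim] exI[of _ "Suc j"]) auto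
      then show "a j = (f \<circ> \<sigma>) j" by simp
    qed
  qed
  then have "schauder_basis ?X ?N ?X (?e \<circ> \<sigma>)"
    unfolding schauder_basis_def limitin_norm_topology comb_def[symmetric]
    using mem comb_X by auto
  moreover have "closed_span ?X ?N (?e \<circ> \<sigma>) = ?X"
    using closed_span_unit_vec[OF ns, where 'a = 'a] unfolding closed_span_def range .
  ultimately show ?thesis using mem by (simp add: basic_sequence_def)
qed

lemma unit_vec_subsymmetric:
  assumes ns: "\<not> summable w"
  shows "subsymmetric (gspace :: (nat \<Rightarrow> 'a::{real_normed_field, euclidean_space}) set)
    gnorm unit_vec"
proof -
  let ?N = "gnorm :: (nat \<Rightarrow> 'a) \<Rightarrow> real"
  have "equivalent_seqs ?N unit_vec (unit_vec \<circ> \<phi>)" if "strict_mono \<phi>" for \<phi>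
    unfolding equivalent_seqs_iff_dominates[of ?N, OF norm_nonneg] dominates_def
    using norm_comb_unit_vec_subseq[OF that, where 'a = 'a] by (intro conjI exI[of _ 1]) auto
  then show ?thesis
    using unit_vec_basic_sequence[OF ns bij_id] unit_vec_basic_sequence[OF ns]
    by (auto simp: subsymmetric_def unconditional_def)
qed

end

section \<open>Domination by a subsymmetric sequence in a Garling space\<close>

lemma const_weight_norm_1:
  "finite A \<Longrightarrow> garling_norm (\<lambda>_. 1) 1 (comb a unit_vec A) = (\<Sum>k\<in>A. norm (a k))"
  by (simp add: const_weight_norm sum_nonneg)

text \<open>Domination passes to finite linear combinations with the same coefficients.\<close>

lemma dominates_combinations:
  assumes "dominates M y L b"
  shows "dominates M (\<lambda>n. comb (e n) y {..<\<mu> n}) L (\<lambda>n. comb (e n) b {..<\<mu> n})"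
proof -
  obtain C where C: "C > 0" "\<And>a A. finite A \<Longrightarrow> L (comb a b A) \<le> C * M (comb a y A)"
    using assms unfolding dominates_def by blast
  have "\<exists>a' B. finite B \<and> comb a (\<lambda>n. comb (e n) y {..<\<mu> n}) A = comb a' y B \<and>
      comb a (\<lambda>n. comb (e n) b {..<\<mu> n}) A = comb a' b B" if A: "finite A" for a A
  proof (intro exI conjI)
    let ?B = "\<Union>n\<in>A. {..<\<mu> n}"
    let ?a = "\<lambda>k. \<Sum>n\<in>A. a n * (if k < \<mu> n then e n k else 0)"
    show "finite ?B" using A by auto
    have "comb a (\<lambda>n. comb (e n) z {..<\<mu> n}) A = comb ?a z ?B" for z
    proof -
      have "comb (e n) z {..<\<mu> n} = comb (\<lambda>k. if k < \<mu> n then e n k else 0) z ?B" if "n \<in> A" for n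
        using that \<open>finite ?B\<close> by (subst comb_restrict[of ?B "{..<\<mu> n}"]) (auto intro: comb_cong)
      then have "comb a (\<lambda>n. comb (e n) z {..<\<mu> n}) A
          = (\<Sum>n\<in>A. \<Sum>k\<in>?B. seq_scale (a n * (if k < \<mu> n then e n k else 0)) (z k))"
        unfolding comb_def[of a] by (intro sum.cong) (simp_all only: comb_def seq.scale_sum_right seq.scale_scale)
      also have "\<dots> = comb ?a z ?B"
        unfolding comb_def by (subst sum.swap) (simp only: seq.scale_sum_left)
      finally show ?thesis .
    qed
    then show "comb a (\<lambda>n. comb (e n) y {..<\<mu> n}) A = comb ?a y ?B"
      "comb a (\<lambda>n. comb (e n) b {..<\<mu> n}) A = comb ?a b ?B" by blast+
  qed
  note common = this
  have "L (comb a (\<lambda>n. comb (e n) b {..<\<mu> n}) A) \<le> C * M (comb a (\<lambda>n. comb (e n) y {..<\<mu> n}) A)"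
    if A: "finite A" for a A
    using common[OF A, of a] C(2) by auto
  then show ?thesis unfolding dominates_def using C(1) by blast
qed

text \<open>Here \<open>q j\<close> bounds the entries of row and column \<open>j\<close> before the diagonal, \<open>2 * j\<close> in number.\<close>

lemma off_diagonal_sum_le:
  fixes s :: "nat \<Rightarrow> nat \<Rightarrow> real"
  assumes s: "\<And>i j. i < j \<Longrightarrow> s i j \<le> q j" "\<And>i j. i < j \<Longrightarrow> s j i \<le> q j"
    and q: "\<And>j. real j * q j \<le> 2 * (1/2) ^ j"
  shows "(\<Sum>j<J. \<Sum>i\<in>{..<J} - {j}. s i j) \<le> 8"
proof -
  have "(\<Sum>j<J. \<Sum>i\<in>{..<J} - {j}. s i j) \<le> 8 - 8 * (1/2) ^ J"
  proof (induction J)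
    case (Suc J)
    have 1: "(\<Sum>i\<in>{..<Suc J} - {j}. s i j) = (\<Sum>i\<in>{..<J} - {j}. s i j) + s J j" if "j < J" for j
    proof -
      have "{..<Suc J} - {j} = insert J ({..<J} - {j})" using that by auto
      then show ?thesis by simp
    qed
    have 2: "{..<Suc J} - {J} = {..<J}" by auto
    have "(\<Sum>j<Suc J. \<Sum>i\<in>{..<Suc J} - {j}. s i j)
        = (\<Sum>j<J. \<Sum>i\<in>{..<J} - {j}. s i j) + (\<Sum>j<J. s J j) + (\<Sum>i<J. s i J)"
      using 1 by (simp add: 2 sum.distrib)
    moreover have "(\<Sum>j<J. s J j) \<le> (\<Sum>j<J. q J)" "(\<Sum>i<J. s i J) \<le> (\<Sum>i<J. q J)"
      by (intro sum_mono s; simp)+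
    ultimately show ?case using Suc q[of J] by simp
  qed simp
  also have "\<dots> \<le> 8" by simp
  finally show ?thesis .
qed

context banach_seq begin

lemma ell1_dominates:
  assumes "range x \<subseteq> X" "\<And>k. N (x k) \<le> M"
  shows "dominates (garling_norm (\<lambda>_. 1) 1) unit_vec N x"
proof (rule dominatesI)
  fix a :: "nat \<Rightarrow> 'a" and A :: "nat set" assume A: "finite A"
  have "N (comb a x A) \<le> (\<Sum>k\<in>A. norm (a k) * N (x k))" using assms by (intro N_comb) auto
  also have "\<dots> \<le> (\<Sum>k\<in>A. norm (a k) * M)" using assms by (intro sum_mono mult_left_mono) auto
  also have "\<dots> = M * (\<Sum>k\<in>A. norm (a k))" by (simp add: sum_distrib_left mult.commute)
  finally show "N (comb a x A) \<le> M * garling_norm (\<lambda>_. 1) 1 (comb a unit_vec A)"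
    by (simp add: const_weight_norm_1[OF A])
qed (simp add: garling_norm_def)

text \<open>A subsymmetric sequence that is not null for some bounded functional dominates the basis of
  \<open>\<ell>\<^sub>1\<close>.\<close>

lemma not_null_dominates_ell1:
  fixes l :: "(nat \<Rightarrow> 'a) \<Rightarrow> 'a"
  assumes x: "subsymmetric X N x"
    and lin: "\<And>a A. l (comb a x A) = (\<Sum>k\<in>A. a k * l (x k))"
    and bd: "\<And>a A. norm (l (comb a x A)) \<le> C * N (comb a x A)" and C: "0 \<le> C"
    and nn: "\<not> (\<lambda>k. l (x k)) \<longlonglongrightarrow> 0"
  shows "dominates N x (garling_norm (\<lambda>_. 1) 1) unit_vec"
proof -
  obtain K where K: "mult_bounded N x K"
    using unconditional_coordinates[of x] x unfolding subsymmetric_def by metis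
  obtain \<delta> where \<delta>: "0 < \<delta>" "\<And>n0. \<exists>n\<ge>n0. \<delta> \<le> norm (l (x n))"
    using nn unfolding LIMSEQ_iff by (auto simp: not_less)
  then have "infinite {n. \<delta> \<le> norm (l (x n))}" unfolding infinite_nat_iff_unbounded_le by blast
  then obtain \<phi> :: "nat \<Rightarrow> nat" where \<phi>: "strict_mono \<phi>" "\<And>n. \<delta> \<le> norm (l (x (\<phi> n)))"
    using infinite_enumerate by blast
  have inj: "inj \<phi>" by (rule strict_mono_imp_inj_on[OF \<phi>(1)])
  have eq: "comb a (x \<circ> \<phi>) A = comb (a \<circ> inv \<phi>) x (\<phi> ` A)" for a A
    by (rule comb_subseq[OF inj])
  have "dominates N (x \<circ> \<phi>) (garling_norm (\<lambda>_. 1) 1) unit_vec"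
  proof (rule dominatesI)
    fix a :: "nat \<Rightarrow> 'a" and A :: "nat set" assume A: "finite A"
    have "(\<Sum>k\<in>A. norm (a k)) \<le> C * K / \<delta> * N (comb a (x \<circ> \<phi>) A)"
    proof (rule sum_coeff_le_of_functional[OF mult_bounded_subseq[OF K inj] A \<delta>(1) C])
      show "l (comb a (x \<circ> \<phi>) A) = (\<Sum>k\<in>A. a k * l ((x \<circ> \<phi>) k))" for a
        unfolding eq lin using inj by (subst sum.reindex) (auto simp: inj_on_subset[OF inj])
      show "norm (l (comb a (x \<circ> \<phi>) A)) \<le> C * N (comb a (x \<circ> \<phi>) A)" for a unfolding eq by (rule bd)
    qed (use \<phi> in auto)
    then show "garling_norm (\<lambda>_. 1) 1 (comb a unit_vec A) \<le> C * K / \<delta> * N (comb a (x \<circ> \<phi>) A)"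
      by (simp add: const_weight_norm_1[OF A])
  qed (rule N_nonneg)
  then show ?thesis by (rule dominates_trans[OF subsymmetric_dominates_subseq(1)[OF x \<phi>(1)]])
qed

end

context garling begin

lemma ell_dominates_disjoint:
  fixes b :: "nat \<Rightarrow> nat \<Rightarrow> 'a::real_normed_field"
  assumes "\<And>k l i. b k i \<noteq> 0 \<Longrightarrow> b l i \<noteq> 0 \<Longrightarrow> k = l"
    "\<And>k. b k \<in> gspace" "\<And>k. gnorm (b k) \<le> M"
  shows "dominates (garling_norm (\<lambda>_. 1) p) unit_vec gnorm b"
proof (rule dominatesI)
  fix a :: "nat \<Rightarrow> 'a" and A :: "nat set" assume A: "finite A"
  show "gnorm (comb a b A) \<le> M * garling_norm (\<lambda>_. 1) p (comb a unit_vec A)"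
    using norm_comb_disjoint_le[OF A assms] by (simp add: const_weight_norm[OF p_ge_1 A])
qed (simp add: garling_norm_def)

text \<open>
  Up to equivalence, a subsymmetric sequence of the space consists of finitely and disjointly
  supported vectors of some Garling-type space: it is either coordinatewise null, in which case a
  subsequence is a small perturbation of such vectors, or equivalent to the basis of \<open>\<ell>\<^sub>1\<close>.
\<close>

lemma disjoint_model:
  fixes y :: "nat \<Rightarrow> nat \<Rightarrow> 'a::{real_normed_field, euclidean_space}"
  assumes ns: "\<not> summable w" and y: "subsymmetric gspace gnorm y"
  obtains w' p' and b :: "nat \<Rightarrow> nat \<Rightarrow> 'a" and M where "garling w' p'"
    "\<And>k. \<exists>B. \<forall>i\<ge>B. b k i = 0" "\<And>k l i. b k i \<noteq> 0 \<Longrightarrow> b l i \<noteq> 0 \<Longrightarrow> k = l"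
    "\<And>k. garling_norm w' p' (b k) \<le> M"
    "dominates gnorm y (garling_norm w' p') b"
    "dominates (garling_norm w' p') b gnorm y"
proof -
  interpret banach_seq "gspace :: (nat \<Rightarrow> 'a) set" "gnorm" by (rule banach)
  let ?N = "gnorm :: (nat \<Rightarrow> 'a) \<Rightarrow> real"
  have y_mem: "y k \<in> gspace" for k using subsymmetric_range[OF y] by auto
  obtain m M where m: "0 < m" "\<And>k. m \<le> ?N (y k)" and M: "\<And>k. ?N (y k) \<le> M"
    using subsymmetric_seminormalized[OF y] by blast
  show ?thesis
  proof (cases "\<exists>j. \<not> (\<lambda>k. y k j) \<longlonglongrightarrow> 0")
    case True
    then obtain j where j: "\<not> (\<lambda>k. y k j) \<longlonglongrightarrow> 0" by blast
    show ?thesis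
    proof (rule that[of "\<lambda>_. 1" 1 unit_vec 1])
      show "garling (\<lambda>_. 1) 1" by (rule garling_const) simp
      show "\<exists>B. \<forall>i\<ge>B. unit_vec k i = (0::'a)" for k
        by (intro exI[of _ "Suc k"]) (auto simp: unit_vec_def)
      show "k = l" if "unit_vec k i \<noteq> (0::'a)" "unit_vec l i \<noteq> (0::'a)" for k l i
        using that by (auto simp: unit_vec_def split: if_splits)
      have "unit_vec k = comb (\<lambda>_. 1::'a) unit_vec {k}" for k by (simp add: comb_def)
      then show "garling_norm (\<lambda>_. 1) 1 (unit_vec k :: nat \<Rightarrow> 'a) \<le> 1" for k
        using const_weight_norm_1[of "{k}" "\<lambda>_. 1::'a"] by simp
      show "dominates ?N y (garling_norm (\<lambda>_. 1) 1) unit_vec"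
      proof (rule not_null_dominates_ell1[OF y, of "\<lambda>f. f j" 1])
        have "comb a y A \<in> gspace" for a A by (intro comb_mem y_mem)
        from coord_le_norm[OF this, of _ _ j]
        show "norm (comb a y A j) \<le> 1 * ?N (comb a y A)" for a A by simp
      qed (use j in \<open>auto simp: comb_apply\<close>)
      show "dominates (garling_norm (\<lambda>_. 1) 1) unit_vec ?N y"
        by (rule ell1_dominates[OF subsymmetric_range[OF y] M])
    qed
  next
    case False
    then have null: "(\<lambda>k. y k j) \<longlonglongrightarrow> 0" for j by blast
    obtain K where K: "0 < K" "mult_bounded ?N y K"
      using unconditional_coordinates[of y] y unfolding subsymmetric_def by metis
    \<comment> \<open>Small enough for the perturbation to be reversible.\<close>
    define \<eta> where "\<eta> = m / (8 * K)"
    have \<eta>: "0 < \<eta>" "K / m * (4 * \<eta>) < 1" using m K by (auto simp: \<eta>_def)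
    define tl where "tl L f = (\<lambda>k::nat. if k < L then 0 else f k)" for L :: nat and f :: "nat \<Rightarrow> 'a"
    have "\<exists>L. ?N (tl L (y n)) < \<eta> * (1/2) ^ n" for n
      unfolding tl_def using \<eta>(1) by (intro tail_small[OF ns y_mem]) auto
    then obtain L0 where L0: "\<And>n. ?N (tl (L0 n) (y n)) < \<eta> * (1/2) ^ n" by metis
    define L where "L n = (\<Sum>i\<le>n. L0 i)" for n
    have L_mono: "L i \<le> L j" if "i \<le> j" for i j unfolding L_def using that by (intro sum_mono2) auto
    have tl_mem: "tl i f \<in> gspace" if "f \<in> gspace" for i f
      by (rule norm_mono(1)[OF that]) (simp add: tl_def)
    have L: "?N (tl (L n) (y n)) \<le> \<eta> * (1/2) ^ n" for n
    proof -
      have "L0 n \<le> L n" unfolding L_def by (intro member_le_sum) auto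
      then have "?N (tl (L n) (y n)) \<le> ?N (tl (L0 n) (y n))"
        by (intro norm_mono(2) tl_mem y_mem) (simp add: tl_def)
      then show ?thesis using L0[of n] by linarith
    qed
    have hd_lim: "(\<lambda>n. ?N (comb (y n) unit_vec {..<l})) \<longlonglongrightarrow> 0" for l
    proof (rule tendsto_sandwich[OF _ _ tendsto_const])
      show "\<forall>\<^sub>F n in sequentially. ?N (comb (y n) unit_vec {..<l}) \<le> (\<Sum>j<l. norm (y n j) * ?N (unit_vec j))"
        by (intro always_eventually allI N_comb unit_vec_mem)
      have "(\<lambda>n. \<Sum>j<l. norm (y n j) * ?N (unit_vec j)) \<longlonglongrightarrow> (\<Sum>j<l. 0 * ?N (unit_vec j))"
        by (intro tendsto_sum tendsto_mult tendsto_const tendsto_norm_zero null)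
      then show "(\<lambda>n. \<Sum>j<l. norm (y n j) * ?N (unit_vec j)) \<longlonglongrightarrow> 0" by simp
    qed (simp add: norm_nonneg)
    have "\<exists>n0. \<forall>n\<ge>n0. ?N (comb (y n) unit_vec {..<L i}) \<le> \<eta> * (1/2) ^ i" for i
    proof -
      have "\<forall>\<^sub>F n in sequentially. ?N (comb (y n) unit_vec {..<L i}) < \<eta> * (1/2) ^ i"
        using \<eta>(1) by (intro order_tendstoD(2)[OF hd_lim]) simp
      then show ?thesis unfolding eventually_sequentially by (meson less_imp_le)
    qed
    then obtain \<psi> :: "nat \<Rightarrow> nat" where \<psi>: "strict_mono \<psi>"
      "\<And>j. ?N (comb (y (\<psi> (Suc j))) unit_vec {..<L (\<psi> j)}) \<le> \<eta> * (1/2) ^ \<psi> j"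
      using strict_mono_eventually_choice[of "\<lambda>i n. ?N (comb (y n) unit_vec {..<L i}) \<le> \<eta> * (1/2) ^ i"] by blast
    define \<phi> where "\<phi> j = \<psi> (Suc j)" for j
    have \<phi>: "strict_mono \<phi>" using \<psi>(1) by (simp add: \<phi>_def strict_mono_Suc_iff)
    have pow: "(1/2::real) ^ \<psi> j \<le> (1/2) ^ j" "(1/2::real) ^ \<phi> j \<le> (1/2) ^ j" for j
      using strict_mono_imp_increasing[OF \<psi>(1), of j] strict_mono_imp_increasing[OF \<phi>, of j]
      by (auto intro: power_decreasing)
    define b where "b j = (\<lambda>i. if L (\<psi> j) \<le> i \<and> i < L (\<phi> j) then y (\<phi> j) i else 0)" for j
    have b_pt: "norm (b j i) \<le> norm (y (\<phi> j) i)" for j i by (simp add: b_def)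
    have b_mem: "b j \<in> gspace" for j by (rule norm_mono(1)[OF y_mem b_pt])
    have b_le: "?N (b j) \<le> M" for j using norm_mono(2)[OF y_mem b_pt, of j] M[of "\<phi> j"] by linarith
    have disj: "k = l" if "b k i \<noteq> 0" "b l i \<noteq> 0" for k l i
    proof (rule ccontr)
      assume "k \<noteq> l"
      moreover have False if "k < l" "b k i \<noteq> 0" "b l i \<noteq> 0" for k l
      proof -
        have "L (\<phi> k) \<le> L (\<psi> l)"
          using that(1) \<psi>(1) by (intro L_mono) (simp add: \<phi>_def strict_mono_less_eq)
        then show False using that by (auto simp: b_def split: if_splits)
      qed
      ultimately show False using that by (metis linorder_neqE_nat)
    qed
    have close: "?N (b j - y (\<phi> j)) \<le> 2 * \<eta> * (1/2) ^ j" for j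
    proof -
      let ?h = "comb (y (\<phi> j)) unit_vec {..<L (\<psi> j)}" and ?t = "tl (L (\<phi> j)) (y (\<phi> j))"
      have h: "?h \<in> gspace" by (intro comb_mem unit_vec_mem)
      have "L (\<psi> j) \<le> L (\<phi> j)" using \<psi>(1) by (intro L_mono) (simp add: \<phi>_def strict_mono_less_eq)
      then have "b j - y (\<phi> j) = - (?h + ?t)"
        by (auto simp: fun_eq_iff diff_fun_apply b_def tl_def comb_unit_vec_apply)
      then have "?N (b j - y (\<phi> j)) = ?N (?h + ?t)" by (simp only: norm_minus)
      also have "\<dots> \<le> ?N ?h + ?N ?t" by (intro norm_add(2) h tl_mem y_mem)
      also have "\<dots> \<le> \<eta> * (1/2) ^ \<psi> j + \<eta> * (1/2) ^ \<phi> j"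
        using \<psi>(2)[of j] L[of "\<phi> j"] by (intro add_mono) (auto simp: \<phi>_def)
      also have "\<dots> \<le> \<eta> * (1/2) ^ j + \<eta> * (1/2) ^ j" using pow \<eta> by (intro add_mono mult_left_mono) auto
      finally show ?thesis by simp
    qed
    have small: "(\<Sum>j\<in>A. ?N (b j - (y \<circ> \<phi>) j)) \<le> 4 * \<eta>" if A: "finite A" for A
    proof -
      have "(\<Sum>j\<in>A. ?N (b j - (y \<circ> \<phi>) j)) \<le> (\<Sum>j\<in>A. 2 * \<eta> * (1/2) ^ j)" using close by (intro sum_mono) simp
      also have "\<dots> \<le> (\<Sum>j. 2 * \<eta> * (1/2) ^ j)"
        using \<eta>(1) A by (intro sum_le_suminf summable_mult summable_geometric) auto
      also have "\<dots> = 4 * \<eta>" by (simp add: suminf_mult suminf_geometric)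
      finally show ?thesis .
    qed
    have y\<phi>: "mult_bounded ?N (y \<circ> \<phi>) K" by (rule mult_bounded_subseq[OF K(2) strict_mono_imp_inj_on[OF \<phi>]])
    have pert: "dominates ?N (y \<circ> \<phi>) ?N b" "dominates ?N b ?N (y \<circ> \<phi>)"
    proof -
      have r: "range (y \<circ> \<phi>) \<subseteq> gspace" "range b \<subseteq> gspace" "\<And>k. m \<le> ?N ((y \<circ> \<phi>) k)"
        using y_mem b_mem m(2) by auto
      note pert = dominates_perturbation[OF y\<phi> K(1) r m(1) small]
      show "dominates ?N (y \<circ> \<phi>) ?N b" by (rule pert(1))
      show "dominates ?N b ?N (y \<circ> \<phi>)" by (rule pert(2)[OF _ \<eta>(2)])
    qed
    show ?thesis
    proof (rule that[of w p b M])
      show "\<exists>B. \<forall>i\<ge>B. b k i = 0" for k by (intro exI[of _ "L (\<phi> k)"]) (auto simp: b_def)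
      show "dominates ?N y ?N b"
        by (rule dominates_trans[OF subsymmetric_dominates_subseq(1)[OF y \<phi>] pert(1)])
      show "dominates ?N b ?N y"
        by (rule dominates_trans[OF pert(2) subsymmetric_dominates_subseq(2)[OF y \<phi>]])
    qed (use b_le disj garling_axioms in auto)
  qed
qed

end

context banach_seq begin

text \<open>
  If the coordinates of a coordinatewise null subsymmetric sequence \<open>x\<close> with respect to \<open>y\<close> do not
  tend uniformly to \<open>0\<close>, then \<open>x\<close> dominates \<open>y\<close>: along suitable subsequences the
  coordinate of \<open>x (n j)\<close> at \<open>k j\<close> stays away from \<open>0\<close>, while the coordinates at \<open>k i\<close>
  with \<open>i \<noteq> j\<close> are summably small, so that projecting onto the vectors \<open>y (k j)\<close> is almost a
  diagonal operator.
\<close>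

lemma dominates_if_large_coordinates:
  assumes x: "subsymmetric X N x" and y: "subsymmetric X N y"
    and Kx: "0 < Kx" "mult_bounded N x Kx" and K: "0 < K" "mult_bounded N y K"
    and c_proj: "\<And>a A B. finite B \<Longrightarrow> N (comb (c (comb a x A)) y B) \<le> K * N (comb a x A)"
    and c_comb: "\<And>a A k. c (comb a x A) k = (\<Sum>i\<in>A. a i * c (x i) k)"
    and c_lim: "\<And>n. (\<lambda>k. c (x n) k) \<longlonglongrightarrow> 0"
    and null: "\<And>k. (\<lambda>n. c (x n) k) \<longlonglongrightarrow> 0"
    and \<delta>: "0 < \<delta>" "\<And>n0. \<exists>n\<ge>n0. \<exists>k. \<delta> < norm (c (x n) k)"
  shows "dominates N x N y"
proof -
  obtain mx Mx where mx: "0 < mx" "\<And>k. mx \<le> N (x k)" and "\<And>k. N (x k) \<le> Mx"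
    using subsymmetric_seminormalized[OF x] by blast
  obtain my My where "0 < my" "\<And>k. my \<le> N (y k)" and My: "\<And>k. N (y k) \<le> My"
    using subsymmetric_seminormalized[OF y] by blast
  have y_mem: "y k \<in> X" and x_mem: "x k \<in> X" for k using subsymmetric_range[OF x] subsymmetric_range[OF y] by auto
  have My0: "0 \<le> My" using order_trans[OF N_nonneg My[of 0]] .
  have "infinite {n. \<exists>k. \<delta> < norm (c (x n) k)}"
    unfolding infinite_nat_iff_unbounded_le by (simp add: \<delta>(2))
  then obtain \<phi> :: "nat \<Rightarrow> nat" where \<phi>: "strict_mono \<phi>" "\<forall>n. \<phi> n \<in> {n. \<exists>k. \<delta> < norm (c (x n) k)}"
    using infinite_enumerate by blast
  define \<kappa> where "\<kappa> n = (SOME k. \<delta> < norm (c (x (\<phi> n)) k))" for n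
  have \<kappa>: "\<delta> < norm (c (x (\<phi> n)) (\<kappa> n))" for n
    unfolding \<kappa>_def by (rule someI_ex) (use \<phi>(2) in simp)
  define u where "u = x \<circ> \<phi>"
  have u_null: "(\<lambda>n. c (u n) k) \<longlonglongrightarrow> 0" for k
    using LIMSEQ_subseq_LIMSEQ[OF null \<phi>(1)] by (simp add: u_def o_def)
  have \<kappa>_lim: "filterlim \<kappa> at_top sequentially"
    unfolding filterlim_at_top
  proof
    fix Z
    have "\<forall>\<^sub>F n in sequentially. norm (c (u n) k) < \<delta>" for k
      using order_tendstoD(2)[OF tendsto_norm_zero[OF u_null]] \<delta>(1) by blast
    then have "\<forall>\<^sub>F n in sequentially. \<forall>k\<in>{..<Z}. norm (c (u n) k) < \<delta>" by (intro eventually_ball_finite) auto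
    then show "\<forall>\<^sub>F n in sequentially. Z \<le> \<kappa> n"
    proof eventually_elim
      case (elim n)
      then show ?case using \<kappa>[of n] unfolding u_def by (metis comp_apply lessThan_iff not_less order_less_asym)
    qed
  qed
  define \<theta> :: "nat \<Rightarrow> real" where "\<theta> m = (1/2) ^ m / (real m + 1)" for m
  have \<theta>_pos: "0 < \<theta> m" for m by (simp add: \<theta>_def add_nonneg_pos)
  have \<theta>_mono: "\<theta> n \<le> \<theta> m" if "m \<le> n" for m n
    unfolding \<theta>_def using that by (intro frac_le power_decreasing) auto
  define Q where "Q m n \<longleftrightarrow> (\<forall>l\<in>{..m}. norm (c (u n) (\<kappa> l)) < \<theta> m \<and> norm (c (u l) (\<kappa> n)) < \<theta> m \<and> \<kappa> l < \<kappa> n)" for m n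
  have "\<forall>\<^sub>F n in sequentially. Q m n" for m
    unfolding Q_def
  proof (intro eventually_ball_finite ballI eventually_conj)
    fix l
    show "\<forall>\<^sub>F n in sequentially. norm (c (u n) (\<kappa> l)) < \<theta> m"
      by (rule order_tendstoD(2)[OF tendsto_norm_zero[OF u_null] \<theta>_pos])
    have "(\<lambda>n. c (u l) (\<kappa> n)) \<longlonglongrightarrow> 0"
      using filterlim_compose[OF c_lim \<kappa>_lim] by (simp add: u_def)
    then show "\<forall>\<^sub>F n in sequentially. norm (c (u l) (\<kappa> n)) < \<theta> m"
      by (rule order_tendstoD(2)[OF tendsto_norm_zero \<theta>_pos])
    show "\<forall>\<^sub>F n in sequentially. \<kappa> l < \<kappa> n"
      using \<kappa>_lim unfolding filterlim_at_top by (simp flip: Suc_le_eq)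
  qed simp
  then have "\<exists>n0. \<forall>n\<ge>n0. Q m n" for m unfolding eventually_sequentially .
  then obtain \<psi> :: "nat \<Rightarrow> nat" where \<psi>: "strict_mono \<psi>" "\<And>j. Q (\<psi> j) (\<psi> (Suc j))"
    using strict_mono_eventually_choice[of Q] by blast
  define v where "v = u \<circ> \<psi>"
  define \<kappa>' where "\<kappa>' = \<kappa> \<circ> \<psi>"
  have later: "norm (c (v j) (\<kappa>' i)) \<le> \<theta> (j - 1)" "norm (c (v i) (\<kappa>' j)) \<le> \<theta> (j - 1)" "\<kappa>' i < \<kappa>' j"
    if ij: "i < j" for i j
  proof -
    obtain j' where j': "j = Suc j'" using ij by (cases j) auto
    have "\<psi> i \<le> \<psi> j'" using ij j' \<psi>(1) by (simp add: strict_mono_less_eq)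
    then have *: "norm (c (u (\<psi> j)) (\<kappa> (\<psi> i))) < \<theta> (\<psi> j')" "norm (c (u (\<psi> i)) (\<kappa> (\<psi> j))) < \<theta> (\<psi> j')"
        "\<kappa> (\<psi> i) < \<kappa> (\<psi> j)"
      using \<psi>(2)[of j'] unfolding Q_def j' by auto
    have "\<theta> (\<psi> j') \<le> \<theta> j'" by (rule \<theta>_mono[OF strict_mono_imp_increasing[OF \<psi>(1)]])
    then show "norm (c (v j) (\<kappa>' i)) \<le> \<theta> (j - 1)" "norm (c (v i) (\<kappa>' j)) \<le> \<theta> (j - 1)" "\<kappa>' i < \<kappa>' j"
      using * by (auto simp: v_def \<kappa>'_def j')
  qed
  have \<kappa>': "strict_mono \<kappa>'" using later(3) by (rule strict_monoI)
  have \<theta>_sum: "real j * \<theta> (j - 1) \<le> 2 * (1/2) ^ j" for j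
    by (cases j) (simp_all add: \<theta>_def field_simps)
  define \<tau> where "\<tau> = \<phi> \<circ> \<psi>"
  have v_eq: "v = x \<circ> \<tau>" by (simp add: v_def u_def \<tau>_def o_assoc)
  have sm: "strict_mono \<tau>" unfolding \<tau>_def using \<phi>(1) \<psi>(1) by (rule strict_mono_o)
  have inj: "inj \<tau>" by (rule strict_mono_imp_inj_on[OF sm])
  have v_comb: "comb a v A = comb (a \<circ> inv \<tau>) x (\<tau> ` A)" for a A
    unfolding v_eq by (rule comb_subseq[OF inj])
  have c_v: "c (comb a v A) k = (\<Sum>i\<in>A. a i * c (v i) k)" for a A k
    unfolding v_comb c_comb using inj
    by (subst sum.reindex[OF inj_on_subset[OF inj subset_UNIV]]) (simp add: v_eq)
  have dom: "dominates N v N (y \<circ> \<kappa>')"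
  proof (rule dominatesI[OF _ N_nonneg])
    fix a :: "nat \<Rightarrow> 'a" and A :: "nat set" assume A: "finite A"
    define f where "f = comb a v A"
    define d where "d j = c (v j) (\<kappa>' j)" for j
    define R where "R = Kx / mx * N f"
    have R: "norm (a j) \<le> R" if "j \<in> A" for j
      unfolding R_def f_def
      by (rule coeff_bound[OF mult_bounded_subseq[OF Kx(2) inj, folded v_eq] _ A that _ mx(1)])
        (use x_mem mx in \<open>auto simp: v_eq\<close>)
    have R0: "0 \<le> R" unfolding R_def using Kx(1) mx(1) N_nonneg by simp
    have d: "\<delta> \<le> norm (d j)" "d j \<noteq> 0" for j
      using \<kappa>[of "\<psi> j"] \<delta>(1) by (auto simp: d_def v_eq \<tau>_def \<kappa>'_def)
    define off where "off j = (\<Sum>i\<in>A - {j}. a i * c (v i) (\<kappa>' j))" for j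
    have coord: "c f (\<kappa>' j) = d j * a j + off j" if "j \<in> A" for j
      unfolding f_def c_v off_def d_def using A that by (subst sum.remove[of A j]) (auto simp: mult.commute)
    \<comment> \<open>The multipliers \<open>\<delta> / d j\<close> turn the diagonal part into \<open>\<delta> * a j\<close>.\<close>
    have "seq_scale (of_real \<delta>) (comb a (y \<circ> \<kappa>') A) = comb (\<lambda>j. of_real \<delta> / d j * (d j * a j)) (y \<circ> \<kappa>') A"
      unfolding comb_scale[symmetric] using d by (intro comb_cong) auto
    then have "\<delta> * N (comb a (y \<circ> \<kappa>') A) = N (comb (\<lambda>j. of_real \<delta> / d j * (d j * a j)) (y \<circ> \<kappa>') A)"
      using N_scale[of "comb a (y \<circ> \<kappa>') A" "of_real \<delta>"] \<delta>(1) y_mem comb_mem[of A "y \<circ> \<kappa>'" a] by simp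
    also have "\<dots> \<le> K * N (comb (\<lambda>j. d j * a j) (y \<circ> \<kappa>') A)"
      using d \<delta>(1) by (intro mult_boundedD[OF mult_bounded_subseq[OF K(2)] A] strict_mono_imp_inj_on \<kappa>')
        (simp add: norm_divide divide_le_eq_1)
    also have "\<dots> \<le> K * (K * N f + My * (R * 8))"
    proof (rule mult_left_mono)
      have y\<kappa>: "(y \<circ> \<kappa>') j \<in> X" for j by (simp add: y_mem)
      have "comb (\<lambda>j. d j * a j) (y \<circ> \<kappa>') A = comb (\<lambda>j. c f (\<kappa>' j) - off j) (y \<circ> \<kappa>') A"
        using coord by (intro comb_cong) auto
      also have "\<dots> = comb (\<lambda>j. c f (\<kappa>' j)) (y \<circ> \<kappa>') A - comb off (y \<circ> \<kappa>') A"
        by (rule comb_diff)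
      finally have "N (comb (\<lambda>j. d j * a j) (y \<circ> \<kappa>') A)
          \<le> N (comb (\<lambda>j. c f (\<kappa>' j)) (y \<circ> \<kappa>') A) + N (comb off (y \<circ> \<kappa>') A)"
        by (simp only:) (intro N_diff_triangle comb_mem y\<kappa>)
      moreover have "comb (\<lambda>j. c f (\<kappa>' j)) (y \<circ> \<kappa>') A = comb (c f) y (\<kappa>' ` A)"
        using comb_comp[of \<kappa>' A "c f" y] strict_mono_imp_inj_on[OF \<kappa>'] by (simp add: inj_on_def o_def)
      then have "N (comb (\<lambda>j. c f (\<kappa>' j)) (y \<circ> \<kappa>') A) \<le> K * N f"
        using c_proj[of "\<kappa>' ` A"] A by (simp add: f_def v_comb)
      moreover have "N (comb off (y \<circ> \<kappa>') A) \<le> My * (R * 8)"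
      proof -
        obtain J where J: "A \<subseteq> {..<J}" using A finite_nat_iff_bounded by blast
        let ?s = "\<lambda>i j. norm (c (v i) (\<kappa>' j))"
        have off_le: "norm (off j) \<le> R * (\<Sum>i\<in>{..<J} - {j}. ?s i j)" for j
        proof -
          have "norm (off j) \<le> (\<Sum>i\<in>A - {j}. R * ?s i j)"
            unfolding off_def using R by (intro sum_norm_le) (simp add: norm_mult mult_right_mono)
          also have "\<dots> \<le> (\<Sum>i\<in>{..<J} - {j}. R * ?s i j)"
            using J R0 by (intro sum_mono2) auto
          finally show ?thesis by (simp add: sum_distrib_left)
        qed
        have "N (comb off (y \<circ> \<kappa>') A) \<le> (\<Sum>j\<in>A. norm (off j) * N ((y \<circ> \<kappa>') j))" by (rule N_comb[OF y\<kappa>])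
        also have "\<dots> \<le> (\<Sum>j\<in>A. R * (\<Sum>i\<in>{..<J} - {j}. ?s i j) * My)"
          using off_le My N_nonneg R0 by (intro sum_mono mult_mono) (auto intro!: mult_nonneg_nonneg sum_nonneg)
        also have "\<dots> \<le> (\<Sum>j<J. R * (\<Sum>i\<in>{..<J} - {j}. ?s i j) * My)"
          using J R0 My0 by (intro sum_mono2) (auto intro!: mult_nonneg_nonneg sum_nonneg)
        also have "\<dots> = My * (R * (\<Sum>j<J. \<Sum>i\<in>{..<J} - {j}. ?s i j))"
          by (simp only: sum_distrib_left sum_distrib_right mult_ac)
        also have "\<dots> \<le> My * (R * 8)"
          using My0 R0 by (intro mult_left_mono off_diagonal_sum_le[where q = "\<lambda>j. \<theta> (j - 1)"] later(1,2) \<theta>_sum)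
        finally show ?thesis .
      qed
      ultimately show "N (comb (\<lambda>j. d j * a j) (y \<circ> \<kappa>') A) \<le> K * N f + My * (R * 8)" by linarith
    qed (use K in simp)
    also have "\<dots> = K * (K + My * (Kx / mx) * 8) * N f" by (simp add: R_def algebra_simps)
    finally show "N (comb a (y \<circ> \<kappa>') A) \<le> (K * (K + My * (Kx / mx) * 8) / \<delta>) * N (comb a v A)"
      using \<delta>(1) by (simp add: f_def field_simps)
  qed
  show ?thesis
    using dominates_trans[OF subsymmetric_dominates_subseq(1)[OF x sm, folded v_eq]
        dominates_trans[OF dom subsymmetric_dominates_subseq(2)[OF y \<kappa>']]] .
qed

end

context garling begin

text \<open>
  The remaining case, in which the coordinates tend uniformly to \<open>0\<close>. Truncated expansions are
  transferred from \<open>y\<close> to a disjointly supported model \<open>b\<close>, where their coefficients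
  tend uniformly to \<open>0\<close>; hence \<open>x\<close> dominates the basis of some \<open>\<ell>\<^sub>p\<close>, which dominates \<open>b\<close>.
\<close>

lemma dominates_if_small_coordinates:
  fixes x y :: "nat \<Rightarrow> nat \<Rightarrow> 'a::{real_normed_field, euclidean_space}"
  assumes ns: "\<not> summable w"
    and x: "subsymmetric gspace gnorm x"
    and y: "subsymmetric gspace gnorm y"
    and lim: "\<And>n. (\<lambda>m. gnorm (comb (c n) y {..<m} - x n)) \<longlonglongrightarrow> 0"
    and small: "\<And>e. 0 < e \<Longrightarrow> \<exists>n0. \<forall>n\<ge>n0. \<forall>k. norm (c n k) \<le> e"
  shows "dominates gnorm x gnorm y"
proof -
  interpret banach_seq "gspace :: (nat \<Rightarrow> 'a) set" "gnorm" by (rule banach)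
  let ?N = "gnorm :: (nat \<Rightarrow> 'a) \<Rightarrow> real"
  have y_mem: "y k \<in> gspace" and x_mem: "x k \<in> gspace" for k
    using subsymmetric_range[OF x] subsymmetric_range[OF y] by auto
  obtain K where K: "0 < K" "mult_bounded ?N x K"
    using unconditional_coordinates[of x] x unfolding subsymmetric_def by metis
  obtain m M' where m: "0 < m" "\<And>k. m \<le> ?N (x k)" and "\<And>k. ?N (x k) \<le> M'"
    using subsymmetric_seminormalized[OF x] by blast
  obtain w' p' and b :: "nat \<Rightarrow> nat \<Rightarrow> 'a" and M where b: "garling w' p'"
    "\<And>k. \<exists>B. \<forall>i\<ge>B. b k i = 0" "\<And>k l i. b k i \<noteq> 0 \<Longrightarrow> b l i \<noteq> 0 \<Longrightarrow> k = l"
    "\<And>k. garling_norm w' p' (b k) \<le> M"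
    "dominates ?N y (garling_norm w' p') b" "dominates (garling_norm w' p') b ?N y"
    using disjoint_model[OF ns y] by blast
  interpret G: garling w' p' by (rule b(1))
  have b_mem: "b k \<in> garling_space w' p'" for k
  proof -
    obtain B where "\<And>i. i \<ge> B \<Longrightarrow> b k i = 0" using b(2) by blast
    then show ?thesis by (intro G.finite_support_mem[of "{..<B}"]) auto
  qed
  have M0: "0 \<le> M" using order_trans[OF G.norm_nonneg b(4)[of 0]] .
  have "\<exists>\<mu>. ?N (comb (c n) y {..<\<mu>} - x n) < m / 2 * (1/2) ^ n" for n
  proof -
    have "\<forall>\<^sub>F \<mu> in sequentially. ?N (comb (c n) y {..<\<mu>} - x n) < m / 2 * (1/2) ^ n"
      using m by (intro order_tendstoD(2)[OF lim]) simp
    then show ?thesis by (auto simp: eventually_sequentially)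
  qed
  then obtain \<mu> where \<mu>: "\<And>n. ?N (comb (c n) y {..<\<mu> n} - x n) < m / 2 * (1/2) ^ n" by metis
  define x' where "x' n = comb (c n) y {..<\<mu> n}" for n
  define Z where "Z n = comb (c n) b {..<\<mu> n}" for n
  have x'_mem: "x' n \<in> gspace" for n unfolding x'_def by (intro comb_mem y_mem)
  have "dominates ?N x ?N x'"
  proof (rule dominates_perturbation(1)[OF K(2,1) _ _ m(2,1), of _ m])
    fix A :: "nat set" assume A: "finite A"
    have "(\<Sum>n\<in>A. ?N (x' n - x n)) \<le> (\<Sum>n\<in>A. m / 2 * (1/2) ^ n)"
      using \<mu> by (intro sum_mono) (auto simp: x'_def intro: less_imp_le)
    also have "\<dots> \<le> (\<Sum>n. m / 2 * (1/2) ^ n)"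
      using m(1) A by (intro sum_le_suminf summable_mult summable_geometric) auto
    also have "\<dots> = m" by (subst suminf_mult) (auto simp: suminf_geometric)
    finally show "(\<Sum>n\<in>A. ?N (x' n - x n)) \<le> m" .
  qed (use x_mem x'_mem in auto)
  moreover have x'Z: "dominates ?N x' (garling_norm w' p') Z" and Zx': "dominates (garling_norm w' p') Z ?N x'"
    unfolding x'_def Z_def by (intro dominates_combinations b)+
  ultimately have xZ: "dominates ?N x (garling_norm w' p') Z" by (blast intro: dominates_trans)
  have supp: "\<exists>B. \<forall>i\<ge>B. Z n i = 0" for n
  proof -
    obtain B where B: "\<And>k i. i \<ge> B k \<Longrightarrow> b k i = 0" using b(2) by metis
    have "Z n i = 0" if "i \<ge> (\<Sum>k<\<mu> n. B k)" for i
      unfolding Z_def comb_apply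
    proof (intro sum.neutral ballI)
      fix k assume "k \<in> {..<\<mu> n}"
      then have "B k \<le> i" using member_le_sum[of k "{..<\<mu> n}" B] that by simp
      then show "c n k * b k i = 0" using B by simp
    qed
    then show ?thesis by blast
  qed
  obtain C where C: "0 < C" "\<And>a A. finite A \<Longrightarrow> ?N (comb a x' A) \<le> C * garling_norm w' p' (comb a Z A)"
    using Zx' unfolding dominates_def by blast
  have lower: "m / (2 * C) \<le> garling_norm w' p' (Z n)" for n
  proof -
    have "?N (x' n - x n) \<le> m / 2 * (1/2) ^ n" using \<mu>[of n] by (simp add: x'_def)
    also have "\<dots> \<le> m / 2 * 1" using m(1) by (intro mult_left_mono power_le_one) auto
    finally have "m / 2 \<le> ?N (x' n)"
      using N_le_diff[OF x_mem x'_mem, of n n] m(2)[of n] N_commute[of "x n" "x' n"] by linarith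
    also have "?N (x' n) \<le> C * garling_norm w' p' (Z n)"
      using C(2)[of "{n}" "\<lambda>_. 1"] by (simp add: comb_def)
    finally show ?thesis using C(1) by (simp add: field_simps)
  qed
  have sup: "\<exists>n0. \<forall>n\<ge>n0. \<forall>i. norm (Z n i) \<le> e" if e: "0 < e" for e
  proof -
    have "0 < e / (M + 1)" using e M0 by simp
    then obtain n0 where n0: "\<And>n k. n \<ge> n0 \<Longrightarrow> norm (c n k) \<le> e / (M + 1)" using small by blast
    have "norm (Z n i) \<le> e" if n: "n \<ge> n0" for n i
    proof (cases "\<exists>k\<in>{..<\<mu> n}. b k i \<noteq> 0")
      case True
      then obtain k where k: "k \<in> {..<\<mu> n}" "b k i \<noteq> 0" by blast
      have "b l i = 0" if "l \<noteq> k" for l using b(3)[OF k(2), of l] that by blast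
      then have "Z n i = c n k * b k i"
        unfolding Z_def comb_apply using k(1) by (subst sum.remove[OF _ k(1)]) (auto intro!: sum.neutral)
      also have "norm \<dots> \<le> e / (M + 1) * M"
        unfolding norm_mult using n0[OF n, of k] G.coord_le_norm[OF b_mem, of k i] b(4)[of k] M0 e
        by (intro mult_mono) auto
      also have "\<dots> \<le> e" using M0 e by (simp add: field_simps)
      finally show ?thesis .
    next
      case False
      then have "Z n i = 0" unfolding Z_def comb_apply by (intro sum.neutral) auto
      then show ?thesis using e by simp
    qed
    then show ?thesis by blast
  qed
  obtain \<psi> :: "nat \<Rightarrow> nat" where \<psi>: "strict_mono \<psi>"
    "dominates (garling_norm w' p') (Z \<circ> \<psi>) (garling_norm (\<lambda>_. 1) p') unit_vec"
  proof (rule G.vanishing_coefficients_dominate_ell[OF supp _ lower sup])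
    show "0 < m / (2 * C)" using m(1) C(1) by simp
  qed
  have "dominates ?N (x \<circ> \<psi>) (garling_norm w' p') (Z \<circ> \<psi>)"
    by (rule dominates_subseq[OF xZ strict_mono_imp_inj_on[OF \<psi>(1)]])
  moreover have "dominates (garling_norm (\<lambda>_. 1) p') unit_vec (garling_norm w' p') b"
    by (rule G.ell_dominates_disjoint[OF b(3) b_mem b(4)])
  ultimately show ?thesis
    using subsymmetric_dominates_subseq(1)[OF x \<psi>(1)] \<psi>(2) b(6) by (blast intro: dominates_trans)
qed

text \<open>The three cases are distinguished by the coordinates \<open>c (x n) k\<close> of \<open>x n\<close> with respect to \<open>y\<close>.\<close>

lemma subsymmetric_dominates:
  fixes x y :: "nat \<Rightarrow> nat \<Rightarrow> 'a::{real_normed_field, euclidean_space}"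
  assumes ns: "\<not> summable w"
    and x: "subsymmetric gspace gnorm x"
    and y: "subsymmetric gspace gnorm y"
    and xy: "range x \<subseteq> closed_span gspace gnorm y"
  shows "dominates gnorm x gnorm y"
proof -
  interpret banach_seq "gspace :: (nat \<Rightarrow> 'a) set" "gnorm" by (rule banach)
  let ?N = "gnorm :: (nat \<Rightarrow> 'a) \<Rightarrow> real" and ?X = "gspace :: (nat \<Rightarrow> 'a) set"
  note ry = subsymmetric_range[OF y]
  have y_mem: "y k \<in> ?X" for k using ry by auto
  obtain Kx where Kx: "0 < Kx" "mult_bounded ?N x Kx"
    using unconditional_coordinates[of x] x unfolding subsymmetric_def by metis
  have unc: "unconditional ?X ?N y" using y by (simp add: subsymmetric_def)
  obtain c K where K: "0 < K" "mult_bounded ?N y K"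
    and c_lim': "\<forall>f\<in>closed_span ?X ?N y. (\<lambda>n. ?N (comb (c f) y {..<n} - f)) \<longlonglongrightarrow> 0"
    and c_proj': "\<forall>f\<in>closed_span ?X ?N y. \<forall>A. finite A \<longrightarrow> ?N (comb (c f) y A) \<le> K * ?N f"
    and c_comb': "\<forall>a u A k. range u \<subseteq> closed_span ?X ?N y \<longrightarrow> c (comb a u A) k = (\<Sum>i\<in>A. a i * c (u i) k)"
    by (rule unconditional_coordinates[OF unc]) (rule that)
  note c_lim = bspec[OF c_lim'] and c_comb = c_comb'[rule_format] and c_proj = c_proj'[rule_format]
  obtain m My where m: "0 < m" "\<And>k. m \<le> ?N (y k)" and My: "\<And>k. ?N (y k) \<le> My"
    using subsymmetric_seminormalized[OF y] by blast
  interpret Y: banach_seq "closed_span ?X ?N y" ?N by (rule closed_span_banach[OF ry])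
  have x_Y: "x k \<in> closed_span ?X ?N y" for k using xy by auto
  have comb_Y: "comb a x A \<in> closed_span ?X ?N y" for a A by (intro Y.comb_mem x_Y)
  have coord: "norm (c f k) \<le> K / m * ?N f" if f: "f \<in> closed_span ?X ?N y" for f k
  proof -
    have "norm (c f k) * m \<le> norm (c f k) * ?N (y k)" using m by (intro mult_left_mono) auto
    also have "\<dots> = ?N (comb (c f) y {k})" by (simp add: comb_def N_scale y_mem)
    also have "\<dots> \<le> K * ?N f" by (rule c_proj[OF f]) auto
    finally show ?thesis using m(1) by (simp add: field_simps)
  qed
  have coord_lim: "(\<lambda>k. c f k) \<longlonglongrightarrow> 0" if f: "f \<in> closed_span ?X ?N y" for f
  proof -
    let ?S = "\<lambda>n. comb (c f) y {..<n}"
    have fX: "f \<in> ?X" using f closed_span_subset[OF ry] by auto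
    have S_mem: "?S n \<in> ?X" for n by (intro comb_mem y_mem)
    have "norm (c f k) \<le> 1 / m * (?N (?S (Suc k) - f) + ?N (?S k - f))" for k
    proof -
      have "norm (c f k) * m \<le> norm (c f k) * ?N (y k)" using m by (intro mult_left_mono) auto
      also have "\<dots> = ?N (seq_scale (c f k) (y k))" by (simp add: N_scale y_mem)
      also have "seq_scale (c f k) (y k) = ?S (Suc k) - ?S k" by (simp add: comb_def)
      also have "?N \<dots> \<le> ?N (?S (Suc k) - f) + ?N (f - ?S k)" by (intro N_triangle3 S_mem fX)
      finally show ?thesis using m(1) N_commute[of f "?S k"] by (simp add: field_simps)
    qed
    then have le: "\<forall>k. norm (c f k) \<le> 1 / m * (?N (?S (Suc k) - f) + ?N (?S k - f))" by blast
    have "(\<lambda>k. 1 / m * (?N (?S (Suc k) - f) + ?N (?S k - f))) \<longlonglongrightarrow> 1 / m * (0 + 0)"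
      by (intro tendsto_mult tendsto_const tendsto_add c_lim[OF f] LIMSEQ_Suc[OF c_lim[OF f]])
    then have "(\<lambda>k. 1 / m * (?N (?S (Suc k) - f) + ?N (?S k - f))) \<longlonglongrightarrow> 0" by simp
    then show ?thesis by (rule Lim_null_comparison[OF always_eventually[OF le]])
  qed
  show ?thesis
  proof (cases "\<exists>k. \<not> (\<lambda>n. c (x n) k) \<longlonglongrightarrow> 0")
    case True
    then obtain k where k: "\<not> (\<lambda>n. c (x n) k) \<longlonglongrightarrow> 0" by blast
    have "dominates ?N x (garling_norm (\<lambda>_. 1) 1) unit_vec"
      by (rule not_null_dominates_ell1[OF x c_comb[OF xy] coord[OF comb_Y] _ k]) (use K m in simp)
    then show ?thesis by (rule dominates_trans[OF _ ell1_dominates[OF ry My]])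
  next
    case False
    then have null: "(\<lambda>n. c (x n) k) \<longlonglongrightarrow> 0" for k by blast
    show ?thesis
    proof (cases "\<exists>\<delta>>0. \<forall>n0. \<exists>n\<ge>n0. \<exists>k. \<delta> < norm (c (x n) k)")
      case True
      then obtain \<delta> where \<delta>: "0 < \<delta>" "\<And>n0. \<exists>n\<ge>n0. \<exists>k. \<delta> < norm (c (x n) k)" by blast
      have "?N (comb (c (comb a x A)) y B) \<le> K * ?N (comb a x A)" if "finite B" for a A B
        by (rule c_proj[OF comb_Y that])
      then show ?thesis
        by (rule dominates_if_large_coordinates[OF x y Kx K _ c_comb[OF xy] coord_lim[OF x_Y] null \<delta>])
    next
      case False
      then have "\<exists>n0. \<forall>n\<ge>n0. \<forall>k. norm (c (x n) k) \<le> e" if "0 < e" for e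
        using that by (meson not_less)
      then show ?thesis
        by (rule dominates_if_small_coordinates[OF ns x y c_lim[OF x_Y]])
    qed
  qed
qed

lemma subsymmetric_basis_equivalent:
  fixes x y :: "nat \<Rightarrow> nat \<Rightarrow> 'a::{real_normed_field, euclidean_space}"
  assumes ns: "\<not> summable w"
    and y: "subsymmetric gspace gnorm y"
    and x: "subsymmetric_basis gspace gnorm
      (closed_span gspace gnorm y) x"
  shows "equivalent_seqs gnorm x y"
proof -
  interpret banach_seq "gspace :: (nat \<Rightarrow> 'a) set" "gnorm" by (rule banach)
  let ?N = "gnorm :: (nat \<Rightarrow> 'a) \<Rightarrow> real" and ?X = "gspace :: (nat \<Rightarrow> 'a) set"
  have sx: "subsymmetric ?X ?N x" and sb: "schauder_basis ?X ?N (closed_span ?X ?N y) x"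
    using x by (auto simp: subsymmetric_basis_def)
  have xy: "range x \<subseteq> closed_span ?X ?N y" using sb by (simp add: schauder_basis_def)
  note rx = subsymmetric_range[OF sx] and ry = subsymmetric_range[OF y]
  have "y k \<in> closed_span ?X ?N x" for k
  proof -
    have "y k \<in> closed_span ?X ?N y" using range_subset_closed_span[OF ry] by auto
    then obtain a where lim: "(\<lambda>n. ?N (comb a x {..<n} - y k)) \<longlonglongrightarrow> 0"
      using sb unfolding schauder_basis_def limitin_norm_topology comb_def by blast
    show ?thesis
      by (rule lim_in_closed_span[OF rx _ lim]) (use ry span_subset_closed_span[OF rx comb_in_span] in auto)
  qed
  then have yx: "range y \<subseteq> closed_span ?X ?N x" by auto
  show ?thesis
    unfolding equivalent_seqs_iff_dominates[of ?N, OF norm_nonneg]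
    using subsymmetric_dominates[OF ns sx y xy] subsymmetric_dominates[OF ns y sx yx] by blast
qed

end

theorem theorem4p1:
  fixes p :: real and w :: "nat \<Rightarrow> real"
  assumes "1 \<le> p" and "w \<in> weights"
  shows "(\<forall>y :: nat \<Rightarrow> nat \<Rightarrow> 'a::{real_normed_field, euclidean_space}.
            subsymmetric (garling_space w p) (garling_norm w p) y \<longrightarrow>
            (\<forall>x. subsymmetric_basis (garling_space w p) (garling_norm w p)
                   (closed_span (garling_space w p) (garling_norm w p) y) x \<longrightarrow>
                 equivalent_seqs (garling_norm w p) x y)) \<and>
         (\<forall>x :: nat \<Rightarrow> nat \<Rightarrow> 'a.
            subsymmetric_basis (garling_space w p) (garling_norm w p) (garling_space w p) x \<longrightarrow>
            equivalent_seqs (garling_norm w p) x unit_vec)"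
proof -
  interpret garling w p
    using assms by unfold_locales (auto simp: weights_def intro: less_imp_le)
  have ns: "\<not> summable w" using assms(2) by (simp add: weights_def)
  show ?thesis
  proof (intro conjI allI impI)
    fix x :: "nat \<Rightarrow> nat \<Rightarrow> 'a"
    assume "subsymmetric_basis (garling_space w p) (garling_norm w p) (garling_space w p) x"
    then show "equivalent_seqs (garling_norm w p) x unit_vec"
      by (intro subsymmetric_basis_equivalent[OF ns unit_vec_subsymmetric[OF ns]])
        (simp add: closed_span_unit_vec[OF ns])
  qed (rule subsymmetric_basis_equivalent[OF ns])
qed

end
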